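(* Let $\mathcal M$ be a compact connected Riemannian manifold without boundary and let $W\in C_b(\mathcal M\times\mathcal M)\cap H^1(\mathcal M\times\mathcal M)$ be symmetric. For $\rho\in H^1(\mathcal M)\cap\mathcal P_{ac}^+(\mathcal M)$ and $\gamma>0$ the following statements are equivalent: 1. $\rho$ is a weak solution of the stationary McKean–Vlasov equation $\gamma^{-1}\Delta\rho+\mathrm{div}(\rho\nabla_xW(x,\cdot)*\rho)=0$; 2. $(\rho,\gamma)$ is a zero of the Gibbs map, i.e. $\rho=\dfrac{1}{Z(\gamma,\rho)}e^{-\gamma W*\rho}$ with $Z(\gamma,\rho)=\int_{\mathcal M}e^{-\gamma W*\rho}dm$; 3. $\rho$ is a critical point of the free energy functional $\mathcal F_\gamma$.
   Context: $m$ is the volume measure, $g$ the metric; $(W*\rho)(x)=\int W(x,y)\rho(y)dm(y)$ and $(\nabla_xW(x,\cdot)*\rho)(x)=\int\nabla_xW(x,y)\rho(y)dm(y)$. $\mathcal P_{ac}(\mathcal M)$ denotes the probability densities w.r.t. $m$ and $\mathcal P_{ac}^+(\mathcal M)$ those which are positive $m$-a.e. Weak solution: $\rho\in H^1(\mathcal M)\cap\mathcal P_{ac}(\mathcal M)$ such that for every $\phi\in H^1(\mathcal M)$, $\gamma^{-1}\int g(\nabla\rho,\nabla\phi)dm+\int g(\rho\nabla\phi,\nabla_xW(x,\cdot)*\rho)dm=0$. Free energy: $\mathcal F_\gamma(\rho)=\gamma^{-1}\int\rho\log\rho\,dm+\frac12\iint W(x,y)\rho(x)\rho(y)\,dm(x)dm(y)$.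 Critical point: for every $\rho'\in\mathcal P_{ac}(\mathcal M)$ with $\int\rho'\log\rho'dm<\infty$, the one-sided derivative at $s=0^+$ of $s\mapsto\mathcal F_\gamma(s\rho'+(1-s)\rho)$ exists and equals $0$. *)

theory Defs
  imports "HOL-Analysis.Analysis"
begin

section \<open>Smooth maps between open subsets of normed spaces\<close>

text \<open>The set \<open>S\<close> is meant to be open; higher derivatives are taken direction by direction,
  which avoids a change of type in the recursion.\<close>

primrec Ck_on ::
  "nat \<Rightarrow> 'a::real_normed_vector set \<Rightarrow> ('a \<Rightarrow> 'b::real_normed_vector) \<Rightarrow> bool" where
  "Ck_on 0 S f = continuous_on S f"
| "Ck_on (Suc k) S f =
     ((\<forall>x\<in>S. f differentiable (at x)) \<and> (\<forall>v. Ck_on k S (\<lambda>x. frechet_derivative f (at x) v)))"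

definition smooth_on :: "'a::real_normed_vector set \<Rightarrow> ('a \<Rightarrow> 'b::real_normed_vector) \<Rightarrow> bool" where
  "smooth_on S f \<longleftrightarrow> (\<forall>k. Ck_on k S f)"

definition test_functions :: "'e::euclidean_space set \<Rightarrow> ('e \<Rightarrow> real) set" where
  "test_functions S =
     {\<psi>. smooth_on UNIV \<psi> \<and> compact (closure {u. \<psi> u \<noteq> 0}) \<and> closure {u. \<psi> u \<noteq> 0} \<subseteq> S}"

definition locally_integrable_on ::
  "('e::euclidean_space \<Rightarrow> 'b::{banach, second_countable_topology}) \<Rightarrow> 'e set \<Rightarrow> bool" where
  "locally_integrable_on f S \<longleftrightarrow> (\<forall>K. compact K \<longrightarrow> K \<subseteq> S \<longrightarrow> set_integrable lborel K f)"


section \<open>Riemannian manifolds\<close>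

text \<open>The underlying topological space is the whole type \<open>'m\<close>; \<open>'e\<close> is the model space.
  Charts are indexed by \<open>chart_ix\<close>, chart \<open>i\<close> being the map \<open>coord i\<close> on \<open>chart_dom i\<close>.
  Tangent vectors at \<open>x\<close> are handled through their components in the charts around \<open>x\<close>:
  \<open>metric i x v w\<close> is $g_x$ applied to the tangent vectors with components
  \<open>v\<close>, \<open>w\<close> in chart \<open>i\<close>.\<close>

record ('i, 'm, 'e) riem =
  chart_ix :: "'i set"
  chart_dom :: "'i \<Rightarrow> 'm set"
  coord :: "'i \<Rightarrow> 'm \<Rightarrow> 'e"
  metric :: "'i \<Rightarrow> 'm \<Rightarrow> 'e \<Rightarrow> 'e \<Rightarrow> real"

definition chart_img :: "('i, 'm, 'e) riem \<Rightarrow> 'i \<Rightarrow> 'e set" where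
  "chart_img M i = coord M i ` chart_dom M i"

definition chart_inv :: "('i, 'm, 'e) riem \<Rightarrow> 'i \<Rightarrow> 'e \<Rightarrow> 'm" where
  "chart_inv M i = inv_into (chart_dom M i) (coord M i)"

text \<open>Differential at \<open>x\<close> of the change of coordinates from chart \<open>i\<close> to chart \<open>j\<close>.\<close>

definition trans_deriv ::
  "('i, 'm, 'e::euclidean_space) riem \<Rightarrow> 'i \<Rightarrow> 'i \<Rightarrow> 'm \<Rightarrow> 'e \<Rightarrow> 'e" where
  "trans_deriv M i j x = frechet_derivative (coord M j \<circ> chart_inv M i) (at (coord M i x))"

locale riemannian_manifold =
  fixes M :: "('i, 'm::{t2_space, second_countable_topology}, 'e::euclidean_space) riem"
  assumes charts_cover: "(\<Union>i\<in>chart_ix M. chart_dom M i) = UNIV"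
    and chart_dom_open: "i \<in> chart_ix M \<Longrightarrow> open (chart_dom M i)"
    and chart_img_open: "i \<in> chart_ix M \<Longrightarrow> open (chart_img M i)"
    and chart_homeomorphism: "i \<in> chart_ix M \<Longrightarrow>
      homeomorphism (chart_dom M i) (chart_img M i) (coord M i) (chart_inv M i)"
    and transition_smooth: "i \<in> chart_ix M \<Longrightarrow> j \<in> chart_ix M \<Longrightarrow>
      smooth_on (coord M i ` (chart_dom M i \<inter> chart_dom M j)) (coord M j \<circ> chart_inv M i)"
    and metric_bilinear: "i \<in> chart_ix M \<Longrightarrow> x \<in> chart_dom M i \<Longrightarrow> bilinear (metric M i x)"
    and metric_sym: "i \<in> chart_ix M \<Longrightarrow> x \<in> chart_dom M i \<Longrightarrow>
      metric M i x v w = metric M i x w v"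
    and metric_pos: "i \<in> chart_ix M \<Longrightarrow> x \<in> chart_dom M i \<Longrightarrow> v \<noteq> 0 \<Longrightarrow>
      metric M i x v v > 0"
    and metric_smooth: "i \<in> chart_ix M \<Longrightarrow>
      smooth_on (chart_img M i) (\<lambda>u. metric M i (chart_inv M i u) v w)"
    and metric_transform: "i \<in> chart_ix M \<Longrightarrow> j \<in> chart_ix M \<Longrightarrow>
      x \<in> chart_dom M i \<inter> chart_dom M j \<Longrightarrow>
      metric M i x v w = metric M j x (trans_deriv M i j x v) (trans_deriv M i j x w)"

text \<open>The volume measure is the unique Borel measure that in every chart is
  $\sqrt{\det (g_{ab})}\,du$.\<close>

definition riemannian_volume ::
  "('i, 'm::topological_space, real ^ 'n) riem \<Rightarrow> 'm measure \<Rightarrow> bool" where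
  "riemannian_volume M m \<longleftrightarrow>
     sets m = sets borel \<and>
     (\<forall>i\<in>chart_ix M. \<forall>A\<in>sets borel. A \<subseteq> chart_dom M i \<longrightarrow>
        emeasure m A =
          (\<integral>\<^sup>+u. ennreal (sqrt (det (\<chi> a b. metric M i (chart_inv M i u) (axis a 1) (axis b 1))))
                * indicator (coord M i ` A) u \<partial>lborel))"

definition prod_riem ::
  "('i, 'm, 'e) riem \<Rightarrow> ('j, 'n, 'f) riem \<Rightarrow> ('i \<times> 'j, 'm \<times> 'n, 'e \<times> 'f) riem" where
  "prod_riem M N =
     \<lparr> chart_ix = chart_ix M \<times> chart_ix N,
       chart_dom = (\<lambda>(i, j). chart_dom M i \<times> chart_dom N j),
       coord = (\<lambda>(i, j) (x, y). (coord M i x, coord N j y)),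
       metric = (\<lambda>(i, j) (x, y) (v, v') (w, w'). metric M i x v w + metric N j y v' w') \<rparr>"


section \<open>Vector fields, weak gradients and the Sobolev space\<close>

type_synonym ('i, 'm, 'e) vfield = "'i \<Rightarrow> 'm \<Rightarrow> 'e"

text \<open>A (not necessarily continuous) section of the tangent bundle is the family of its components
  in all charts, subject to the transformation rule at every point. Hence an expression formed
  with the chart picked by \<open>chart_at\<close> does not depend on that choice.\<close>

definition vector_field :: "('i, 'm, 'e::euclidean_space) riem \<Rightarrow> ('i, 'm, 'e) vfield \<Rightarrow> bool" where
  "vector_field M X \<longleftrightarrow>
     (\<forall>i\<in>chart_ix M. \<forall>j\<in>chart_ix M. \<forall>x\<in>chart_dom M i \<inter> chart_dom M j.
        X j x = trans_deriv M i j x (X i x))"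

definition chart_at :: "('i, 'm, 'e) riem \<Rightarrow> 'm \<Rightarrow> 'i" where
  "chart_at M x = (SOME i. i \<in> chart_ix M \<and> x \<in> chart_dom M i)"

definition rinner ::
  "('i, 'm, 'e) riem \<Rightarrow> ('i, 'm, 'e) vfield \<Rightarrow> ('i, 'm, 'e) vfield \<Rightarrow> 'm \<Rightarrow> real" where
  "rinner M X Y x = metric M (chart_at M x) x (X (chart_at M x) x) (Y (chart_at M x) x)"

text \<open>\<open>X\<close> is a weak gradient of \<open>f\<close> if in every chart the covector $g(X, \cdot)$ is the
  distributional differential of the coordinate expression of \<open>f\<close>.\<close>

definition weak_gradient ::
  "('i, 'm, 'e::euclidean_space) riem \<Rightarrow> ('m \<Rightarrow> real) \<Rightarrow> ('i, 'm, 'e) vfield \<Rightarrow> bool" where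
  "weak_gradient M f X \<longleftrightarrow>
     vector_field M X \<and>
     (\<forall>i\<in>chart_ix M.
        locally_integrable_on (\<lambda>u. f (chart_inv M i u)) (chart_img M i) \<and>
        locally_integrable_on (\<lambda>u. X i (chart_inv M i u)) (chart_img M i) \<and>
        (\<forall>\<psi>\<in>test_functions (chart_img M i). \<forall>w.
           (LINT u:chart_img M i|lborel. f (chart_inv M i u) * frechet_derivative \<psi> (at u) w) =
           - (LINT u:chart_img M i|lborel.
                metric M i (chart_inv M i u) (X i (chart_inv M i u)) w * \<psi> u)))"

text \<open>Elements of the Sobolev space are represented by functions; the weak gradient is unique
  up to null sets.\<close>

definition grad :: "('i, 'm, 'e::euclidean_space) riem \<Rightarrow> ('m \<Rightarrow> real) \<Rightarrow> ('i, 'm, 'e) vfield" where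
  "grad M f = (SOME X. weak_gradient M f X)"

definition H1 :: "('i, 'm, 'e::euclidean_space) riem \<Rightarrow> 'm measure \<Rightarrow> ('m \<Rightarrow> real) set" where
  "H1 M m =
     {f. f \<in> borel_measurable m \<and> integrable m (\<lambda>x. (f x)\<^sup>2) \<and>
         (\<exists>X. weak_gradient M f X \<and> integrable m (rinner M X X))}"


section \<open>The stationary McKean--Vlasov equation\<close>

definition P_ac :: "'m measure \<Rightarrow> ('m \<Rightarrow> real) set" where
  "P_ac m = {\<rho>. integrable m \<rho> \<and> (AE x in m. \<rho> x \<ge> 0) \<and> (\<integral>x. \<rho> x \<partial>m) = 1}"

definition P_ac_pos :: "'m measure \<Rightarrow> ('m \<Rightarrow> real) set" where
  "P_ac_pos m = {\<rho> \<in> P_ac m. AE x in m. \<rho> x > 0}"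

definition conv :: "'m measure \<Rightarrow> ('m \<Rightarrow> 'm \<Rightarrow> real) \<Rightarrow> ('m \<Rightarrow> real) \<Rightarrow> 'm \<Rightarrow> real" where
  "conv m W \<rho> x = (\<integral>y. W x y * \<rho> y \<partial>m)"

text \<open>The first component of the weak gradient of \<open>W\<close> on the product manifold, with respect to
  $T_{(x,y)}(M \times M) = T_x M \times T_y M$; its components in chart \<open>i\<close> around \<open>x\<close> do not
  depend on the chart used around \<open>y\<close>.\<close>

definition grad_fst ::
  "('i, 'm, 'e::euclidean_space) riem \<Rightarrow> ('m \<Rightarrow> 'm \<Rightarrow> real) \<Rightarrow> 'i \<Rightarrow> 'm \<Rightarrow> 'm \<Rightarrow> 'e" where
  "grad_fst M W i x y = fst (grad (prod_riem M M) (\<lambda>(x, y). W x y) (i, chart_at M y) (x, y))"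

definition conv_grad ::
  "('i, 'm, 'e::euclidean_space) riem \<Rightarrow> 'm measure \<Rightarrow> ('m \<Rightarrow> 'm \<Rightarrow> real) \<Rightarrow> ('m \<Rightarrow> real)
     \<Rightarrow> ('i, 'm, 'e) vfield" where
  "conv_grad M m W \<rho> i x = (\<integral>y. \<rho> y *\<^sub>R grad_fst M W i x y \<partial>m)"

text \<open>The weak formulation includes the existence of the drift integral: for \<open>\<rho>\<close>, \<open>\<phi>\<close> and \<open>W\<close>
  merely of class $H^1$ its integrand need not be integrable, and the Bochner integral
  would then silently be 0. The first integrand is integrable by Cauchy--Schwarz.\<close>

definition weak_solution ::
  "('i, 'm, 'e::euclidean_space) riem \<Rightarrow> 'm measure \<Rightarrow> ('m \<Rightarrow> 'm \<Rightarrow> real) \<Rightarrow> real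
     \<Rightarrow> ('m \<Rightarrow> real) \<Rightarrow> bool" where
  "weak_solution M m W \<gamma> \<rho> \<longleftrightarrow>
     \<rho> \<in> H1 M m \<inter> P_ac m \<and>
     (\<forall>\<phi>\<in>H1 M m.
        integrable m (rinner M (\<lambda>i x. \<rho> x *\<^sub>R grad M \<phi> i x) (conv_grad M m W \<rho>)) \<and>
        inverse \<gamma> * (\<integral>x. rinner M (grad M \<rho>) (grad M \<phi>) x \<partial>m)
          + (\<integral>x. rinner M (\<lambda>i x. \<rho> x *\<^sub>R grad M \<phi> i x) (conv_grad M m W \<rho>) x \<partial>m) = 0)"

definition partition_fn :: "'m measure \<Rightarrow> ('m \<Rightarrow> 'm \<Rightarrow> real) \<Rightarrow> real \<Rightarrow> ('m \<Rightarrow> real) \<Rightarrow> real" where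
  "partition_fn m W \<gamma> \<rho> = (\<integral>x. exp (- \<gamma> * conv m W \<rho> x) \<partial>m)"

text \<open>Equality of densities is equality almost everywhere.\<close>

definition gibbs_zero :: "'m measure \<Rightarrow> ('m \<Rightarrow> 'm \<Rightarrow> real) \<Rightarrow> real \<Rightarrow> ('m \<Rightarrow> real) \<Rightarrow> bool" where
  "gibbs_zero m W \<gamma> \<rho> \<longleftrightarrow>
     (AE x in m. \<rho> x = 1 / partition_fn m W \<gamma> \<rho> * exp (- \<gamma> * conv m W \<rho> x))"

definition free_energy :: "'m measure \<Rightarrow> ('m \<Rightarrow> 'm \<Rightarrow> real) \<Rightarrow> real \<Rightarrow> ('m \<Rightarrow> real) \<Rightarrow> real" where
  "free_energy m W \<gamma> \<rho> =
     inverse \<gamma> * (\<integral>x. \<rho> x * ln (\<rho> x) \<partial>m)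
       + 1 / 2 * (\<integral>x. (\<integral>y. W x y * \<rho> x * \<rho> y \<partial>m) \<partial>m)"

text \<open>On a finite measure space the negative part of \<open>\<rho>' ln \<rho>'\<close> is bounded, so that finiteness of
  the entropy is integrability. The convention \<open>ln 0 = 0\<close> gives $0 \log 0 = 0$.\<close>

definition critical_point :: "'m measure \<Rightarrow> ('m \<Rightarrow> 'm \<Rightarrow> real) \<Rightarrow> real \<Rightarrow> ('m \<Rightarrow> real) \<Rightarrow> bool" where
  "critical_point m W \<gamma> \<rho> \<longleftrightarrow>
     (\<forall>\<rho>'\<in>P_ac m. integrable m (\<lambda>x. \<rho>' x * ln (\<rho>' x)) \<longrightarrow>
        ((\<lambda>s. free_energy m W \<gamma> (\<lambda>x. s * \<rho>' x + (1 - s) * \<rho> x)) has_real_derivative 0)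
          (at_right 0))"

end

theory Submission
  imports Defs
begin

text \<open>Write \<open>V = W * \<rho>\<close>. That the Gibbs equation characterises the critical points is a fact about finite
  measures. The one-sided derivative of the free energy at \<open>\<rho>\<close> towards \<open>\<rho>'\<close> is the integral of
  \<open>(\<rho>' - \<rho>) (\<gamma>\<^sup>-\<^sup>1 ln \<rho> + V)\<close> (\<open>free_energy_derivative\<close>). If \<open>\<rho>\<close> is a Gibbs density, the second factor is
  constant and the derivative vanishes because the masses agree. Conversely, a tilt of \<open>\<rho>\<close> by a bounded
  increasing function of the second factor turns the derivative into a covariance that is zero only
  for a constant (\<open>critical_imp_gibbs\<close>).

  For the weak equation let \<open>f = \<rho> e\<^sup>\<gamma>\<^sup>V\<close>. The flux \<open>\<gamma>\<^sup>-\<^sup>1 \<nabla>\<rho> + \<rho> \<nabla>V\<close> is a positive multiple of \<open>\<nabla>f\<close>, and the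
  Gibbs equation says that \<open>f\<close> is constant. Testing with \<open>f\<close> itself is not possible: \<open>\<rho>\<close> and \<open>\<nabla>V\<close> are only
  square integrable, so \<open>\<rho> \<nabla>V\<close>, and with it \<open>\<nabla>f\<close>, is merely integrable. But \<open>\<phi> = arctan f\<close> belongs to
  \<open>H\<^sup>1\<close>, since the factor \<open>1 / (1 + f\<^sup>2)\<close> in \<open>\<nabla>\<phi>\<close> also controls the term with \<open>f \<nabla>V\<close>. The weak equation for
  this \<open>\<phi>\<close> has a nonnegative integrand and yields \<open>\<nabla>\<phi> = 0\<close>, and connectedness makes \<open>\<phi>\<close> constant
  (\<open>weak_solution_imp_gibbs\<close>). The other direction is the chain rule for \<open>e\<^sup>-\<^sup>\<gamma>\<^sup>V / Z\<close>.

  This needs four facts on weak gradients: a chain rule in two variables (\<open>weak_gradient_chain\<close>), the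
  constancy of functions with vanishing weak gradient (\<open>weak_gradient_zero_imp_const\<close>), the uniqueness of
  weak gradients (\<open>weak_gradient_unique\<close>), which relates the chosen gradient to a computed one, and that
  \<open>V\<close> has the square integrable weak gradient \<open>\<integral> \<nabla>\<^sub>xW(x, y) \<rho>(y) dm(y)\<close> (\<open>weak_gradient_conv\<close>,
  \<open>conv_grad_square_integrable\<close>). The first two rest on one identity in the charts: the increment of \<open>f\<close>
  over a translation by \<open>w\<close> is almost everywhere the average of its weak derivative over the segment
  (\<open>weak_dir_deriv_translation\<close>).\<close>

section \<open>Smooth functions and bump functions\<close>

lemma Ck_on_Suc_UNIV:
  "Ck_on (Suc k) UNIV f \<Longrightarrow> Ck_on k UNIV f"
proof (induction k arbitrary: f)
  case 0
  then show ?case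
    by (auto intro!: differentiable_imp_continuous_on simp: differentiable_on_def)
next
  case (Suc k)
  then show ?case by (metis Ck_on.simps(2))
qed

lemma Ck_on_const: "Ck_on k UNIV (\<lambda>x. c)"
proof (induction k arbitrary: c)
  case (Suc k)
  have "frechet_derivative (\<lambda>x. c) (at x) = (\<lambda>v. 0)" for x :: 'a
    by (rule frechet_derivative_at[symmetric]) (rule has_derivative_const)
  with Suc show ?case by simp
qed simp

lemma Ck_on_add:
  "Ck_on k UNIV f \<Longrightarrow> Ck_on k UNIV g \<Longrightarrow> Ck_on k UNIV (\<lambda>x. f x + g x)"
proof (induction k arbitrary: f g)
  case 0 then show ?case by (simp add: continuous_on_add)
next
  case (Suc k)
  have "frechet_derivative (\<lambda>x. f x + g x) (at x) =
      (\<lambda>v. frechet_derivative f (at x) v + frechet_derivative g (at x) v)" for x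
    by (rule frechet_derivative_at[symmetric])
       (use Suc.prems in \<open>auto intro!: has_derivative_add simp: frechet_derivative_works[symmetric]\<close>)
  with Suc show ?case by (auto intro: differentiable_add)
qed

lemma Ck_on_mult:
  fixes f g :: "'a::real_normed_vector \<Rightarrow> real"
  shows "Ck_on k UNIV f \<Longrightarrow> Ck_on k UNIV g \<Longrightarrow> Ck_on k UNIV (\<lambda>x. f x * g x)"
proof (induction k arbitrary: f g)
  case 0 then show ?case by (simp add: continuous_on_mult)
next
  case (Suc k)
  have "frechet_derivative (\<lambda>x. f x * g x) (at x) =
      (\<lambda>v. f x * frechet_derivative g (at x) v + frechet_derivative f (at x) v * g x)" for x
    by (rule frechet_derivative_at[symmetric])
       (use Suc.prems in \<open>auto intro!: has_derivative_mult simp: frechet_derivative_works[symmetric]\<close>)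
  moreover have "Ck_on k UNIV f" "Ck_on k UNIV g"
    using Suc.prems by (auto intro: Ck_on_Suc_UNIV)
  ultimately show ?case using Suc by (auto intro!: Ck_on_add Suc.IH)
qed

text \<open>Translations, coordinate functionals and the two projections of a product are all of this form.\<close>

lemma Ck_on_compose_affine:
  assumes L: "bounded_linear L"
  shows "Ck_on k UNIV f \<Longrightarrow> Ck_on k UNIV (\<lambda>x. f (L x + c))"
proof (induction k arbitrary: f)
  case 0
  then show ?case
    by (auto intro!: continuous_on_compose2[of UNIV f] continuous_on_add
        linear_continuous_on[OF L])
next
  case (Suc k)
  have d: "((\<lambda>x. f (L x + c)) has_derivative (\<lambda>v. frechet_derivative f (at (L x + c)) (L v))) (at x)" for x
  proof -
    have "(f has_derivative frechet_derivative f (at (L x + c))) (at (L x + c))"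
      using Suc.prems by (auto simp: frechet_derivative_works[symmetric])
    moreover have "((\<lambda>x. L x + c) has_derivative L) (at x)"
      using has_derivative_add[OF bounded_linear_imp_has_derivative[OF L] has_derivative_const] by simp
    ultimately show ?thesis
      using diff_chain_at[of "\<lambda>x. L x + c" L x f] by (simp add: o_def)
  qed
  have "frechet_derivative (\<lambda>x. f (L x + c)) (at x) =
      (\<lambda>v. frechet_derivative f (at (L x + c)) (L v))" for x
    by (rule frechet_derivative_at[symmetric]) (rule d)
  moreover have "Ck_on k UNIV (\<lambda>x. frechet_derivative f (at (L x + c)) (L v))" for v
    using Suc.IH[of "\<lambda>x. frechet_derivative f (at x) (L v)"] Suc.prems by simp
  ultimately show ?case using d by (auto simp: differentiable_def)
qed

lemma smooth_on_const: "smooth_on UNIV (\<lambda>x. c)"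
  by (simp add: smooth_on_def Ck_on_const)

lemma smooth_on_mult:
  fixes f g :: "'a::real_normed_vector \<Rightarrow> real"
  shows "smooth_on UNIV f \<Longrightarrow> smooth_on UNIV g \<Longrightarrow> smooth_on UNIV (\<lambda>x. f x * g x)"
  by (simp add: smooth_on_def Ck_on_mult)

lemma smooth_on_compose_affine:
  "smooth_on UNIV f \<Longrightarrow> bounded_linear L \<Longrightarrow> smooth_on UNIV (\<lambda>x. f (L x + c))"
  by (simp add: smooth_on_def Ck_on_compose_affine)

lemma smooth_on_prod:
  fixes f :: "'i \<Rightarrow> 'a::real_normed_vector \<Rightarrow> real"
  assumes "\<And>i. i \<in> I \<Longrightarrow> smooth_on UNIV (f i)"
  shows "smooth_on UNIV (\<lambda>x. \<Prod>i\<in>I. f i x)"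
  using assms
  by (induction I rule: infinite_finite_induct) (auto intro: smooth_on_const smooth_on_mult)

text \<open>Multiplying \<open>exp (-1/t)\<close> by a polynomial in \<open>1/t\<close> gives a class of functions that is closed under
  differentiation, so that smoothness at \<open>0\<close> becomes an induction over the order.\<close>

definition flat_fun :: "real poly \<Rightarrow> real \<Rightarrow> real" where
  "flat_fun p t = (if t > 0 then poly p (1 / t) * exp (- 1 / t) else 0)"

lemma poly_over_exp_tendsto_0: "((\<lambda>x. poly p x / exp x) \<longlongrightarrow> (0::real)) at_top"
proof -
  have "((\<lambda>x. \<Sum>i\<le>degree p. coeff p i * (x ^ i / exp x)) \<longlongrightarrow> (\<Sum>i\<le>degree p. coeff p i * 0)) at_top"
    by (intro tendsto_sum tendsto_mult tendsto_const tendsto_power_div_exp_0)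
  then show ?thesis
    by (simp add: poly_altdef sum_divide_distrib)
qed

lemma flat_fun_tendsto_0: "(flat_fun p \<longlongrightarrow> 0) (at 0)"
proof -
  have "((\<lambda>t. poly p (inverse t) / exp (inverse t)) \<longlongrightarrow> (0::real)) (at_right 0)"
    by (rule filterlim_compose[OF poly_over_exp_tendsto_0 filterlim_inverse_at_top_right])
  then have "(flat_fun p \<longlongrightarrow> 0) (at_right 0)"
    by (rule Lim_transform_eventually)
       (auto simp: eventually_at_filter flat_fun_def exp_minus field_simps)
  moreover have "(flat_fun p \<longlongrightarrow> 0) (at_left 0)"
    by (rule Lim_transform_eventually[OF tendsto_const])
       (auto simp: eventually_at_filter flat_fun_def)
  ultimately show ?thesis by (simp add: filterlim_split_at)
qed

lemma flat_fun_has_real_derivative: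
  "(flat_fun p has_real_derivative flat_fun ([:0, 0, 1:] * (p - pderiv p)) t) (at t)"
proof (cases t "0::real" rule: linorder_cases)
  case less
  have "((\<lambda>_. 0) has_real_derivative 0) (at t)" by simp
  then have "(flat_fun p has_real_derivative 0) (at t)"
    by (rule has_field_derivative_transform_within_open[where S="{..<0}"])
       (use less in \<open>auto simp: flat_fun_def\<close>)
  with less show ?thesis by (simp add: flat_fun_def)
next
  case equal
  have "(flat_fun (pCons 0 p) \<longlongrightarrow> 0) (at 0)" by (rule flat_fun_tendsto_0)
  then have "((\<lambda>h. (flat_fun p (0 + h) - flat_fun p 0) / h) \<longlongrightarrow> 0) (at 0)"
    by (rule Lim_transform_eventually)
       (auto simp: eventually_at_filter flat_fun_def divide_simps)
  with equal show ?thesis by (simp add: DERIV_def flat_fun_def)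
next
  case greater
  have "((\<lambda>t. poly p (1 / t) * exp (- 1 / t)) has_real_derivative
      (poly (pderiv p) (1 / t) * (- 1 / t\<^sup>2)) * exp (- 1 / t) + (exp (- 1 / t) * (1 / t\<^sup>2)) * poly p (1 / t)) (at t)"
    using greater
    by (intro DERIV_mult DERIV_chain2[where f="poly p"] poly_DERIV DERIV_chain2[where f=exp] DERIV_exp)
       (auto intro!: derivative_eq_intros simp: power2_eq_square)
  then have "(flat_fun p has_real_derivative
      (poly (pderiv p) (1 / t) * (- 1 / t\<^sup>2)) * exp (- 1 / t) + (exp (- 1 / t) * (1 / t\<^sup>2)) * poly p (1 / t)) (at t)"
    by (rule has_field_derivative_transform_within_open[where S="{0<..}"])
       (use greater in \<open>auto simp: flat_fun_def\<close>)
  moreover have "(poly (pderiv p) (1 / t) * (- 1 / t\<^sup>2)) * exp (- 1 / t) + (exp (- 1 / t) * (1 / t\<^sup>2)) * poly p (1 / t)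
     = flat_fun ([:0, 0, 1:] * (p - pderiv p)) t"
    using greater by (simp add: flat_fun_def field_simps power2_eq_square)
  ultimately show ?thesis by simp
qed

lemma Ck_on_flat_fun: "Ck_on k UNIV (flat_fun p)"
proof (induction k arbitrary: p)
  case 0
  show ?case using flat_fun_has_real_derivative
    by (auto intro!: DERIV_continuous_on)
next
  case (Suc k)
  have d: "(flat_fun p has_derivative (\<lambda>v. flat_fun ([:0, 0, 1:] * (p - pderiv p)) t * v)) (at t)" for t
    using flat_fun_has_real_derivative by (simp add: has_field_derivative_def)
  have "frechet_derivative (flat_fun p) (at t) v = flat_fun (smult v ([:0, 0, 1:] * (p - pderiv p))) t" for t v
    using fun_cong[OF frechet_derivative_at[OF d[of t]], of v, symmetric] by (simp add: flat_fun_def)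
  with Suc d show ?case by (auto simp: differentiable_def)
qed

text \<open>The bumps approximate the indicator of the open box because \<open>exp (-1/(n t))\<close> tends to \<open>1\<close> for \<open>t > 0\<close>
  and vanishes for \<open>t \<le> 0\<close>.\<close>

definition box_bump :: "nat \<Rightarrow> 'e::euclidean_space \<Rightarrow> 'e \<Rightarrow> 'e \<Rightarrow> real" where
  "box_bump n a c u =
     (\<Prod>b\<in>Basis. flat_fun 1 (real n * ((u - a) \<bullet> b)) * flat_fun 1 (real n * ((c - u) \<bullet> b)))"

lemma smooth_on_box_bump: "smooth_on UNIV (box_bump n a c)"
proof -
  have "smooth_on UNIV (\<lambda>u. flat_fun 1 (s * (u \<bullet> b) + r))" for s r and b :: 'a
    by (rule smooth_on_compose_affine)
       (auto simp: smooth_on_def intro: Ck_on_flat_fun bounded_linear_intros)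
  from this[of "real n" _ "- real n * (a \<bullet> _)"] this[of "- real n" _ "real n * (c \<bullet> _)"]
  have "smooth_on UNIV (\<lambda>u. flat_fun 1 (real n * ((u - a) \<bullet> b)))"
    "smooth_on UNIV (\<lambda>u. flat_fun 1 (real n * ((c - u) \<bullet> b)))" for b
    by (simp_all add: inner_diff_left algebra_simps)
  then show ?thesis
    unfolding box_bump_def[abs_def] by (intro smooth_on_prod smooth_on_mult)
qed

lemma flat_fun_1_bounds: "0 \<le> flat_fun 1 t" "flat_fun 1 t \<le> 1"
  by (auto simp: flat_fun_def)

lemma box_bump_bounds: "0 \<le> box_bump n a c u" "box_bump n a c u \<le> 1"
  unfolding box_bump_def
  by (auto intro!: prod_nonneg prod_le_1 mult_nonneg_nonneg mult_le_one flat_fun_1_bounds)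

lemma box_bump_eq_0: "u \<notin> box a c \<Longrightarrow> box_bump n a c u = 0"
  unfolding box_bump_def mem_box
  by (rule prod_zero, simp, clarify)
     (metis flat_fun_def inner_diff_left diff_gt_0_iff_gt mult_eq_0_iff of_nat_0_le_iff
        zero_less_mult_iff order_less_le_trans less_irrefl not_le)

lemma flat_fun_scale_tendsto: "(\<lambda>n. flat_fun 1 (real n * t)) \<longlonglongrightarrow> (if t > 0 then 1 else 0)"
proof (cases "t > 0")
  case True
  have "(\<lambda>n. exp (- (1 / t) * inverse (real n))) \<longlonglongrightarrow> exp (- (1 / t) * 0)"
    by (intro tendsto_intros lim_inverse_n)
  then have "(\<lambda>n. flat_fun 1 (real n * t)) \<longlonglongrightarrow> exp (- (1 / t) * 0)"
    by (rule Lim_transform_eventually)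
       (use eventually_gt_at_top[of "0::nat"] in \<open>eventually_elim, use True in \<open>auto simp: flat_fun_def field_simps\<close>\<close>)
  with True show ?thesis by simp
qed (auto simp: flat_fun_def zero_less_mult_iff)

lemma box_bump_tendsto: "(\<lambda>n. box_bump n a c u) \<longlonglongrightarrow> (indicator (box a c) u :: real)"
proof -
  have "(\<lambda>n. box_bump n a c u) \<longlonglongrightarrow> (\<Prod>b\<in>Basis. (if (u - a) \<bullet> b > 0 then 1 else 0) * (if (c - u) \<bullet> b > 0 then 1 else 0))"
    unfolding box_bump_def by (intro tendsto_prod tendsto_mult flat_fun_scale_tendsto)
  also have "(\<Prod>b\<in>Basis. (if (u - a) \<bullet> b > 0 then 1 else 0) * (if (c - u) \<bullet> b > 0 then 1 else (0::real)))
      = indicator (box a c) u"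
    by (auto simp: indicator_def mem_box inner_diff_left intro!: prod.neutral) (force+)?
  finally show ?thesis .
qed

lemma box_bump_test_function:
  assumes "cbox a c \<subseteq> S"
  shows "box_bump n a c \<in> test_functions S"
proof -
  have "{u. box_bump n a c u \<noteq> 0} \<subseteq> cbox a c"
    using box_bump_eq_0 box_subset_cbox by blast
  then have "closure {u. box_bump n a c u \<noteq> 0} \<subseteq> cbox a c"
    by (simp add: closure_minimal closed_cbox)
  moreover from this have "compact (closure {u. box_bump n a c u \<noteq> 0})"
    by (meson bounded_cbox bounded_subset closed_closure compact_eq_bounded_closed)
  ultimately show ?thesis
    using assms by (auto simp: test_functions_def smooth_on_box_bump)
qed

subsection \<open>Elementary properties of test functions\<close>

lemma
  assumes "\<psi> \<in> test_functions S"
  shows test_function_differentiable: "\<psi> differentiable (at u)"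
    and test_function_continuous: "continuous_on T \<psi>"
    and test_function_deriv_continuous: "continuous_on T (\<lambda>u. frechet_derivative \<psi> (at u) w)"
    and test_function_has_derivative: "(\<psi> has_derivative frechet_derivative \<psi> (at u)) (at u)"
proof -
  have C: "Ck_on k UNIV \<psi>" for k using assms by (auto simp: test_functions_def smooth_on_def)
  show "\<psi> differentiable (at u)" using C[of 1] by auto
  then show "(\<psi> has_derivative frechet_derivative \<psi> (at u)) (at u)" by (simp add: frechet_derivative_works)
  show "continuous_on T \<psi>" using C[of 0] continuous_on_subset by auto
  have "continuous_on UNIV (\<lambda>u. frechet_derivative \<psi> (at u) w)" using C[of "Suc 0"] by simp
  then show "continuous_on T (\<lambda>u. frechet_derivative \<psi> (at u) w)" by (rule continuous_on_subset) simp
qed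

lemma test_function_support:
  assumes "\<psi> \<in> test_functions S"
  obtains K where "compact K" "K \<subseteq> S" "\<And>u. u \<notin> K \<Longrightarrow> \<psi> u = 0"
    "\<And>u w. u \<notin> K \<Longrightarrow> frechet_derivative \<psi> (at u) w = 0"
proof
  let ?K = "closure {u. \<psi> u \<noteq> 0}"
  show "compact ?K" "?K \<subseteq> S" using assms by (auto simp: test_functions_def)
  show 0: "\<psi> u = 0" if "u \<notin> ?K" for u
    using that closure_subset[of "{u. \<psi> u \<noteq> 0}"] by blast
  show "frechet_derivative \<psi> (at u) w = 0" if "u \<notin> ?K" for u w
  proof -
    have "((\<lambda>_. 0) has_derivative (\<lambda>_. 0)) (at u)" by simp
    then have "(\<psi> has_derivative (\<lambda>_. 0)) (at u)"
    proof (rule has_derivative_transform_within_open)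
      show "open (- ?K)" by (rule open_Compl) (rule closed_closure)
      show "u \<in> - ?K" using that by blast
      show "0 = \<psi> v" if "v \<in> - ?K" for v using 0[of v] that by simp
    qed
    from frechet_derivative_at[OF this] show ?thesis by (simp add: fun_eq_iff)
  qed
qed

lemma compact_support_bounded:
  fixes f :: "'a::topological_space \<Rightarrow> real"
  assumes "compact K" "continuous_on K f" "\<And>u. u \<notin> K \<Longrightarrow> f u = 0"
  obtains C where "C > 0" "\<And>u. \<bar>f u\<bar> \<le> C"
proof -
  have "bounded (f ` K)" using assms by (simp add: compact_continuous_image compact_imp_bounded)
  then obtain C where "C > 0" "\<And>u. u \<in> K \<Longrightarrow> \<bar>f u\<bar> \<le> C" by (auto simp: bounded_pos)
  moreover from this have "\<bar>f u\<bar> \<le> C" for u using assms(3)[of u] by (cases "u \<in> K") auto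
  ultimately show ?thesis using that by blast
qed

lemma test_function_bounded:
  assumes "\<psi> \<in> test_functions S"
  obtains C where "C > 0" "\<And>u. \<bar>\<psi> u\<bar> \<le> C"
proof -
  obtain K where K: "compact K" "\<And>u. u \<notin> K \<Longrightarrow> \<psi> u = 0" using test_function_support[OF assms] by metis
  show ?thesis
    by (rule compact_support_bounded[OF K(1) test_function_continuous[OF assms] K(2)]) (assumption | rule that)+
qed

lemma test_function_deriv_bounded:
  assumes "\<psi> \<in> test_functions S"
  obtains C where "C > 0" "\<And>u. \<bar>frechet_derivative \<psi> (at u) w\<bar> \<le> C"
proof -
  obtain K where K: "compact K" "\<And>u. u \<notin> K \<Longrightarrow> frechet_derivative \<psi> (at u) w = 0"
    using test_function_support[OF assms] by metis
  show ?thesis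
    by (rule compact_support_bounded[OF K(1) test_function_deriv_continuous[OF assms] K(2)]) (assumption | rule that)+
qed

lemma borel_measurable_test_function [measurable]:
  "\<psi> \<in> test_functions S \<Longrightarrow> \<psi> \<in> borel_measurable borel"
  by (simp add: borel_measurable_continuous_onI test_function_continuous)

lemma borel_measurable_test_function_deriv [measurable]:
  "\<psi> \<in> test_functions S \<Longrightarrow> (\<lambda>u. frechet_derivative \<psi> (at u) w) \<in> borel_measurable borel"
  by (simp add: borel_measurable_continuous_onI test_function_deriv_continuous)

lemma test_functions_mono: "S \<subseteq> T \<Longrightarrow> test_functions S \<subseteq> test_functions T"
  by (auto simp: test_functions_def)

section \<open>Weak directional derivatives\<close>

text \<open>Boxes generate the Borel sets and are stable under intersection. The integral over the whole
  space enters in the step to complements, as the space itself is not a box.\<close>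

lemma AE_zero_if_box_integrals_zero:
  fixes f :: "'e::euclidean_space \<Rightarrow> real"
  assumes f: "integrable lborel f"
    and total: "(LINT u|lborel. f u) = 0"
    and box: "\<And>a c. (LINT u:box a c|lborel. f u) = 0"
  shows "AE u in lborel. f u = 0"
proof (rule sigma_finite_measure.density_zero[OF sigma_finite_lborel f])
  fix A :: "'e set" assume "A \<in> sets lborel"
  then have A: "A \<in> sigma_sets UNIV (range (\<lambda>(a, b). box a b :: 'e set))"
    by (simp add: borel_eq_box)
  have "Int_stable (range (\<lambda>(a, b). box a b :: 'e set))"
    by (auto simp: Int_stable_def box_Int_box)
  moreover have "range (\<lambda>(a, b). box a b) \<subseteq> Pow (UNIV :: 'e set)" by auto
  moreover note A
  ultimately show "(LINT u:A|lborel. f u) = 0"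
  proof (induction rule: sigma_sets_induct_disjoint)
    case (basic A)
    then show ?case using box by auto
  next
    case empty
    then show ?case by (simp add: set_lebesgue_integral_def)
  next
    case (compl A)
    then have A: "A \<in> sets borel" by (simp add: borel_eq_box)
    have "(LINT u:UNIV - A|lborel. f u) = (LINT u|lborel. f u - indicator A u *\<^sub>R f u)"
      unfolding set_lebesgue_integral_def
      by (rule Bochner_Integration.integral_cong) (auto simp: indicator_def)
    also have "\<dots> = 0"
      using total compl.IH unfolding set_lebesgue_integral_def
      by (subst Bochner_Integration.integral_diff) (use f integrable_mult_indicator[of A lborel f] A in auto)
    finally show ?case .
  next
    case (union A)
    have A: "A i \<in> sets lborel" for i
      using union.hyps by (simp add: borel_eq_box subset_eq)
    have "(LINT u:\<Union> (range A)|lborel. f u) = (\<Sum>i. (LINT u:A i|lborel. f u))"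
      by (rule lebesgue_integral_countable_add)
         (use A f union.hyps in \<open>auto simp: disjoint_family_on_def set_integrable_def intro!: integrable_mult_indicator[of _ lborel f, simplified]\<close>)
    then show ?case using union.IH by simp
  qed
qed

text \<open>The bumps converge boundedly to indicators of boxes, so a locally integrable
  function that annihilates all test functions has zero integral over every box.\<close>

lemma fundamental_lemma:
  fixes f :: "'e::euclidean_space \<Rightarrow> real"
  assumes S: "open S" and f: "locally_integrable_on f S"
    and zero: "\<And>\<psi>. \<psi> \<in> test_functions S \<Longrightarrow> (LINT u:S|lborel. f u * \<psi> u) = 0"
  shows "AE u in lborel. u \<in> S \<longrightarrow> f u = 0"
proof -
  have box0: "(LINT u:box a c|lborel. f u) = 0" if sub: "cbox a c \<subseteq> S" for a c
  proof -
    have int: "integrable lborel (\<lambda>u. indicator (cbox a c) u *\<^sub>R f u)"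
      using f sub by (auto simp: locally_integrable_on_def set_integrable_def)
    have [measurable]: "box_bump n a c \<in> borel_measurable borel" for n
      by (rule borel_measurable_test_function[OF box_bump_test_function[OF sub]])
    have "(\<lambda>n. LINT u|lborel. (indicator (cbox a c) u *\<^sub>R f u) * box_bump n a c u)
        \<longlonglongrightarrow> (LINT u|lborel. (indicator (cbox a c) u *\<^sub>R f u) * indicator (box a c) u)"
    proof (rule integral_dominated_convergence[where w="\<lambda>u. \<bar>indicator (cbox a c) u *\<^sub>R f u\<bar>"])
      show "AE u in lborel. (\<lambda>n. (indicator (cbox a c) u *\<^sub>R f u) * box_bump n a c u)
        \<longlonglongrightarrow> (indicator (cbox a c) u *\<^sub>R f u) * indicator (box a c) u"
        by (intro AE_I2 tendsto_mult tendsto_const box_bump_tendsto)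
      show "AE u in lborel. norm ((indicator (cbox a c) u *\<^sub>R f u) * box_bump n a c u)
          \<le> \<bar>indicator (cbox a c) u *\<^sub>R f u\<bar>" for n
        using box_bump_bounds[of n a c] by (auto simp: abs_mult intro!: mult_left_le)
    qed (use int in auto)
    moreover have "(LINT u|lborel. (indicator (cbox a c) u *\<^sub>R f u) * box_bump n a c u) = 0" for n
    proof -
      have "(LINT u|lborel. (indicator (cbox a c) u *\<^sub>R f u) * box_bump n a c u)
          = (LINT u:S|lborel. f u * box_bump n a c u)"
        unfolding set_lebesgue_integral_def
        by (rule Bochner_Integration.integral_cong)
           (use sub box_bump_eq_0[of _ a c n] box_subset_cbox[of a c] in \<open>auto simp: indicator_def\<close>)
      with zero[OF box_bump_test_function[OF sub]] show ?thesis by simp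
    qed
    moreover have "(LINT u|lborel. (indicator (cbox a c) u *\<^sub>R f u) * indicator (box a c) u) = (LINT u:box a c|lborel. f u)"
      unfolding set_lebesgue_integral_def
      by (rule Bochner_Integration.integral_cong) (use box_subset_cbox in \<open>auto simp: indicator_def\<close>)
    ultimately show ?thesis by (simp add: LIMSEQ_const_iff)
  qed
  have ae: "AE u in lborel. u \<in> box a c \<longrightarrow> f u = 0" if sub: "cbox a c \<subseteq> S" for a c
  proof -
    let ?g = "\<lambda>u. indicator (box a c) u *\<^sub>R f u"
    have "integrable lborel (\<lambda>u. indicator (cbox a c) u *\<^sub>R f u)"
      using f sub by (auto simp: locally_integrable_on_def set_integrable_def)
    then have "integrable lborel (\<lambda>u. indicator (box a c) u *\<^sub>R (indicator (cbox a c) u *\<^sub>R f u))"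
      by (rule integrable_mult_indicator[rotated]) simp
    also have "(\<lambda>u. indicator (box a c) u *\<^sub>R (indicator (cbox a c) u *\<^sub>R f u)) = ?g"
      using box_subset_cbox by (auto simp: indicator_def fun_eq_iff)
    finally have int: "integrable lborel ?g" .
    have "(LINT u:box a' c'|lborel. ?g u) = 0" for a' c'
    proof -
      obtain a'' c'' where eq: "box a c \<inter> box a' c' = box a'' c''" by (simp add: box_Int_box)
      have "(LINT u:box a' c'|lborel. ?g u) = (LINT u:box a'' c''|lborel. f u)"
        unfolding set_lebesgue_integral_def
        by (rule Bochner_Integration.integral_cong)
           (use eq in \<open>auto simp: indicator_def split: if_splits\<close>)
      also have "\<dots> = 0"
      proof (cases "box a'' c'' = {}")
        case False
        then have "\<forall>i\<in>Basis. a'' \<bullet> i < c'' \<bullet> i" by (simp add: box_ne_empty)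
        moreover have "box a'' c'' \<subseteq> cbox a c" using eq box_subset_cbox[of a c] by blast
        ultimately have "\<forall>i\<in>Basis. a \<bullet> i \<le> a'' \<bullet> i \<and> c'' \<bullet> i \<le> c \<bullet> i" by (simp add: subset_box)
        then have "cbox a'' c'' \<subseteq> cbox a c" by (simp add: subset_box)
        then have "cbox a'' c'' \<subseteq> S" using sub by (rule order_trans)
        then show ?thesis by (rule box0)
      qed (simp add: set_lebesgue_integral_def)
      finally show ?thesis .
    qed
    moreover have "(LINT u|lborel. ?g u) = 0"
      using box0[OF sub] by (simp add: set_lebesgue_integral_def)
    ultimately have "AE u in lborel. ?g u = 0"
      by (intro AE_zero_if_box_integrals_zero[OF int])
    then show ?thesis by eventually_elim auto
  qed
  define \<F> where "\<F> = {box a c |a c. cbox a c \<subseteq> S}"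
  have "open X" if "X \<in> \<F>" for X using that by (auto simp: \<F>_def)
  then obtain \<G> where \<G>: "\<G> \<subseteq> \<F>" "countable \<G>" "\<Union>\<G> = \<Union>\<F>" using Lindelof by metis
  have "S \<subseteq> \<Union>\<F>"
  proof
    fix u assume "u \<in> S"
    then obtain a c where "cbox a c \<subseteq> S" "u \<in> box a c" using open_contains_cbox[OF S] by metis
    then show "u \<in> \<Union>\<F>" unfolding \<F>_def by blast
  qed
  moreover have "AE u in lborel. \<forall>X\<in>\<G>. u \<in> X \<longrightarrow> f u = 0"
  proof (rule AE_ball_countable[OF \<G>(2), THEN iffD2, rule_format])
    fix X assume "X \<in> \<G>"
    then obtain a c where "X = box a c" "cbox a c \<subseteq> S" using \<G>(1) by (auto simp: \<F>_def)
    then show "AE u in lborel. u \<in> X \<longrightarrow> f u = 0" using ae by simp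
  qed
  ultimately show ?thesis using \<G>(3) by (elim eventually_mono) blast
qed

text \<open>In a chart a vector field is a weak gradient precisely if, for every fixed direction \<open>w\<close>, its metric
  product with \<open>w\<close> is the derivative in this sense.\<close>

definition weak_dir_deriv ::
  "'e::euclidean_space set \<Rightarrow> 'e \<Rightarrow> ('e \<Rightarrow> real) \<Rightarrow> ('e \<Rightarrow> real) \<Rightarrow> bool" where
  "weak_dir_deriv S w f g \<longleftrightarrow>
     locally_integrable_on f S \<and> locally_integrable_on g S \<and>
     (\<forall>\<psi>\<in>test_functions S.
        (LINT u:S|lborel. f u * frechet_derivative \<psi> (at u) w) = - (LINT u:S|lborel. g u * \<psi> u))"

lemma integrable_mult_bounded:
  fixes f h :: "'a \<Rightarrow> real"
  assumes "integrable M f" "h \<in> borel_measurable M" "\<And>x. \<bar>h x\<bar> \<le> C"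
  shows "integrable M (\<lambda>x. f x * h x)" "integrable M (\<lambda>x. h x * f x)"
proof -
  have "integrable M (\<lambda>x. C * \<bar>f x\<bar>)" using assms(1) by simp
  moreover have ae: "AE x in M. norm (f x * h x) \<le> norm (C * \<bar>f x\<bar>)"
  proof (rule AE_I2)
    fix x
    have "\<bar>h x\<bar> * \<bar>f x\<bar> \<le> C * \<bar>f x\<bar>" using assms(3) by (intro mult_right_mono) auto
    also have "\<dots> \<le> \<bar>C * \<bar>f x\<bar>\<bar>" by (rule abs_ge_self)
    finally show "norm (f x * h x) \<le> norm (C * \<bar>f x\<bar>)" by (simp add: abs_mult mult.commute)
  qed
  moreover have "(\<lambda>x. f x * h x) \<in> borel_measurable M" using assms by simp
  ultimately show "integrable M (\<lambda>x. f x * h x)"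
    using Bochner_Integration.integrable_bound[OF _ _ ae] by blast
  then show "integrable M (\<lambda>x. h x * f x)" by (simp add: mult.commute)
qed

lemma lborel_integral_translate:
  fixes f :: "'e::euclidean_space \<Rightarrow> real"
  assumes [measurable]: "f \<in> borel_measurable borel"
  shows "(LINT u|lborel. f (u + c)) = (LINT u|lborel. f u)"
proof -
  have "(LINT u|lborel. f u) = (LINT u|distr lborel borel ((+) c). f u)"
    by (simp add: lborel_distr_plus)
  also have "\<dots> = (LINT u|lborel. f (c + u))"
    by (rule integral_distr) auto
  finally show ?thesis by (simp add: add.commute)
qed

lemma nn_integral_lborel_translate:
  fixes f :: "'e::euclidean_space \<Rightarrow> ennreal"
  assumes [measurable]: "f \<in> borel_measurable borel"
  shows "(\<integral>\<^sup>+u. f (u + c) \<partial>lborel) = (\<integral>\<^sup>+u. f u \<partial>lborel)"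
proof -
  have "(\<integral>\<^sup>+u. f u \<partial>lborel) = (\<integral>\<^sup>+u. f u \<partial>distr lborel borel ((+) c))"
    by (simp add: lborel_distr_plus)
  also have "\<dots> = (\<integral>\<^sup>+u. f (c + u) \<partial>lborel)"
    by (rule nn_integral_distr) auto
  finally show ?thesis by (simp add: add.commute)
qed

lemma lborel_integrable_translate:
  fixes f :: "'e::euclidean_space \<Rightarrow> real"
  assumes f: "integrable lborel f"
  shows "integrable lborel (\<lambda>u. f (u + c))"
proof -
  have "integrable (distr lborel borel ((+) c)) f" using f by (simp add: lborel_distr_plus)
  then have "integrable lborel (\<lambda>u. f (c + u))"
    by (rule integrable_distr[rotated]) simp
  then show ?thesis by (simp add: add.commute)
qed

lemma test_function_translate:
  assumes "\<psi> \<in> test_functions A" "(\<lambda>u. u + c) ` A \<subseteq> S"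
  shows "(\<lambda>u. \<psi> (u - c)) \<in> test_functions S"
proof -
  have sm: "smooth_on UNIV \<psi>" and K: "compact (closure {u. \<psi> u \<noteq> 0})" "closure {u. \<psi> u \<noteq> 0} \<subseteq> A"
    using assms by (auto simp: test_functions_def)
  have "smooth_on UNIV (\<lambda>u. \<psi> (u - c))"
    using smooth_on_compose_affine[OF sm bounded_linear_ident, of "- c"] by simp
  moreover have eq: "{u. \<psi> (u - c) \<noteq> 0} = (\<lambda>u. c + u) ` {u. \<psi> u \<noteq> 0}"
    by (force simp: image_iff intro: exI[of _ "_ - c"])
  moreover have "closure ((\<lambda>u. c + u) ` {u. \<psi> u \<noteq> 0}) = (\<lambda>u. c + u) ` closure {u. \<psi> u \<noteq> 0}"
    by (rule closure_translation)
  moreover have "compact ((\<lambda>u. c + u) ` closure {u. \<psi> u \<noteq> 0})"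
    using K(1) by (rule compact_translation)
  moreover have "(\<lambda>u. c + u) ` closure {u. \<psi> u \<noteq> 0} \<subseteq> S"
    using K(2) assms(2) by (auto simp: add.commute)
  ultimately show ?thesis by (simp only: test_functions_def mem_Collect_eq simp_thms)
qed

lemma frechet_derivative_translate:
  assumes "\<psi> differentiable (at (u - c))"
  shows "frechet_derivative (\<lambda>u. \<psi> (u - c)) (at u) = frechet_derivative \<psi> (at (u - c))"
proof (rule frechet_derivative_at[symmetric])
  have "(\<psi> has_derivative frechet_derivative \<psi> (at (u - c))) (at (u - c))"
    using assms by (simp add: frechet_derivative_works)
  moreover have "((\<lambda>u. u - c) has_derivative (\<lambda>v. v)) (at u)"
    by (auto intro!: derivative_eq_intros)
  ultimately show "((\<lambda>u. \<psi> (u - c)) has_derivative frechet_derivative \<psi> (at (u - c))) (at u)"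
    using diff_chain_at[of "\<lambda>u. u - c" "\<lambda>v. v" u \<psi>] by (simp add: o_def)
qed

lemma test_function_line_derivative:
  fixes s :: real
  assumes \<psi>: "\<psi> \<in> test_functions S"
  shows "((\<lambda>s. \<psi> (u - s *\<^sub>R w)) has_real_derivative - frechet_derivative \<psi> (at (u - s *\<^sub>R w)) w) (at s)"
proof -
  have lin: "linear (frechet_derivative \<psi> (at x))" for x
    using test_function_differentiable[OF \<psi>] by (rule linear_frechet_derivative)
  have "((\<lambda>s. u - s *\<^sub>R w) has_derivative (\<lambda>s. - (s *\<^sub>R w))) (at s)"
    by (auto intro!: derivative_eq_intros)
  from diff_chain_at[OF this test_function_has_derivative[OF \<psi>]]
  have "((\<lambda>s. \<psi> (u - s *\<^sub>R w)) has_derivative (\<lambda>r. frechet_derivative \<psi> (at (u - s *\<^sub>R w)) (- (r *\<^sub>R w)))) (at s)"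
    by (simp add: o_def)
  moreover have "(\<lambda>r. frechet_derivative \<psi> (at (u - s *\<^sub>R w)) (- (r *\<^sub>R w))) = (*) (- frechet_derivative \<psi> (at (u - s *\<^sub>R w)) w)"
    by (simp add: fun_eq_iff linear_neg[OF lin] linear_scale[OF lin])
  ultimately show ?thesis by (simp add: has_field_derivative_def)
qed

lemma test_function_FTC:
  assumes \<psi>: "\<psi> \<in> test_functions S"
  shows "\<psi> (u - w) - \<psi> u = - (LINT s|lborel. indicator {0..1} s * frechet_derivative \<psi> (at (u - s *\<^sub>R w)) w)"
proof -
  have "(LINT s|lborel. indicator {0..1} s *\<^sub>R (- frechet_derivative \<psi> (at (u - s *\<^sub>R w)) w))
      = \<psi> (u - 1 *\<^sub>R w) - \<psi> (u - 0 *\<^sub>R w)"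
  proof (rule integral_FTC_atLeastAtMost)
    show "((\<lambda>s. \<psi> (u - s *\<^sub>R w)) has_vector_derivative - frechet_derivative \<psi> (at (u - s *\<^sub>R w)) w) (at s within {0..1})" for s :: real
      using test_function_line_derivative[OF \<psi>]
      by (metis has_real_derivative_iff_has_vector_derivative has_vector_derivative_at_within)
    show "continuous_on {0..1} (\<lambda>s. - frechet_derivative \<psi> (at (u - s *\<^sub>R w)) w)"
      by (intro continuous_on_minus continuous_on_compose2[OF test_function_deriv_continuous[OF \<psi>, of UNIV]])
         (auto intro!: continuous_intros)
  qed simp
  then show ?thesis by simp
qed

lemma test_function_eq_0: "\<psi> \<in> test_functions S \<Longrightarrow> u \<notin> S \<Longrightarrow> \<psi> u = 0"
  by (metis test_function_support subsetD)

lemma test_function_deriv_eq_0: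
  "\<psi> \<in> test_functions S \<Longrightarrow> u \<notin> S \<Longrightarrow> frechet_derivative \<psi> (at u) w = 0"
  by (metis test_function_support subsetD)

lemma set_integral_test_function:
  assumes "\<psi> \<in> test_functions U" "U \<subseteq> S"
  shows "(LINT u:S|M. f u * \<psi> u) = (LINT u|M. f u * \<psi> u)"
    and "(LINT u:S|M. f u * frechet_derivative \<psi> (at u) w) = (LINT u|M. f u * frechet_derivative \<psi> (at u) w)"
proof -
  have "\<psi> u = 0" "frechet_derivative \<psi> (at u) w = 0" if "u \<notin> S" for u
    using that assms test_function_eq_0 test_function_deriv_eq_0 by blast+
  then show "(LINT u:S|M. f u * \<psi> u) = (LINT u|M. f u * \<psi> u)"
    and "(LINT u:S|M. f u * frechet_derivative \<psi> (at u) w) = (LINT u|M. f u * frechet_derivative \<psi> (at u) w)"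
    unfolding set_lebesgue_integral_def
    by (auto intro!: Bochner_Integration.integral_cong simp: indicator_def)
qed

lemma weak_dir_derivD:
  assumes "weak_dir_deriv S w f g" "\<psi> \<in> test_functions S"
  shows "(LINT u|lborel. f u * frechet_derivative \<psi> (at u) w) = - (LINT u|lborel. g u * \<psi> u)"
  using assms set_integral_test_function[OF assms(2) order_refl] by (auto simp: weak_dir_deriv_def)

lemma locally_integrable_on_subset:
  "locally_integrable_on f S \<Longrightarrow> T \<subseteq> S \<Longrightarrow> locally_integrable_on f T"
  by (auto simp: locally_integrable_on_def)

lemma locally_integrable_on_cong:
  assumes "\<And>u. u \<in> S \<Longrightarrow> f u = g u"
  shows "locally_integrable_on f S \<longleftrightarrow> locally_integrable_on g S"
proof -
  have "set_integrable lborel K f \<longleftrightarrow> set_integrable lborel K g" if "K \<subseteq> S" for K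
    unfolding set_integrable_def
    by (rule Bochner_Integration.integrable_cong) (use assms that in \<open>auto simp: indicator_def\<close>)
  then show ?thesis by (simp add: locally_integrable_on_def)
qed

lemma weak_dir_deriv_restrict:
  assumes w: "weak_dir_deriv S w f f'" and sub: "U \<subseteq> S"
    and eq: "\<And>u. u \<in> U \<Longrightarrow> F u = f u" "\<And>u. u \<in> U \<Longrightarrow> F' u = f' u"
  shows "weak_dir_deriv U w F F'"
  unfolding weak_dir_deriv_def
proof (intro conjI ballI)
  show "locally_integrable_on F U" "locally_integrable_on F' U"
    using w locally_integrable_on_subset[OF _ sub] locally_integrable_on_cong[of U F f]
      locally_integrable_on_cong[of U F' f'] eq by (auto simp: weak_dir_deriv_def)
  fix \<psi> assume \<psi>: "\<psi> \<in> test_functions U"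
  then have "\<psi> \<in> test_functions S" using sub test_functions_mono by blast
  then have "(LINT u|lborel. f u * frechet_derivative \<psi> (at u) w) = - (LINT u|lborel. f' u * \<psi> u)"
    by (rule weak_dir_derivD[OF w])
  moreover have "(LINT u:U|lborel. F u * frechet_derivative \<psi> (at u) w)
      = (LINT u:U|lborel. f u * frechet_derivative \<psi> (at u) w)"
    "(LINT u:U|lborel. F' u * \<psi> u) = (LINT u:U|lborel. f' u * \<psi> u)"
    unfolding set_lebesgue_integral_def using eq
    by (auto intro!: Bochner_Integration.integral_cong simp: indicator_def)
  ultimately show "(LINT u:U|lborel. F u * frechet_derivative \<psi> (at u) w) = - (LINT u:U|lborel. F' u * \<psi> u)"
    using set_integral_test_function[OF \<psi> order_refl] by simp
qed

lemma weak_dir_deriv_scale: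
  assumes w: "weak_dir_deriv S w f f'"
  shows "weak_dir_deriv S (t *\<^sub>R w) f (\<lambda>u. t * f' u)"
  unfolding weak_dir_deriv_def
proof (intro conjI ballI)
  show "locally_integrable_on f S" using w by (simp add: weak_dir_deriv_def)
  have "set_integrable lborel K f'" if "compact K" "K \<subseteq> S" for K
    using w that by (simp add: weak_dir_deriv_def locally_integrable_on_def)
  then show "locally_integrable_on (\<lambda>u. t * f' u) S"
    by (simp add: locally_integrable_on_def)
  fix \<psi> assume \<psi>: "\<psi> \<in> test_functions S"
  have "frechet_derivative \<psi> (at u) (t *\<^sub>R w) = t * frechet_derivative \<psi> (at u) w" for u
    using linear_scale[OF linear_frechet_derivative[OF test_function_differentiable[OF \<psi>]]] by simp
  then have "(LINT u|lborel. f u * frechet_derivative \<psi> (at u) (t *\<^sub>R w))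
      = (LINT u|lborel. t * (f u * frechet_derivative \<psi> (at u) w))"
    by (simp add: algebra_simps)
  also have "\<dots> = - (LINT u|lborel. t * f' u * \<psi> u)"
    using weak_dir_derivD[OF w \<psi>] by (simp add: mult.assoc)
  finally show "(LINT u:S|lborel. f u * frechet_derivative \<psi> (at u) (t *\<^sub>R w)) = - (LINT u:S|lborel. t * f' u * \<psi> u)"
    using set_integral_test_function[OF \<psi> order_refl] by simp
qed

lemma integrable_line_average:
  fixes g :: "'e::euclidean_space \<Rightarrow> real"
  assumes g: "integrable lborel g"
  shows "integrable (lborel \<Otimes>\<^sub>M lborel) (\<lambda>(s, u). indicator {0..1} s * g (u + s *\<^sub>R w))"
proof (rule lborel_pair.Fubini_integrable)
  have [measurable]: "g \<in> borel_measurable borel" using g by auto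
  show "(\<lambda>(s, u). indicator {0..1} s * g (u + s *\<^sub>R w)) \<in> borel_measurable (lborel \<Otimes>\<^sub>M lborel)"
    by measurable
  show "AE s in lborel. integrable lborel (\<lambda>u. case (s, u) of (s, u) \<Rightarrow> indicator {0..1} s * g (u + s *\<^sub>R w))"
    using lborel_integrable_translate[OF g] by simp
  have "(\<integral>u. norm (case (s, u) of (s, u) \<Rightarrow> indicator {0..1} s * g (u + s *\<^sub>R w)) \<partial>lborel)
      = indicator {0..1} s * (\<integral>u. \<bar>g u\<bar> \<partial>lborel)" for s
    using lborel_integral_translate[of "\<lambda>u. \<bar>g u\<bar>" "s *\<^sub>R w"] by (simp add: abs_mult)
  then show "integrable lborel (\<lambda>s. \<integral>u. norm (case (s, u) of (s, u) \<Rightarrow> indicator {0..1} s * g (u + s *\<^sub>R w)) \<partial>lborel)"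
    by simp
qed

text \<open>Tested against \<open>\<psi>\<close>, the increment of \<open>f\<close> becomes minus the increment of \<open>\<psi>\<close>, to which the fundamental
  theorem of calculus applies; the weak equation for each translate of \<open>\<psi>\<close> and Fubini's theorem
  bring back the average of \<open>g\<close>, and the fundamental lemma removes \<open>\<psi>\<close>.\<close>

lemma weak_dir_deriv_translation:
  assumes w: "weak_dir_deriv U w f g"
    and f: "integrable lborel f" and g: "integrable lborel g"
    and A: "open A" and seg: "\<And>u s. u \<in> A \<Longrightarrow> s \<in> {0..1} \<Longrightarrow> u + s *\<^sub>R w \<in> U"
  shows "AE u in lborel. u \<in> A \<longrightarrow> f (u + w) - f u = (LINT s|lborel. indicator {0..1} s * g (u + s *\<^sub>R w))"
proof -
  have [measurable]: "f \<in> borel_measurable borel" "g \<in> borel_measurable borel" using f g by auto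
  define a where "a u = (LINT s|lborel. indicator {0..1} s * g (u + s *\<^sub>R w))" for u
  have a: "integrable lborel a"
    unfolding a_def using lborel_pair.integrable_snd[OF integrable_line_average[OF g, of w]] .
  have d: "integrable lborel (\<lambda>u. f (u + w) - f u - a u)"
    using f a lborel_integrable_translate[OF f] by simp
  have "(LINT u:A|lborel. (f (u + w) - f u - a u) * \<psi> u) = 0" if \<psi>: "\<psi> \<in> test_functions A" for \<psi>
  proof -
    obtain C where C: "\<And>u. \<bar>\<psi> u\<bar> \<le> C" using test_function_bounded[OF \<psi>] by metis
    obtain C' where C'0: "C' > 0" and C': "\<And>u. \<bar>frechet_derivative \<psi> (at u) w\<bar> \<le> C'" using test_function_deriv_bounded[OF \<psi>] by metis
    note [measurable] = borel_measurable_test_function[OF \<psi>] borel_measurable_test_function_deriv[OF \<psi>]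
    have i: "integrable lborel (\<lambda>u. h u * \<psi> (u - c))" if "integrable lborel h" for h c
      using that by (rule integrable_mult_bounded) (use C in auto)
    note i0 = i[where c=0, simplified]
    have J: "(LINT u|lborel. f u * frechet_derivative \<psi> (at (u - s *\<^sub>R w)) w)
        = - (LINT u|lborel. g (u + s *\<^sub>R w) * \<psi> u)" if s: "s \<in> {0..1}" for s
    proof -
      have \<psi>s: "(\<lambda>u. \<psi> (u - s *\<^sub>R w)) \<in> test_functions U"
        by (rule test_function_translate[OF \<psi>]) (use seg s in auto)
      have "(LINT u|lborel. f u * frechet_derivative \<psi> (at (u - s *\<^sub>R w)) w)
          = (LINT u|lborel. f u * frechet_derivative (\<lambda>u. \<psi> (u - s *\<^sub>R w)) (at u) w)"
        by (simp add: frechet_derivative_translate test_function_differentiable[OF \<psi>])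
      also have "\<dots> = - (LINT u|lborel. g u * \<psi> (u - s *\<^sub>R w))"
        by (rule weak_dir_derivD[OF w \<psi>s])
      also have "(LINT u|lborel. g u * \<psi> (u - s *\<^sub>R w)) = (LINT u|lborel. g (u + s *\<^sub>R w) * \<psi> u)"
        using lborel_integral_translate[of "\<lambda>u. g u * \<psi> (u - s *\<^sub>R w)" "s *\<^sub>R w"] by simp
      finally show ?thesis .
    qed
    have int2: "integrable (lborel \<Otimes>\<^sub>M lborel)
        (\<lambda>(s, u). f u * (indicator {0..1} s * frechet_derivative \<psi> (at (u - s *\<^sub>R w)) w))"
    proof (rule lborel_pair.Fubini_integrable)
      show "AE s in lborel. integrable lborel (\<lambda>u. case (s, u) of (s, u) \<Rightarrow> f u * (indicator {0..1} s * frechet_derivative \<psi> (at (u - s *\<^sub>R w)) w))"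
        using f by (intro AE_I2, simp, intro integrable_mult_bounded[where C=C'])
          (use C' C'0 in \<open>auto simp: indicator_def\<close>)
      have "integrable lborel (indicator {0..1} :: real \<Rightarrow> real)" by (rule integrable_real_indicator) simp_all
      then have "integrable lborel (\<lambda>s::real. indicator {0..1} s * (C' * (\<integral>u. \<bar>f u\<bar> \<partial>lborel)) :: real)"
        by simp
      then show "integrable lborel (\<lambda>s. \<integral>u. norm (case (s, u) of (s, u) \<Rightarrow> f u * (indicator {0..1} s * frechet_derivative \<psi> (at (u - s *\<^sub>R w)) w)) \<partial>lborel)"
      proof (rule Bochner_Integration.integrable_bound)
        show "AE s in lborel. norm (\<integral>u. norm (case (s, u) of (s, u) \<Rightarrow> f u * (indicator {0..1} s * frechet_derivative \<psi> (at (u - s *\<^sub>R w)) w)) \<partial>lborel)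
            \<le> norm (indicator {0..1} s * (C' * (\<integral>u. \<bar>f u\<bar> \<partial>lborel)) :: real)"
        proof (rule AE_I2)
          fix s :: real
          have "(\<integral>u. \<bar>f u\<bar> * \<bar>frechet_derivative \<psi> (at (u - s *\<^sub>R w)) w\<bar> \<partial>lborel) \<le> (\<integral>u. \<bar>f u\<bar> * C' \<partial>lborel)"
            using f C' C'0 by (intro integral_mono integrable_mult_bounded[where C=C']) (auto intro!: mult_left_mono)
          moreover have "0 \<le> (\<integral>u. \<bar>f u\<bar> * \<bar>frechet_derivative \<psi> (at (u - s *\<^sub>R w)) w\<bar> \<partial>lborel)" by simp
          ultimately show "norm (\<integral>u. norm (case (s, u) of (s, u) \<Rightarrow> f u * (indicator {0..1} s * frechet_derivative \<psi> (at (u - s *\<^sub>R w)) w)) \<partial>lborel)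
            \<le> norm (indicator {0..1} s * (C' * (\<integral>u. \<bar>f u\<bar> \<partial>lborel)) :: real)"
            using C'0 by (auto simp: abs_mult indicator_def mult.commute)
        qed
      qed simp
    qed simp
    have "(LINT u|lborel. f (u + w) * \<psi> u) = (LINT u|lborel. f u * \<psi> (u - w))"
      using lborel_integral_translate[of "\<lambda>u. f u * \<psi> (u - w)" w] by simp
    then have "(LINT u|lborel. (f (u + w) - f u) * \<psi> u) = (LINT u|lborel. f u * (\<psi> (u - w) - \<psi> u))"
      using i[OF f] i0[OF f] i0[OF lborel_integrable_translate[OF f]]
      by (simp add: left_diff_distrib right_diff_distrib)
    also have "\<dots> = - (LINT u|lborel. LINT s|lborel. f u * (indicator {0..1} s * frechet_derivative \<psi> (at (u - s *\<^sub>R w)) w))"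
      by (simp add: test_function_FTC[OF \<psi>])
    also have "\<dots> = - (LINT s|lborel. LINT u|lborel. f u * (indicator {0..1} s * frechet_derivative \<psi> (at (u - s *\<^sub>R w)) w))"
      using lborel_pair.Fubini_integral[OF int2] by simp
    also have "\<dots> = (LINT s|lborel. LINT u|lborel. (indicator {0..1} s * g (u + s *\<^sub>R w)) * \<psi> u)"
    proof -
      have "(LINT u|lborel. f u * (indicator {0..1} s * frechet_derivative \<psi> (at (u - s *\<^sub>R w)) w))
          = - (LINT u|lborel. (indicator {0..1} s * g (u + s *\<^sub>R w)) * \<psi> u)" for s
        using J[of s] by (simp add: indicator_def)
      then show ?thesis by simp
    qed
    also have "\<dots> = (LINT u|lborel. LINT s|lborel. (indicator {0..1} s * g (u + s *\<^sub>R w)) * \<psi> u)"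
    proof -
      have "integrable (lborel \<Otimes>\<^sub>M lborel) (\<lambda>x. (case x of (s, u) \<Rightarrow> indicator {0..1} s * g (u + s *\<^sub>R w)) * \<psi> (snd x))"
        by (rule integrable_mult_bounded[OF integrable_line_average[OF g]]) (use C in auto)
      then have "integrable (lborel \<Otimes>\<^sub>M lborel) (\<lambda>(s, u). (indicator {0..1} s * g (u + s *\<^sub>R w)) * \<psi> u)"
        by (simp add: case_prod_beta')
      from lborel_pair.Fubini_integral[OF this] show ?thesis by simp
    qed
    also have "\<dots> = (LINT u|lborel. a u * \<psi> u)" by (simp add: a_def)
    finally have "(LINT u|lborel. (f (u + w) - f u - a u) * \<psi> u) = 0"
      using i0[OF a] i0[OF f] i0[OF lborel_integrable_translate[OF f]]
      by (simp add: left_diff_distrib right_diff_distrib)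
    then show ?thesis using set_integral_test_function[OF \<psi> order_refl] by simp
  qed
  moreover have "locally_integrable_on (\<lambda>u. f (u + w) - f u - a u) A"
    using d by (auto simp: locally_integrable_on_def set_integrable_def compact_imp_closed
        intro!: integrable_mult_indicator[of _ lborel "\<lambda>u. f (u + w) - f u - a u", simplified])
  ultimately have "AE u in lborel. u \<in> A \<longrightarrow> f (u + w) - f u - a u = 0"
    by (intro fundamental_lemma[OF A])
  then show ?thesis by (simp add: a_def)
qed

lemma weak_dir_deriv_translation_bound:
  assumes w: "weak_dir_deriv U w f g"
    and f: "integrable lborel f" and g: "integrable lborel g"
    and A: "open A" and seg: "\<And>u s. u \<in> A \<Longrightarrow> s \<in> {0..1} \<Longrightarrow> u + s *\<^sub>R w \<in> U"
  shows "(\<integral>\<^sup>+u. ennreal (indicator A u * \<bar>f (u + w) - f u\<bar>) \<partial>lborel) \<le> (\<integral>\<^sup>+u. ennreal \<bar>g u\<bar> \<partial>lborel)"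
proof -
  have [measurable]: "f \<in> borel_measurable borel" "g \<in> borel_measurable borel" using f g by auto
  have [measurable]: "(\<lambda>(s, u). indicator {0..1} s * g (u + s *\<^sub>R w)) \<in> borel_measurable (lborel \<Otimes>\<^sub>M lborel)"
    by measurable
  have "AE u in lborel. ennreal (indicator A u * \<bar>f (u + w) - f u\<bar>)
      \<le> (\<integral>\<^sup>+s. ennreal \<bar>indicator {0..1} s * g (u + s *\<^sub>R w)\<bar> \<partial>lborel)"
    using weak_dir_deriv_translation[OF w f g A seg, simplified] lborel_pair.AE_integrable_snd[OF integrable_line_average[OF g, of w]]
  proof eventually_elim
    case (elim u)
    then show ?case
      using integral_norm_bound_ennreal[of lborel "\<lambda>s. indicator {0..1} s * g (u + s *\<^sub>R w)"]
      by (cases "u \<in> A") auto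
  qed
  then have "(\<integral>\<^sup>+u. ennreal (indicator A u * \<bar>f (u + w) - f u\<bar>) \<partial>lborel)
      \<le> (\<integral>\<^sup>+u. \<integral>\<^sup>+s. ennreal \<bar>indicator {0..1} s * g (u + s *\<^sub>R w)\<bar> \<partial>lborel \<partial>lborel)"
    by (rule nn_integral_mono_AE)
  also have "\<dots> = (\<integral>\<^sup>+s. \<integral>\<^sup>+u. ennreal \<bar>indicator {0..1} s * g (u + s *\<^sub>R w)\<bar> \<partial>lborel \<partial>lborel)"
    by (rule lborel_pair.Fubini') measurable
  also have "\<dots> = (\<integral>\<^sup>+s. indicator {0..1::real} s * (\<integral>\<^sup>+u. ennreal \<bar>g u\<bar> \<partial>lborel) \<partial>lborel)"
    using nn_integral_lborel_translate[of "\<lambda>u. ennreal \<bar>g u\<bar>"]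
    by (intro nn_integral_cong) (auto simp: indicator_def)
  also have "\<dots> = (\<integral>\<^sup>+u. ennreal \<bar>g u\<bar> \<partial>lborel)"
    by (simp add: nn_integral_multc)
  finally show ?thesis .
qed

text \<open>Along a geometric sequence of translations the bound is summable, hence the translates
  converge almost everywhere without passing to a subsequence.\<close>

lemma weak_dir_deriv_translates_tendsto:
  assumes w: "weak_dir_deriv U w f g"
    and f: "integrable lborel f" and g: "integrable lborel g"
    and A: "open A" and seg: "\<And>u s. u \<in> A \<Longrightarrow> \<bar>s\<bar> \<le> d \<Longrightarrow> u + s *\<^sub>R w \<in> U"
    and \<sigma>: "\<And>n. \<bar>\<sigma> n\<bar> \<le> d * (1 / 2) ^ n"
  shows "AE u in lborel. u \<in> A \<longrightarrow> (\<lambda>n. f (u + \<sigma> n *\<^sub>R w)) \<longlonglongrightarrow> f u"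
proof -
  have [measurable]: "f \<in> borel_measurable borel" "g \<in> borel_measurable borel" using f g by auto
  have [measurable]: "A \<in> sets borel" using A by auto
  have d0: "0 \<le> d" using \<sigma>[of 0] by (simp add: order_trans[OF abs_ge_zero])
  have d: "\<bar>\<sigma> n\<bar> \<le> d" for n
    using order_trans[OF \<sigma>[of n], of d] d0 by (simp add: mult_left_le power_le_one)
  define D where "D n u = indicator A u * \<bar>f (u + \<sigma> n *\<^sub>R w) - f u\<bar>" for n u
  have [measurable]: "D n \<in> borel_measurable borel" for n unfolding D_def by measurable
  define N where "N = (\<integral>\<^sup>+u. ennreal \<bar>g u\<bar> \<partial>lborel)"
  have N: "N < \<infinity>" using g by (simp add: N_def integrable_iff_bounded)
  have bound: "(\<integral>\<^sup>+u. ennreal (D n u) \<partial>lborel) \<le> ennreal (d * (1 / 2) ^ n) * N" for n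
  proof -
    have "(\<integral>\<^sup>+u. ennreal (D n u) \<partial>lborel) \<le> (\<integral>\<^sup>+u. ennreal \<bar>\<sigma> n * g u\<bar> \<partial>lborel)"
      unfolding D_def
    proof (rule weak_dir_deriv_translation_bound[OF weak_dir_deriv_scale[OF w] f _ A])
      fix u and s :: real assume "u \<in> A" "s \<in> {0..1}"
      moreover have "\<bar>s * \<sigma> n\<bar> \<le> 1 * d"
        unfolding abs_mult using \<open>s \<in> {0..1}\<close> d by (intro mult_mono) auto
      ultimately show "u + s *\<^sub>R \<sigma> n *\<^sub>R w \<in> U" using seg[of u "s * \<sigma> n"] by simp
    qed (use g in simp)
    also have "\<dots> = ennreal \<bar>\<sigma> n\<bar> * N"
      by (simp add: N_def abs_mult ennreal_mult nn_integral_cmult)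
    also have "\<dots> \<le> ennreal (d * (1 / 2) ^ n) * N"
      by (intro mult_right_mono ennreal_leI \<sigma>) simp
    finally show ?thesis .
  qed
  have "(\<integral>\<^sup>+u. (\<Sum>n. ennreal (D n u)) \<partial>lborel) = (\<Sum>n. \<integral>\<^sup>+u. ennreal (D n u) \<partial>lborel)"
    by (rule nn_integral_suminf) simp
  also have "\<dots> \<le> (\<Sum>n. ennreal (d * (1 / 2) ^ n) * N)"
    by (intro suminf_le bound) auto
  also have "\<dots> = (\<Sum>n. ennreal (d * (1 / 2) ^ n)) * N" by simp
  also have "(\<Sum>n. ennreal (d * (1 / 2) ^ n)) = ennreal (\<Sum>n. d * (1 / 2) ^ n)"
    using d0 by (intro suminf_ennreal2) (auto intro: summable_mult summable_geometric)
  also have "ennreal (\<Sum>n. d * (1 / 2) ^ n) * N < \<infinity>"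
    using N by (simp add: ennreal_mult_less_top)
  finally have "AE u in lborel. (\<Sum>n. ennreal (D n u)) \<noteq> \<infinity>"
    by (intro nn_integral_PInf_AE) auto
  then show ?thesis
  proof eventually_elim
    case (elim u)
    have "summable (\<lambda>n. D n u)"
      by (rule summable_suminf_not_top) (use elim in \<open>auto simp: D_def\<close>)
    then have "(\<lambda>n. D n u) \<longlonglongrightarrow> 0" by (rule summable_LIMSEQ_zero)
    then show ?case
      by (auto simp: D_def LIM_zero_iff tendsto_rabs_zero_iff)
  qed
qed

text \<open>The translation identity replaces the difference quotient by an average of \<open>g\<close> over the segment.
  For each point \<open>s\<close> of the segment the substitution \<open>u - (s * t n) *\<^sub>R w\<close> for \<open>u\<close> fixes \<open>g\<close> and moves
  the translation to the bounded factors, where dominated convergence applies.\<close>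

lemma difference_quotient_limit:
  assumes \<psi>: "\<psi> \<in> test_functions A" and A: "open A"
    and w: "weak_dir_deriv U w f g"
    and f: "integrable lborel f" and g: "integrable lborel g"
    and t0: "\<And>n. t n > 0" and t: "t \<longlonglongrightarrow> 0"
    and seg: "\<And>u s n. u \<in> A \<Longrightarrow> s \<in> {0..1} \<Longrightarrow> u + (s * t n) *\<^sub>R w \<in> U"
    and b[measurable]: "\<And>n. b n \<in> borel_measurable borel" and bC: "\<And>n u. \<bar>b n u\<bar> \<le> C"
    and b0[measurable]: "b0 \<in> borel_measurable borel"
    and lim: "\<And>s. s \<in> {0..1} \<Longrightarrow> AE u in lborel. u \<in> A \<longrightarrow> (\<lambda>n. b n (u - (s * t n) *\<^sub>R w)) \<longlonglongrightarrow> b0 u"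
  shows "(\<lambda>n. LINT u|lborel. \<psi> u * b n u * ((f (u + t n *\<^sub>R w) - f u) / t n)) \<longlonglongrightarrow> (LINT u|lborel. \<psi> u * b0 u * g u)"
proof -
  have [measurable]: "f \<in> borel_measurable borel" "g \<in> borel_measurable borel" using f g by auto
  obtain C\<psi> where C\<psi>0: "C\<psi> > 0" and C\<psi>: "\<And>u. \<bar>\<psi> u\<bar> \<le> C\<psi>" using test_function_bounded[OF \<psi>] by metis
  note [measurable] = borel_measurable_test_function[OF \<psi>]
  have C0: "0 \<le> C" using bC[of 0 0] by linarith
  define J where "J n s = (LINT u|lborel. \<psi> (u - (s * t n) *\<^sub>R w) * b n (u - (s * t n) *\<^sub>R w) * g u)" for n s
  have \<psi>b: "\<bar>\<psi> u * b n u'\<bar> \<le> C\<psi> * C" for u u' n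
    unfolding abs_mult using C\<psi>0 C\<psi> bC by (intro mult_mono) auto
  have eq: "(LINT u|lborel. \<psi> u * b n u * ((f (u + t n *\<^sub>R w) - f u) / t n)) = (LINT s|lborel. indicator {0..1} s * J n s)" for n
  proof -
    have "AE u in lborel. u \<in> A \<longrightarrow> f (u + t n *\<^sub>R w) - f u
        = (LINT s|lborel. indicator {0..1} s * (t n * g (u + s *\<^sub>R t n *\<^sub>R w)))"
      by (rule weak_dir_deriv_translation[OF weak_dir_deriv_scale[OF w] f _ A]) (use g seg in auto)
    then have ae: "AE u in lborel. \<psi> u * b n u * ((f (u + t n *\<^sub>R w) - f u) / t n)
        = (LINT s|lborel. indicator {0..1} s * g (u + s *\<^sub>R t n *\<^sub>R w) * (\<psi> u * b n u))"
    proof eventually_elim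
      case (elim u)
      show ?case
      proof (cases "u \<in> A")
        case True
        with elim have "(f (u + t n *\<^sub>R w) - f u) / t n = (LINT s|lborel. t n * (indicator {0..1} s * g (u + s *\<^sub>R t n *\<^sub>R w))) / t n"
          by (simp add: mult.left_commute)
        also have "\<dots> = (LINT s|lborel. indicator {0..1} s * g (u + s *\<^sub>R t n *\<^sub>R w))"
          using t0[of n] by simp
        finally show ?thesis by simp
      qed (simp add: test_function_eq_0[OF \<psi>])
    qed
    have "integrable (lborel \<Otimes>\<^sub>M lborel) (\<lambda>x. (case x of (s, u) \<Rightarrow> indicator {0..1} s * g (u + s *\<^sub>R t n *\<^sub>R w)) * (\<psi> (snd x) * b n (snd x)))"
      by (rule integrable_mult_bounded[OF integrable_line_average[OF g]]) (use \<psi>b in auto)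
    then have int: "integrable (lborel \<Otimes>\<^sub>M lborel) (\<lambda>(s, u). indicator {0..1} s * g (u + s *\<^sub>R t n *\<^sub>R w) * (\<psi> u * b n u))"
      by (simp add: case_prod_beta')
    have "(LINT u|lborel. \<psi> u * b n u * ((f (u + t n *\<^sub>R w) - f u) / t n))
        = (LINT u|lborel. LINT s|lborel. indicator {0..1} s * g (u + s *\<^sub>R t n *\<^sub>R w) * (\<psi> u * b n u))"
      by (rule integral_cong_AE) (use ae in auto)
    also have "\<dots> = (LINT s|lborel. LINT u|lborel. indicator {0..1} s * g (u + s *\<^sub>R t n *\<^sub>R w) * (\<psi> u * b n u))"
      by (rule lborel_pair.Fubini_integral[OF int])
    also have "\<dots> = (LINT s|lborel. indicator {0..1} s * J n s)"
    proof (rule Bochner_Integration.integral_cong[OF refl])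
      fix s :: real
      have "(LINT u|lborel. g (u + s *\<^sub>R t n *\<^sub>R w) * (\<psi> u * b n u)) = J n s"
        using lborel_integral_translate[of "\<lambda>u. \<psi> (u - (s * t n) *\<^sub>R w) * b n (u - (s * t n) *\<^sub>R w) * g u" "(s * t n) *\<^sub>R w"]
        by (simp add: J_def mult_ac)
      then show "(LINT u|lborel. indicator {0..1} s * g (u + s *\<^sub>R t n *\<^sub>R w) * (\<psi> u * b n u)) = indicator {0..1} s * J n s"
        by (simp add: mult.assoc)
    qed
    finally show ?thesis .
  qed
  have Jlim: "(\<lambda>n. J n s) \<longlonglongrightarrow> (LINT u|lborel. \<psi> u * b0 u * g u)" if s: "s \<in> {0..1}" for s
    unfolding J_def
  proof (rule integral_dominated_convergence[where w="\<lambda>u. C\<psi> * C * \<bar>g u\<bar>"])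
    show "AE u in lborel. (\<lambda>n. \<psi> (u - (s * t n) *\<^sub>R w) * b n (u - (s * t n) *\<^sub>R w) * g u) \<longlonglongrightarrow> \<psi> u * b0 u * g u"
      using lim[OF s]
    proof eventually_elim
      case (elim u)
      have "(\<lambda>n. u - (s * t n) *\<^sub>R w) \<longlonglongrightarrow> u - (s * 0) *\<^sub>R w"
        by (intro tendsto_intros t)
      then have \<psi>lim: "(\<lambda>n. \<psi> (u - (s * t n) *\<^sub>R w)) \<longlonglongrightarrow> \<psi> u"
        using continuous_on_tendsto_compose[OF test_function_continuous[OF \<psi>, of UNIV]] by simp
      show ?case
      proof (cases "u \<in> A")
        case True
        with elim \<psi>lim show ?thesis by (intro tendsto_mult) auto
      next
        case False
        then have 0: "\<psi> u = 0" by (rule test_function_eq_0[OF \<psi>])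
        have "(\<lambda>n. \<psi> (u - (s * t n) *\<^sub>R w) * b n (u - (s * t n) *\<^sub>R w)) \<longlonglongrightarrow> 0"
        proof (rule Lim_null_comparison)
          show "\<forall>\<^sub>F n in sequentially. norm (\<psi> (u - (s * t n) *\<^sub>R w) * b n (u - (s * t n) *\<^sub>R w)) \<le> \<bar>\<psi> (u - (s * t n) *\<^sub>R w)\<bar> * C"
            using bC by (intro always_eventually allI) (auto simp: abs_mult intro!: mult_left_mono)
          show "(\<lambda>n. \<bar>\<psi> (u - (s * t n) *\<^sub>R w)\<bar> * C) \<longlonglongrightarrow> 0"
            using tendsto_mult_left_zero[OF tendsto_rabs_zero, of "\<lambda>n. \<psi> (u - (s * t n) *\<^sub>R w)" sequentially C] \<psi>lim 0 by simp
        qed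
        from tendsto_mult_right[OF this, of "g u"] 0 show ?thesis
          by (simp add: mult_ac)
      qed
    qed
    show "AE u in lborel. norm (\<psi> (u - (s * t n) *\<^sub>R w) * b n (u - (s * t n) *\<^sub>R w) * g u) \<le> C\<psi> * C * \<bar>g u\<bar>" for n
      using \<psi>b by (auto simp: abs_mult[of _ "g _"] intro!: mult_right_mono)
  qed (use g in auto)
  have J_bound: "\<bar>J n s\<bar> \<le> C\<psi> * C * (LINT u|lborel. \<bar>g u\<bar>)" for n s
  proof -
    have "\<bar>J n s\<bar> \<le> (LINT u|lborel. \<bar>\<psi> (u - (s * t n) *\<^sub>R w) * b n (u - (s * t n) *\<^sub>R w) * g u\<bar>)"
      unfolding J_def by (rule integral_abs_bound)
    also have "\<dots> \<le> (LINT u|lborel. C\<psi> * C * \<bar>g u\<bar>)"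
    proof (rule integral_mono)
      show "integrable lborel (\<lambda>u. \<bar>\<psi> (u - (s * t n) *\<^sub>R w) * b n (u - (s * t n) *\<^sub>R w) * g u\<bar>)"
        by (intro integrable_abs integrable_mult_bounded(2)[OF g, where C="C\<psi> * C"]) (use \<psi>b in auto)
      show "\<bar>\<psi> (u - (s * t n) *\<^sub>R w) * b n (u - (s * t n) *\<^sub>R w) * g u\<bar> \<le> C\<psi> * C * \<bar>g u\<bar>" for u
        unfolding abs_mult[of _ "g u"] by (intro mult_right_mono \<psi>b) simp
    qed (use g in simp)
    finally show ?thesis by simp
  qed
  have "(\<lambda>n. LINT s|lborel. indicator {0..1} s * J n s) \<longlonglongrightarrow> (LINT s|lborel. indicator {0..1::real} s * (LINT u|lborel. \<psi> u * b0 u * g u))"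
  proof (rule integral_dominated_convergence[where w="\<lambda>s. indicator {0..1} s * (C\<psi> * C * (LINT u|lborel. \<bar>g u\<bar>))"])
    show "AE s in lborel. (\<lambda>n. indicator {0..1} s * J n s) \<longlonglongrightarrow> indicator {0..1} s * (LINT u|lborel. \<psi> u * b0 u * g u)"
      using Jlim by (intro AE_I2) (auto simp: indicator_def)
    show "AE s in lborel. norm (indicator {0..1} s * J n s) \<le> indicator {0..1} s * (C\<psi> * C * (LINT u|lborel. \<bar>g u\<bar>))" for n
      using J_bound by (auto simp: indicator_def)
    have "integrable lborel (indicator {0..1} :: real \<Rightarrow> real)" by (rule integrable_real_indicator) simp_all
    then show "integrable lborel (\<lambda>s::real. indicator {0..1} s * (C\<psi> * C * (LINT u|lborel. \<bar>g u\<bar>)))" by simp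
  qed (auto simp: J_def[abs_def])
  then show ?thesis unfolding eq by simp
qed

subsection \<open>The chain rule\<close>

text \<open>The value on the diagonal makes the quotient continuous there, see \<open>diff_quot_tendsto\<close>.\<close>

definition diff_quot :: "(real \<Rightarrow> real) \<Rightarrow> (real \<Rightarrow> real) \<Rightarrow> real \<Rightarrow> real \<Rightarrow> real" where
  "diff_quot F F' r r' = (if r' = r then F' r else (F r' - F r) / (r' - r))"

lemma diff_quot_mult: "diff_quot F F' r r' * (r' - r) = F r' - F r"
  by (simp add: diff_quot_def)

lemma diff_quot_mean_value:
  assumes "\<And>x. (F has_real_derivative F' x) (at x)"
  shows "\<exists>\<xi>. min r r' \<le> \<xi> \<and> \<xi> \<le> max r r' \<and> diff_quot F F' r r' = F' \<xi>"
proof (cases r r' rule: linorder_cases)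
  case less
  obtain z where "r < z" "z < r'" "F r' - F r = (r' - r) * F' z"
    using MVT2[OF less, of F F'] assms by blast
  with less show ?thesis by (intro exI[of _ z]) (simp add: diff_quot_def)
next
  case equal
  then show ?thesis by (intro exI[of _ r]) (simp add: diff_quot_def)
next
  case greater
  obtain z where z: "r' < z" "z < r" "F r - F r' = (r - r') * F' z"
    using MVT2[OF greater, of F F'] assms by blast
  then have "F r' - F r = F' z * (r' - r)" by (simp add: algebra_simps)
  with greater z show ?thesis by (intro exI[of _ z]) (simp add: diff_quot_def)
qed

lemma diff_quot_tendsto:
  fixes G G1 :: "real \<Rightarrow> real \<Rightarrow> real"
  assumes G1: "\<And>r v. ((\<lambda>r. G r v) has_real_derivative G1 r v) (at r)"
    and cont: "continuous_on UNIV (\<lambda>x. G1 (fst x) (snd x))"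
    and lim: "r \<longlonglongrightarrow> r0" "r' \<longlonglongrightarrow> r0" "v \<longlonglongrightarrow> v0"
  shows "(\<lambda>n. diff_quot (\<lambda>x. G x (v n)) (\<lambda>x. G1 x (v n)) (r n) (r' n)) \<longlonglongrightarrow> G1 r0 v0"
proof -
  have "\<forall>n. \<exists>\<xi>. min (r n) (r' n) \<le> \<xi> \<and> \<xi> \<le> max (r n) (r' n) \<and>
      diff_quot (\<lambda>x. G x (v n)) (\<lambda>x. G1 x (v n)) (r n) (r' n) = G1 \<xi> (v n)"
    using diff_quot_mean_value[of "\<lambda>x. G x (v _)" "\<lambda>x. G1 x (v _)"] G1 by blast
  then obtain \<xi> where \<xi>: "\<And>n. min (r n) (r' n) \<le> \<xi> n" "\<And>n. \<xi> n \<le> max (r n) (r' n)"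
    "\<And>n. diff_quot (\<lambda>x. G x (v n)) (\<lambda>x. G1 x (v n)) (r n) (r' n) = G1 (\<xi> n) (v n)" by metis
  have "\<xi> \<longlonglongrightarrow> r0"
  proof (rule tendsto_sandwich)
    show "(\<lambda>n. min (r n) (r' n)) \<longlonglongrightarrow> r0" "(\<lambda>n. max (r n) (r' n)) \<longlonglongrightarrow> r0"
      using tendsto_min[OF lim(1,2)] tendsto_max[OF lim(1,2)] by simp_all
  qed (use \<xi> in auto)
  then have "(\<lambda>n. (\<xi> n, v n)) \<longlonglongrightarrow> (r0, v0)" by (intro tendsto_Pair lim)
  from continuous_on_tendsto_compose[OF cont this] show ?thesis by (simp add: \<xi>)
qed

lemma integrable_indicator_compact:
  fixes K :: "'e::euclidean_space set"
  assumes "compact K"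
  shows "integrable lborel (indicator K :: 'e \<Rightarrow> real)"
  using assms emeasure_bounded_finite[OF compact_imp_bounded[OF assms]]
  by (intro integrable_real_indicator) (simp_all add: compact_imp_closed)

lemma continuous_on_flip:
  assumes "continuous_on UNIV (\<lambda>x. G (fst x) (snd x))"
  shows "continuous_on UNIV (\<lambda>x. G (snd x) (fst x))"
  using continuous_on_compose2[OF assms, of UNIV "\<lambda>x. (snd x, fst x)"]
  by (simp add: continuous_on_Pair continuous_on_fst continuous_on_snd)

lemma borel_measurable_diff_quot:
  fixes G G1 :: "real \<Rightarrow> real \<Rightarrow> real"
  assumes G: "continuous_on UNIV (\<lambda>x. G (fst x) (snd x))"
    and G1: "continuous_on UNIV (\<lambda>x. G1 (fst x) (snd x))"
    and [measurable]: "r \<in> borel_measurable M" "r' \<in> borel_measurable M" "v \<in> borel_measurable M"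
  shows "(\<lambda>u. diff_quot (\<lambda>x. G x (v u)) (\<lambda>x. G1 x (v u)) (r u) (r' u)) \<in> borel_measurable M"
proof -
  note [measurable] = borel_measurable_continuous_Pair[OF _ _ G] borel_measurable_continuous_Pair[OF _ _ G1]
  show ?thesis unfolding diff_quot_def by measurable
qed

text \<open>The increment of \<open>G f h\<close> over a translation is a bounded difference quotient times the increment
  of \<open>f\<close>, plus the same for \<open>h\<close>. Moving the translation onto the bounded factor leaves the fixed
  integrable function \<open>f'\<close>, so that dominated convergence applies.\<close>

theorem weak_dir_deriv_chain:
  fixes f h :: "'e::euclidean_space \<Rightarrow> real"
  assumes S: "open S"
    and f: "weak_dir_deriv S w f f'" and h: "weak_dir_deriv S w h h'"
    and B: "B \<ge> 0" "\<And>u. u \<in> S \<Longrightarrow> \<bar>h u\<bar> \<le> B"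
    and G1: "\<And>r v. ((\<lambda>r. G r v) has_real_derivative G1 r v) (at r)"
    and G2: "\<And>r v. ((\<lambda>v. G r v) has_real_derivative G2 r v) (at v)"
    and cont: "continuous_on UNIV (\<lambda>x. G (fst x) (snd x))"
      "continuous_on UNIV (\<lambda>x. G1 (fst x) (snd x))"
      "continuous_on UNIV (\<lambda>x. G2 (fst x) (snd x))"
    and C: "\<And>r v. \<bar>v\<bar> \<le> B \<Longrightarrow> \<bar>G r v\<bar> \<le> C" "\<And>r v. \<bar>v\<bar> \<le> B \<Longrightarrow> \<bar>G1 r v\<bar> \<le> C"
      "\<And>r v. \<bar>v\<bar> \<le> B \<Longrightarrow> \<bar>G2 r v\<bar> \<le> C"
  shows "weak_dir_deriv S w (\<lambda>u. G (f u) (h u)) (\<lambda>u. G1 (f u) (h u) * f' u + G2 (f u) (h u) * h' u)"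
proof -
  note [measurable] = borel_measurable_continuous_Pair[OF _ _ cont(1)]
    borel_measurable_continuous_Pair[OF _ _ cont(2)] borel_measurable_continuous_Pair[OF _ _ cont(3)]
  define ex where "ex K k u = indicator K u * k u" for K :: "'e set" and k :: "'e \<Rightarrow> real" and u
  have ex_int: "integrable lborel (ex K k)" if "locally_integrable_on k S" "compact K" "K \<subseteq> S" for K k
    using that by (simp add: ex_def[abs_def] locally_integrable_on_def set_integrable_def)
  have loc: "locally_integrable_on f S" "locally_integrable_on f' S" "locally_integrable_on h S" "locally_integrable_on h' S"
    using f h by (auto simp: weak_dir_deriv_def)
  have exB: "\<bar>ex K h u\<bar> \<le> B" if "K \<subseteq> S" for K u
    using that B by (auto simp: ex_def indicator_def)
  show ?thesis
    unfolding weak_dir_deriv_def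
  proof (intro conjI ballI)
    show "locally_integrable_on (\<lambda>u. G (f u) (h u)) S"
      unfolding locally_integrable_on_def set_integrable_def
    proof (intro allI impI)
      fix K assume K: "compact K" "K \<subseteq> S"
      note [measurable] = borel_measurable_integrable[OF ex_int[OF loc(1) K]] borel_measurable_integrable[OF ex_int[OF loc(3) K]]
      have "integrable lborel (indicator K :: 'e \<Rightarrow> real)"
        using K(1) by (rule integrable_indicator_compact)
      then have "integrable lborel (\<lambda>u. indicator K u * G (ex K f u) (ex K h u))"
        by (rule integrable_mult_bounded) (use C(1) exB[OF K(2)] in auto)
      moreover have "indicator K u * G (ex K f u) (ex K h u) = indicator K u *\<^sub>R G (f u) (h u)" for u
        by (simp add: ex_def indicator_def)
      ultimately show "integrable lborel (\<lambda>u. indicator K u *\<^sub>R G (f u) (h u))" by simp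
    qed
    show "locally_integrable_on (\<lambda>u. G1 (f u) (h u) * f' u + G2 (f u) (h u) * h' u) S"
      unfolding locally_integrable_on_def set_integrable_def
    proof (intro allI impI)
      fix K assume K: "compact K" "K \<subseteq> S"
      note [measurable] = borel_measurable_integrable[OF ex_int[OF loc(1) K]] borel_measurable_integrable[OF ex_int[OF loc(3) K]]
      have "integrable lborel (\<lambda>u. G1 (ex K f u) (ex K h u) * ex K f' u + G2 (ex K f u) (ex K h u) * ex K h' u)"
        by (intro Bochner_Integration.integrable_add integrable_mult_bounded(2)[OF ex_int[OF loc(2) K], where C=C]
          integrable_mult_bounded(2)[OF ex_int[OF loc(4) K], where C=C]) (use C exB[OF K(2)] in auto)
      moreover have "G1 (ex K f u) (ex K h u) * ex K f' u + G2 (ex K f u) (ex K h u) * ex K h' u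
          = indicator K u *\<^sub>R (G1 (f u) (h u) * f' u + G2 (f u) (h u) * h' u)" for u
        by (simp add: ex_def indicator_def)
      ultimately show "integrable lborel (\<lambda>u. indicator K u *\<^sub>R (G1 (f u) (h u) * f' u + G2 (f u) (h u) * h' u))" by simp
    qed
  next
    fix \<psi> assume \<psi>: "\<psi> \<in> test_functions S"
    let ?K0 = "closure {u. \<psi> u \<noteq> 0}"
    have K0: "compact ?K0" "?K0 \<subseteq> S" using \<psi> by (auto simp: test_functions_def)
    obtain \<epsilon> where \<epsilon>: "\<epsilon> > 0" "(\<Union>x\<in>?K0. cball x \<epsilon>) \<subseteq> S"
      using compact_subset_open_imp_cball_epsilon_subset[OF K0(1) S K0(2)] by metis
    define K where "K = (\<Union>x\<in>?K0. cball x \<epsilon>)"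
    define U where "U = (\<Union>x\<in>?K0. ball x \<epsilon>)"
    define A where "A = (\<Union>x\<in>?K0. ball x (\<epsilon> / 2))"
    have K: "compact K" "K \<subseteq> S" using \<epsilon> K0 by (auto simp: K_def compact_minkowski_sum_cball)
    have UK: "U \<subseteq> K" by (auto simp: U_def K_def)
    have AU: "A \<subseteq> U" using \<epsilon> by (force simp: A_def U_def)
    have A: "open A" by (auto simp: A_def)
    have "?K0 \<subseteq> A" using \<epsilon> by (force simp: A_def)
    then have \<psi>A: "\<psi> \<in> test_functions A" using \<psi> by (auto simp: test_functions_def)
    define F where "F = ex K f" define F' where "F' = ex K f'"
    define H where "H = ex K h" define H' where "H' = ex K h'"
    have int: "integrable lborel F" "integrable lborel F'" "integrable lborel H" "integrable lborel H'"
      unfolding F_def F'_def H_def H'_def using ex_int loc K by auto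
    have [measurable]: "F \<in> borel_measurable borel" "F' \<in> borel_measurable borel"
      "H \<in> borel_measurable borel" "H' \<in> borel_measurable borel" using int by auto
    have eqK: "F u = f u" "F' u = f' u" "H u = h u" "H' u = h' u" if "u \<in> K" for u
      using that by (auto simp: F_def F'_def H_def H'_def ex_def)
    have HB: "\<bar>H u\<bar> \<le> B" for u unfolding H_def by (rule exB[OF K(2)])
    have US: "U \<subseteq> S" using UK K(2) by (rule order_trans)
    have wF: "weak_dir_deriv U w F F'"
      by (rule weak_dir_deriv_restrict[OF f US]) (simp_all add: eqK subsetD[OF UK])
    have wH: "weak_dir_deriv U w H H'"
      by (rule weak_dir_deriv_restrict[OF h US]) (simp_all add: eqK subsetD[OF UK])
    \<comment> \<open>Steps of length at most \<open>d\<close> along \<open>w\<close> lead from \<open>A\<close> to points of \<open>U\<close>.\<close>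
    define d where "d = \<epsilon> / (2 * (norm w + 1))"
    have d0: "d > 0" using \<epsilon> by (simp add: d_def add_nonneg_pos)
    have "norm w + 1 > 0" by (simp add: add_nonneg_pos)
    then have "d * (norm w + 1) = \<epsilon> / 2" unfolding d_def by (simp add: divide_simps)
    then have dw: "d * norm w < \<epsilon> / 2" using d0 by (simp add: distrib_left)
    have seg: "u + s *\<^sub>R w \<in> U" if "u \<in> A" "\<bar>s\<bar> \<le> d" for u s
    proof -
      from that(1) obtain x where x0: "x \<in> ?K0" "u \<in> ball x (\<epsilon> / 2)" unfolding A_def by (rule UN_E)
      then have x: "dist x u < \<epsilon> / 2" by (simp only: mem_ball)
      have "dist x (u + s *\<^sub>R w) \<le> dist x u + dist u (u + s *\<^sub>R w)" by (rule dist_triangle)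
      also have "dist u (u + s *\<^sub>R w) = \<bar>s\<bar> * norm w" by (simp add: dist_norm)
      also have "\<dots> \<le> d * norm w" using that(2) by (intro mult_right_mono) auto
      finally have "dist x (u + s *\<^sub>R w) < \<epsilon>" using x dw by simp
      then have "u + s *\<^sub>R w \<in> ball x \<epsilon>" by (simp only: mem_ball)
      with x0(1) show ?thesis unfolding U_def by (rule UN_I)
    qed
    \<comment> \<open>Geometric decay is what \<open>weak_dir_deriv_translates_tendsto\<close> asks for.\<close>
    define t where "t n = d * (1 / 2) ^ n" for n :: nat
    have t0: "t n > 0" and td: "t n \<le> d" for n
      using d0 by (auto simp: t_def intro!: mult_left_le power_le_one)
    have tlim: "t \<longlonglongrightarrow> 0"
      unfolding t_def by (intro tendsto_mult_right_zero LIMSEQ_realpow_zero) auto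
    have st: "\<bar>s * t n\<bar> \<le> d * (1 / 2) ^ n" "\<bar>(1 - s) * t n\<bar> \<le> d * (1 / 2) ^ n" if "s \<in> {0..1}" for s n
      using that t0[of n] by (auto simp: abs_mult t_def[symmetric] intro!: mult_left_le_one_le)
    have seg': "u + (s * t n) *\<^sub>R w \<in> U" if "u \<in> A" "s \<in> {0..1}" for u s n
      using that seg st(1)[of s n] td[of n] by (auto simp: t_def)
    \<comment> \<open>The two bounded factors in the increment of \<open>G F H\<close>.\<close>
    define b1 where "b1 n u = diff_quot (\<lambda>x. G x (H (u + t n *\<^sub>R w))) (\<lambda>x. G1 x (H (u + t n *\<^sub>R w))) (F u) (F (u + t n *\<^sub>R w))" for n u
    define b2 where "b2 n u = diff_quot (\<lambda>x. G (F u) x) (\<lambda>x. G2 (F u) x) (H u) (H (u + t n *\<^sub>R w))" for n u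
    have [measurable]: "b1 n \<in> borel_measurable borel" for n
      unfolding b1_def by (rule borel_measurable_diff_quot[OF cont(1,2)]) measurable
    have [measurable]: "b2 n \<in> borel_measurable borel" for n
      unfolding b2_def by (rule borel_measurable_diff_quot[OF continuous_on_flip[OF cont(1)] continuous_on_flip[OF cont(3)]]) measurable
    have b1C: "\<bar>b1 n u\<bar> \<le> C" for n u
    proof -
      obtain \<xi> where "b1 n u = G1 \<xi> (H (u + t n *\<^sub>R w))"
        using diff_quot_mean_value[of "\<lambda>x. G x (H (u + t n *\<^sub>R w))" "\<lambda>x. G1 x (H (u + t n *\<^sub>R w))" "F u" "F (u + t n *\<^sub>R w)", OF G1]
        unfolding b1_def by auto
      with C(2) HB show ?thesis by simp
    qed
    have b2C: "\<bar>b2 n u\<bar> \<le> C" for n u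
    proof -
      obtain \<xi> where \<xi>: "min (H u) (H (u + t n *\<^sub>R w)) \<le> \<xi>" "\<xi> \<le> max (H u) (H (u + t n *\<^sub>R w))" "b2 n u = G2 (F u) \<xi>"
        using diff_quot_mean_value[of "\<lambda>x. G (F u) x" "\<lambda>x. G2 (F u) x" "H u" "H (u + t n *\<^sub>R w)", OF G2]
        unfolding b2_def by metis
      have "\<bar>\<xi>\<bar> \<le> B" using \<xi>(1,2) HB[of u] HB[of "u + t n *\<^sub>R w"] by (auto simp: abs_le_iff min_def max_def split: if_splits)
      with C(3) \<xi> show ?thesis by simp
    qed
    have lims: "AE u in lborel. u \<in> A \<longrightarrow> (\<lambda>n. k (u - (s * t n) *\<^sub>R w)) \<longlonglongrightarrow> k u \<and>
        (\<lambda>n. k (u - (s * t n) *\<^sub>R w + t n *\<^sub>R w)) \<longlonglongrightarrow> k u"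
      if "s \<in> {0..1}" "weak_dir_deriv U w k k'" "integrable lborel k" "integrable lborel k'" for s k k'
    proof -
      have "AE u in lborel. u \<in> A \<longrightarrow> (\<lambda>n. k (u + (- (s * t n)) *\<^sub>R w)) \<longlonglongrightarrow> k u"
        by (rule weak_dir_deriv_translates_tendsto[OF that(2-4) A seg]) (use st(1)[OF that(1)] in auto)
      moreover have "AE u in lborel. u \<in> A \<longrightarrow> (\<lambda>n. k (u + ((1 - s) * t n) *\<^sub>R w)) \<longlonglongrightarrow> k u"
        by (rule weak_dir_deriv_translates_tendsto[OF that(2-4) A seg]) (use st(2)[OF that(1)] in auto)
      ultimately show ?thesis
        by eventually_elim (simp add: algebra_simps)
    qed
    have lim: "AE u in lborel. u \<in> A \<longrightarrow> (\<lambda>n. b1 n (u - (s * t n) *\<^sub>R w)) \<longlonglongrightarrow> G1 (F u) (H u)"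
      "AE u in lborel. u \<in> A \<longrightarrow> (\<lambda>n. b2 n (u - (s * t n) *\<^sub>R w)) \<longlonglongrightarrow> G2 (F u) (H u)" if "s \<in> {0..1}" for s
    proof -
      have 1: "AE u in lborel. u \<in> A \<longrightarrow>
          (\<lambda>n. F (u - (s * t n) *\<^sub>R w)) \<longlonglongrightarrow> F u \<and> (\<lambda>n. F (u - (s * t n) *\<^sub>R w + t n *\<^sub>R w)) \<longlonglongrightarrow> F u \<and>
          (\<lambda>n. H (u - (s * t n) *\<^sub>R w)) \<longlonglongrightarrow> H u \<and> (\<lambda>n. H (u - (s * t n) *\<^sub>R w + t n *\<^sub>R w)) \<longlonglongrightarrow> H u"
        using lims[OF that wF int(1,2)] lims[OF that wH int(3,4)] by eventually_elim auto
      show "AE u in lborel. u \<in> A \<longrightarrow> (\<lambda>n. b1 n (u - (s * t n) *\<^sub>R w)) \<longlonglongrightarrow> G1 (F u) (H u)"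
        using 1 unfolding b1_def 
      proof eventually_elim
        case (elim u)
        show ?case
        proof
          assume "u \<in> A"
          with elim have l: "(\<lambda>n. F (u - (s * t n) *\<^sub>R w)) \<longlonglongrightarrow> F u" "(\<lambda>n. F (u - (s * t n) *\<^sub>R w + t n *\<^sub>R w)) \<longlonglongrightarrow> F u"
            "(\<lambda>n. H (u - (s * t n) *\<^sub>R w + t n *\<^sub>R w)) \<longlonglongrightarrow> H u" by blast+
          show "(\<lambda>n. diff_quot (\<lambda>x. G x (H (u - (s * t n) *\<^sub>R w + t n *\<^sub>R w)))
              (\<lambda>x. G1 x (H (u - (s * t n) *\<^sub>R w + t n *\<^sub>R w)))
              (F (u - (s * t n) *\<^sub>R w)) (F (u - (s * t n) *\<^sub>R w + t n *\<^sub>R w))) \<longlonglongrightarrow> G1 (F u) (H u)"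
            by (rule diff_quot_tendsto[OF G1 cont(2) l])
        qed
      qed
      show "AE u in lborel. u \<in> A \<longrightarrow> (\<lambda>n. b2 n (u - (s * t n) *\<^sub>R w)) \<longlonglongrightarrow> G2 (F u) (H u)"
        using 1 unfolding b2_def
      proof eventually_elim
        case (elim u)
        show ?case
        proof
          assume "u \<in> A"
          with elim have l: "(\<lambda>n. H (u - (s * t n) *\<^sub>R w)) \<longlonglongrightarrow> H u" "(\<lambda>n. H (u - (s * t n) *\<^sub>R w + t n *\<^sub>R w)) \<longlonglongrightarrow> H u"
            "(\<lambda>n. F (u - (s * t n) *\<^sub>R w)) \<longlonglongrightarrow> F u" by blast+
          show "(\<lambda>n. diff_quot (\<lambda>x. G (F (u - (s * t n) *\<^sub>R w)) x) (\<lambda>x. G2 (F (u - (s * t n) *\<^sub>R w)) x)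
              (H (u - (s * t n) *\<^sub>R w)) (H (u - (s * t n) *\<^sub>R w + t n *\<^sub>R w))) \<longlonglongrightarrow> G2 (F u) (H u)"
            by (rule diff_quot_tendsto[of "\<lambda>x r. G r x" "\<lambda>x r. G2 r x", OF G2 continuous_on_flip[OF cont(3)] l])
        qed
      qed
    qed
    obtain C\<psi> where C\<psi>0: "C\<psi> > 0" and C\<psi>: "\<And>u. \<bar>\<psi> u\<bar> \<le> C\<psi>" using test_function_bounded[OF \<psi>] by metis
    obtain C' where C'0: "C' > 0" and C': "\<And>u. \<bar>frechet_derivative \<psi> (at u) w\<bar> \<le> C'" using test_function_deriv_bounded[OF \<psi>] by metis
    note [measurable] = borel_measurable_test_function[OF \<psi>] borel_measurable_test_function_deriv[OF \<psi>]
    have [measurable]: "K \<in> sets borel" using K(1) by (simp add: compact_imp_closed)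
    define \<Phi> where "\<Phi> u = indicator K u * G (F u) (H u)" for u
    have \<Phi>: "integrable lborel \<Phi>"
    proof -
      have "integrable lborel (indicator K :: 'e \<Rightarrow> real)"
        using K(1) by (rule integrable_indicator_compact)
      then show ?thesis unfolding \<Phi>_def[abs_def]
        by (rule integrable_mult_bounded) (use C(1) HB in auto)
    qed
    have [measurable]: "\<Phi> \<in> borel_measurable borel" using \<Phi> by auto
    have i: "integrable lborel (\<lambda>u. k u * \<psi> (u - c))" if "integrable lborel k" for k c
      using that by (rule integrable_mult_bounded) (use C\<psi> in auto)
    note i0 = i[where c=0, simplified]
    have "(\<lambda>n. LINT u|lborel. \<psi> u * b1 n u * ((F (u + t n *\<^sub>R w) - F u) / t n)) \<longlonglongrightarrow> (LINT u|lborel. \<psi> u * G1 (F u) (H u) * F' u)"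
      by (rule difference_quotient_limit[OF \<psi>A A wF int(1,2) t0 tlim seg' _ b1C _ lim(1)]) measurable
    moreover have "(\<lambda>n. LINT u|lborel. \<psi> u * b2 n u * ((H (u + t n *\<^sub>R w) - H u) / t n)) \<longlonglongrightarrow> (LINT u|lborel. \<psi> u * G2 (F u) (H u) * H' u)"
      by (rule difference_quotient_limit[OF \<psi>A A wH int(3,4) t0 tlim seg' _ b2C _ lim(2)]) measurable
    ultimately have "(\<lambda>n. (LINT u|lborel. \<psi> u * b1 n u * ((F (u + t n *\<^sub>R w) - F u) / t n)) + (LINT u|lborel. \<psi> u * b2 n u * ((H (u + t n *\<^sub>R w) - H u) / t n)))
        \<longlonglongrightarrow> (LINT u|lborel. \<psi> u * G1 (F u) (H u) * F' u) + (LINT u|lborel. \<psi> u * G2 (F u) (H u) * H' u)"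
      by (rule tendsto_add)
    moreover have "(LINT u|lborel. \<psi> u * b1 n u * ((F (u + t n *\<^sub>R w) - F u) / t n)) + (LINT u|lborel. \<psi> u * b2 n u * ((H (u + t n *\<^sub>R w) - H u) / t n))
        = (LINT u|lborel. \<Phi> u * ((\<psi> (u - t n *\<^sub>R w) - \<psi> u) / t n))" for n
    proof -
      have ib: "integrable lborel (\<lambda>u. \<psi> u * b u * ((k (u + t n *\<^sub>R w) - k u) / t n))"
        if "integrable lborel k" "b \<in> borel_measurable borel" "\<And>u. \<bar>b u\<bar> \<le> C" for k b
      proof (rule integrable_mult_bounded(2)[where C="C\<psi> * C"])
        show "integrable lborel (\<lambda>u. (k (u + t n *\<^sub>R w) - k u) / t n)"
          using that(1) lborel_integrable_translate[OF that(1)] by simp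
        show "\<bar>\<psi> u * b u\<bar> \<le> C\<psi> * C" for u
          unfolding abs_mult using C\<psi>0 C\<psi> that(3) by (intro mult_mono) auto
      qed (use that in auto)
      have "(LINT u|lborel. \<psi> u * b1 n u * ((F (u + t n *\<^sub>R w) - F u) / t n)) + (LINT u|lborel. \<psi> u * b2 n u * ((H (u + t n *\<^sub>R w) - H u) / t n))
        = (LINT u|lborel. \<psi> u * b1 n u * ((F (u + t n *\<^sub>R w) - F u) / t n) + \<psi> u * b2 n u * ((H (u + t n *\<^sub>R w) - H u) / t n))"
        by (rule Bochner_Integration.integral_add[symmetric]; rule ib) (use int b1C b2C in auto)
      also have "\<dots> = (LINT u|lborel. (\<Phi> (u + t n *\<^sub>R w) - \<Phi> u) * \<psi> u / t n)"
      proof (rule Bochner_Integration.integral_cong[OF refl])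
        fix u
        show "\<psi> u * b1 n u * ((F (u + t n *\<^sub>R w) - F u) / t n) + \<psi> u * b2 n u * ((H (u + t n *\<^sub>R w) - H u) / t n)
            = (\<Phi> (u + t n *\<^sub>R w) - \<Phi> u) * \<psi> u / t n"
        proof (cases "u \<in> A")
          case True
          then have "u \<in> K" "u + t n *\<^sub>R w \<in> K"
            using AU UK seg'[OF True, of 1 n] by auto
          then have "\<Phi> (u + t n *\<^sub>R w) - \<Phi> u = G (F (u + t n *\<^sub>R w)) (H (u + t n *\<^sub>R w)) - G (F u) (H u)"
            by (simp add: \<Phi>_def)
          also have "\<dots> = b1 n u * (F (u + t n *\<^sub>R w) - F u) + b2 n u * (H (u + t n *\<^sub>R w) - H u)"
            unfolding b1_def b2_def diff_quot_mult by simp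
          finally show ?thesis by (simp add: distrib_left distrib_right add_divide_distrib mult_ac)
        qed (simp add: test_function_eq_0[OF \<psi>A])
      qed
      also have "\<dots> = ((LINT u|lborel. \<Phi> (u + t n *\<^sub>R w) * \<psi> u) - (LINT u|lborel. \<Phi> u * \<psi> u)) / t n"
        using i0[OF \<Phi>] i0[OF lborel_integrable_translate[OF \<Phi>]] by (simp add: left_diff_distrib)
      also have "(LINT u|lborel. \<Phi> (u + t n *\<^sub>R w) * \<psi> u) = (LINT u|lborel. \<Phi> u * \<psi> (u - t n *\<^sub>R w))"
        using lborel_integral_translate[of "\<lambda>u. \<Phi> u * \<psi> (u - t n *\<^sub>R w)" "t n *\<^sub>R w"] by simp
      also have "((LINT u|lborel. \<Phi> u * \<psi> (u - t n *\<^sub>R w)) - (LINT u|lborel. \<Phi> u * \<psi> u)) / t n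
          = (LINT u|lborel. \<Phi> u * ((\<psi> (u - t n *\<^sub>R w) - \<psi> u) / t n))"
        using i0[OF \<Phi>] i[OF \<Phi>] by (simp add: right_diff_distrib)
      finally show ?thesis .
    qed
    moreover have "(\<lambda>n. LINT u|lborel. \<Phi> u * ((\<psi> (u - t n *\<^sub>R w) - \<psi> u) / t n)) \<longlonglongrightarrow> (LINT u|lborel. \<Phi> u * (- frechet_derivative \<psi> (at u) w))"
    proof (rule integral_dominated_convergence[where w="\<lambda>u. \<bar>\<Phi> u\<bar> * C'"])
      note line = test_function_line_derivative[OF \<psi>]
      have dq: "(\<lambda>n. (\<psi> (u - t n *\<^sub>R w) - \<psi> u) / t n) \<longlonglongrightarrow> - frechet_derivative \<psi> (at u) w" for u
      proof -
        have "((\<lambda>s. (\<psi> (u - s *\<^sub>R w) - \<psi> u) / s) \<longlongrightarrow> - frechet_derivative \<psi> (at u) w) (at 0)"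
          using line[of u w 0] by (simp add: DERIV_def)
        moreover have "filterlim t (at 0) sequentially"
          using tlim t0 by (simp add: filterlim_at less_imp_neq[symmetric])
        ultimately show ?thesis by (rule filterlim_compose)
      qed
      show "AE u in lborel. (\<lambda>n. \<Phi> u * ((\<psi> (u - t n *\<^sub>R w) - \<psi> u) / t n)) \<longlonglongrightarrow> \<Phi> u * (- frechet_derivative \<psi> (at u) w)"
        by (intro AE_I2 tendsto_mult tendsto_const dq)
      show "AE u in lborel. norm (\<Phi> u * ((\<psi> (u - t n *\<^sub>R w) - \<psi> u) / t n)) \<le> \<bar>\<Phi> u\<bar> * C'" for n
      proof (rule AE_I2)
        fix u
        obtain z where "\<psi> (u - t n *\<^sub>R w) - \<psi> (u - 0 *\<^sub>R w) = (t n - 0) * (- frechet_derivative \<psi> (at (u - z *\<^sub>R w)) w)"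
          using MVT2[OF t0[of n], of "\<lambda>s. \<psi> (u - s *\<^sub>R w)" "\<lambda>s. - frechet_derivative \<psi> (at (u - s *\<^sub>R w)) w"] line by blast
        then have "(\<psi> (u - t n *\<^sub>R w) - \<psi> u) / t n = - frechet_derivative \<psi> (at (u - z *\<^sub>R w)) w"
          using t0[of n] by simp
        then have "\<bar>(\<psi> (u - t n *\<^sub>R w) - \<psi> u) / t n\<bar> \<le> C'" using C' by simp
        then show "norm (\<Phi> u * ((\<psi> (u - t n *\<^sub>R w) - \<psi> u) / t n)) \<le> \<bar>\<Phi> u\<bar> * C'"
          unfolding real_norm_def abs_mult[of "\<Phi> u"] by (intro mult_left_mono) auto
      qed
    qed (use \<Phi> in auto)
    ultimately have lim_eq: "(LINT u|lborel. \<psi> u * G1 (F u) (H u) * F' u) + (LINT u|lborel. \<psi> u * G2 (F u) (H u) * H' u)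
        = (LINT u|lborel. \<Phi> u * (- frechet_derivative \<psi> (at u) w))"
      using LIMSEQ_unique by simp
    have ig: "integrable lborel (\<lambda>u. \<psi> u * b u * k u)"
      if "integrable lborel k" "b \<in> borel_measurable borel" "\<And>u. \<bar>b u\<bar> \<le> C" for k b
    proof (rule integrable_mult_bounded(2)[OF that(1), where C="C\<psi> * C"])
      show "\<bar>\<psi> u * b u\<bar> \<le> C\<psi> * C" for u
        unfolding abs_mult using C\<psi>0 C\<psi> that(3) by (intro mult_mono) auto
    qed (use that in auto)
    have "(LINT u:S|lborel. (G1 (f u) (h u) * f' u + G2 (f u) (h u) * h' u) * \<psi> u)
        = (LINT u|lborel. (G1 (f u) (h u) * f' u + G2 (f u) (h u) * h' u) * \<psi> u)"
      by (rule set_integral_test_function[OF \<psi> order_refl])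
    also have "\<dots> = (LINT u|lborel. \<psi> u * G1 (F u) (H u) * F' u + \<psi> u * G2 (F u) (H u) * H' u)"
    proof (rule Bochner_Integration.integral_cong[OF refl])
      fix u
      show "(G1 (f u) (h u) * f' u + G2 (f u) (h u) * h' u) * \<psi> u = \<psi> u * G1 (F u) (H u) * F' u + \<psi> u * G2 (F u) (H u) * H' u"
      proof (cases "u \<in> A")
        case True
        then have "u \<in> K" using AU UK by blast
        then show ?thesis by (simp add: eqK algebra_simps)
      qed (simp add: test_function_eq_0[OF \<psi>A])
    qed
    also have "\<dots> = (LINT u|lborel. \<psi> u * G1 (F u) (H u) * F' u) + (LINT u|lborel. \<psi> u * G2 (F u) (H u) * H' u)"
      by (rule Bochner_Integration.integral_add; rule ig) (use int C(2,3) HB in auto)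
    also have "\<dots> = - (LINT u|lborel. \<Phi> u * frechet_derivative \<psi> (at u) w)"
      unfolding lim_eq by simp
    also have "(LINT u|lborel. \<Phi> u * frechet_derivative \<psi> (at u) w) = (LINT u|lborel. G (f u) (h u) * frechet_derivative \<psi> (at u) w)"
    proof (rule Bochner_Integration.integral_cong[OF refl])
      fix u
      show "\<Phi> u * frechet_derivative \<psi> (at u) w = G (f u) (h u) * frechet_derivative \<psi> (at u) w"
      proof (cases "u \<in> A")
        case True
        then have "u \<in> K" using AU UK by blast
        then show ?thesis by (simp add: eqK \<Phi>_def)
      qed (simp add: test_function_deriv_eq_0[OF \<psi>A])
    qed
    also have "\<dots> = (LINT u:S|lborel. G (f u) (h u) * frechet_derivative \<psi> (at u) w)"
      by (rule set_integral_test_function[OF \<psi> order_refl, symmetric])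
    finally show "(LINT u:S|lborel. G (f u) (h u) * frechet_derivative \<psi> (at u) w)
        = - (LINT u:S|lborel. (G1 (f u) (h u) * f' u + G2 (f u) (h u) * h' u) * \<psi> u)" by simp
  qed
qed

subsection \<open>Vanishing weak derivatives\<close>

lemma AE_lborel_translate:
  fixes c :: "'e::euclidean_space"
  assumes "AE u in lborel. P u"
  shows "AE u in lborel. P (u + c)"
proof -
  have "AE u in distr lborel borel ((+) c). P u" unfolding lborel_distr_plus by (rule assms)
  then have "AE u in lborel. P (c + u)" by (rule AE_distrD[rotated]) simp
  then show ?thesis by (simp add: add.commute)
qed

lemma AE_ball_imp_ex:
  fixes x :: "'e::euclidean_space"
  assumes "r > 0" "AE u in lborel. u \<in> ball x r \<longrightarrow> P u"
  shows "\<exists>u\<in>ball x r. P u"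
proof (rule ccontr)
  assume "\<not> ?thesis"
  with assms(2) have "AE u in lborel. u \<notin> ball x r" by (auto elim: eventually_mono)
  then have "emeasure lborel (ball x r) = 0"
    by (subst (asm) AE_iff_measurable[of "ball x r"]) (simp_all add: ball_def)
  then have "negligible (ball x r)"
    using negligible_iff_emeasure0[of "ball x r"] by simp
  then show False using \<open>r > 0\<close> open_not_negligible[of "ball x r"] by simp
qed

text \<open>For each small \<open>w\<close> the translation identity gives \<open>f (u + w) = f u\<close> for almost every \<open>u\<close>. By Fubini's
  theorem there is one point \<open>u\<close> that is good for almost every \<open>w\<close>, and its translates fill the ball.\<close>

lemma weak_dir_deriv_zero_locally_const:
  fixes f :: "'e::euclidean_space \<Rightarrow> real"
  assumes S: "open S" "x \<in> S" and w: "\<And>w. weak_dir_deriv S w f (\<lambda>_. 0)"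
  shows "\<exists>r>0. ball x r \<subseteq> S \<and> (\<exists>c. AE u in lborel. u \<in> ball x r \<longrightarrow> f u = c)"
proof -
  obtain e where e: "e > 0" "cball x e \<subseteq> S" using S open_contains_cball by blast
  define r where "r = e / 3"
  have r: "r > 0" using e by (simp add: r_def)
  have r3: "ball x (3 * r) \<subseteq> cball x e" by (simp add: r_def ball_subset_cball)
  define F where "F u = indicator (cball x e) u * f u" for u
  have F: "integrable lborel F"
    using w[of 0] e by (auto simp: weak_dir_deriv_def locally_integrable_on_def set_integrable_def F_def[abs_def])
  have [measurable]: "F \<in> borel_measurable borel" using F by auto
  have FU: "weak_dir_deriv (ball x (3 * r)) v F (\<lambda>_. 0)" for v
    by (rule weak_dir_deriv_restrict[OF w]) (use e r3 in \<open>auto simp: F_def\<close>)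
  have in3: "u + v \<in> ball x (3 * r)" if "u \<in> ball x r" "v \<in> ball 0 (2 * r)" for u v
  proof -
    have "dist x (u + v) \<le> dist x u + dist u (u + v)" by (rule dist_triangle)
    with that show ?thesis by (simp add: dist_norm)
  qed
  have tr: "AE u in lborel. u \<in> ball x r \<longrightarrow> v \<in> ball 0 (2 * r) \<longrightarrow> F (u + v) = F u" for v
  proof (cases "v \<in> ball 0 (2 * r)")
    case True
    have "AE u in lborel. u \<in> ball x r \<longrightarrow> F (u + v) - F u = (LINT s|lborel. indicator {0..1::real} s * 0)"
    proof (rule weak_dir_deriv_translation[OF FU[of v] F, of "ball x r"])
      fix u and s :: real assume u: "u \<in> ball x r" and s: "s \<in> {0..1}"
      have "norm (s *\<^sub>R v) \<le> norm v" using s by (simp add: mult_left_le_one_le)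
      with True have "s *\<^sub>R v \<in> ball 0 (2 * r)" by simp
      with u show "u + s *\<^sub>R v \<in> ball x (3 * r)" by (rule in3)
    qed auto
    then show ?thesis by eventually_elim auto
  qed simp
  have "AE v in lborel. AE u in lborel. u \<in> ball x r \<longrightarrow> v \<in> ball 0 (2 * r) \<longrightarrow> F (u + v) = F u"
    by (intro AE_I2 tr)
  then have "AE u in lborel. AE v in lborel. u \<in> ball x r \<longrightarrow> v \<in> ball 0 (2 * r) \<longrightarrow> F (u + v) = F u"
  proof (rule lborel_pair.AE_commute[THEN iffD1, rotated])
    have [measurable]: "ball x r \<in> sets borel" "ball (0::'e) (2 * r) \<in> sets borel" by simp_all
    show "{p \<in> space (lborel \<Otimes>\<^sub>M lborel). snd p \<in> ball x r \<longrightarrow> fst p \<in> ball 0 (2 * r) \<longrightarrow> F (snd p + fst p) = F (snd p)}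
        \<in> sets (lborel \<Otimes>\<^sub>M lborel)"
      by measurable
  qed
  then have "AE u in lborel. u \<in> ball x r \<longrightarrow> (AE v in lborel. v \<in> ball 0 (2 * r) \<longrightarrow> F (u + v) = F u)"
    by eventually_elim auto
  from AE_ball_imp_ex[OF r this] obtain u0 where
    u0: "u0 \<in> ball x r" "AE v in lborel. v \<in> ball 0 (2 * r) \<longrightarrow> F (u0 + v) = F u0" by blast
  from AE_lborel_translate[OF u0(2), of "- u0"]
  have "AE u in lborel. u \<in> ball x r \<longrightarrow> f u = F u0"
  proof eventually_elim
    case (elim u)
    show ?case
    proof
      assume u: "u \<in> ball x r"
      have "dist u0 u \<le> dist u0 x + dist x u" by (rule dist_triangle)
      with u u0(1) have "u - u0 \<in> ball 0 (2 * r)" by (simp add: dist_norm norm_minus_commute)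
      with elim have "F u = F u0" by simp
      moreover have "u \<in> cball x e"
        using u r by (auto simp: r_def)
      ultimately show "f u = F u0" by (simp add: F_def)
    qed
  qed
  moreover have "ball x r \<subseteq> S" using e r3 r by (auto simp: r_def)
  ultimately show ?thesis using r by blast
qed

section \<open>Charts and metrics\<close>

text \<open>Only these properties of a Riemannian atlas enter the local theory of weak gradients. They
  are stated separately because they also hold for the product manifold.\<close>

locale riemannian_charts =
  fixes M :: "('i, 'm::topological_space, 'e::euclidean_space) riem"
  assumes open_img: "i \<in> chart_ix M \<Longrightarrow> open (chart_img M i)"
    and metric_bilin: "i \<in> chart_ix M \<Longrightarrow> u \<in> chart_img M i \<Longrightarrow> bilinear (metric M i (chart_inv M i u))"
    and metric_posdef: "i \<in> chart_ix M \<Longrightarrow> u \<in> chart_img M i \<Longrightarrow> v \<noteq> 0 \<Longrightarrow>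
      metric M i (chart_inv M i u) v v > 0"
    and metric_cont: "i \<in> chart_ix M \<Longrightarrow>
      continuous_on (chart_img M i) (\<lambda>u. metric M i (chart_inv M i u) v w)"

lemma bilinear_sum_Basis:
  fixes B :: "'e::euclidean_space \<Rightarrow> 'e \<Rightarrow> real"
  assumes "bilinear B"
  shows "B v w = (\<Sum>a\<in>Basis. \<Sum>b\<in>Basis. (v \<bullet> a) * (w \<bullet> b) * B a b)"
proof -
  have "B v w = B (\<Sum>a\<in>Basis. (v \<bullet> a) *\<^sub>R a) (\<Sum>b\<in>Basis. (w \<bullet> b) *\<^sub>R b)"
    by (simp add: euclidean_representation)
  also have "\<dots> = (\<Sum>(a, b)\<in>Basis \<times> Basis. B ((v \<bullet> a) *\<^sub>R a) ((w \<bullet> b) *\<^sub>R b))"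
    by (rule bilinear_sum[OF assms]) 
  also have "\<dots> = (\<Sum>a\<in>Basis. \<Sum>b\<in>Basis. B ((v \<bullet> a) *\<^sub>R a) ((w \<bullet> b) *\<^sub>R b))"
    by (rule sum.cartesian_product[symmetric])
  finally show ?thesis
    by (simp add: bilinear_lmul[OF assms] bilinear_rmul[OF assms] mult_ac)
qed

lemma locally_integrable_mult_test_function:
  assumes g: "locally_integrable_on g S" and \<psi>: "\<psi> \<in> test_functions S"
  shows "integrable lborel (\<lambda>u. g u * \<psi> u)"
    and "integrable lborel (\<lambda>u. g u * frechet_derivative \<psi> (at u) w)"
proof -
  obtain C where C: "C > 0" "\<And>u. \<bar>\<psi> u\<bar> \<le> C" using test_function_bounded[OF \<psi>] by metis
  obtain C' where C': "C' > 0" "\<And>u. \<bar>frechet_derivative \<psi> (at u) w\<bar> \<le> C'" using test_function_deriv_bounded[OF \<psi>] by metis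
  obtain K where K: "compact K" "K \<subseteq> S" "\<And>u. u \<notin> K \<Longrightarrow> \<psi> u = 0"
    "\<And>u w. u \<notin> K \<Longrightarrow> frechet_derivative \<psi> (at u) w = 0" using test_function_support[OF \<psi>] by metis
  note [measurable] = borel_measurable_test_function[OF \<psi>] borel_measurable_test_function_deriv[OF \<psi>]
  have int: "integrable lborel (\<lambda>u. indicator K u *\<^sub>R g u)"
    using g K by (simp add: locally_integrable_on_def set_integrable_def)
  have "integrable lborel (\<lambda>u. (indicator K u *\<^sub>R g u) * \<psi> u)"
    by (rule integrable_mult_bounded[OF int _ C(2)]) simp
  also have "(\<lambda>u. (indicator K u *\<^sub>R g u) * \<psi> u) = (\<lambda>u. g u * \<psi> u)"
    using K(3) by (auto simp: indicator_def fun_eq_iff)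
  finally show "integrable lborel (\<lambda>u. g u * \<psi> u)" .
  have "integrable lborel (\<lambda>u. (indicator K u *\<^sub>R g u) * frechet_derivative \<psi> (at u) w)"
    by (rule integrable_mult_bounded[OF int _ C'(2)]) simp
  also have "(\<lambda>u. (indicator K u *\<^sub>R g u) * frechet_derivative \<psi> (at u) w) = (\<lambda>u. g u * frechet_derivative \<psi> (at u) w)"
    using K(4) by (auto simp: indicator_def fun_eq_iff)
  finally show "integrable lborel (\<lambda>u. g u * frechet_derivative \<psi> (at u) w)" .
qed

lemma locally_integrable_imp_measurable:
  fixes f :: "'e::euclidean_space \<Rightarrow> 'b::{banach, second_countable_topology}"
  assumes "open S" "locally_integrable_on f S"
  shows "f \<in> borel_measurable (restrict_space borel S)"
proof -
  obtain C where C: "\<And>n::nat. compact (C n)" "\<And>n. C n \<subseteq> S" "\<Union> (range C) = S"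
    using open_Union_compact_subsets[OF assms(1)] by metis
  show ?thesis
  proof (rule measurable_piecewise_restrict[where C="range C"])
    show "space (restrict_space borel S) \<subseteq> \<Union> (range C)" using C by (simp add: space_restrict_space)
    fix \<Omega> assume "\<Omega> \<in> range C"
    then have \<Omega>: "compact \<Omega>" "\<Omega> \<subseteq> S" using C by auto
    then have [measurable]: "\<Omega> \<in> sets borel" by (simp add: compact_imp_closed)
    show "\<Omega> \<inter> space (restrict_space borel S) \<in> sets (restrict_space borel S)"
      using \<Omega> by (auto simp: space_restrict_space sets_restrict_space)
    have "set_integrable lborel \<Omega> f" using assms \<Omega> by (auto simp: locally_integrable_on_def)
    then have "(\<lambda>x. indicator \<Omega> x *\<^sub>R f x) \<in> borel_measurable borel"
      by (auto simp: set_integrable_def)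
    then have "f \<in> borel_measurable (restrict_space borel \<Omega>)"
      by (subst borel_measurable_restrict_space_iff) auto
    moreover have "restrict_space (restrict_space borel S) \<Omega> = restrict_space borel \<Omega>"
      using \<Omega> assms(1) by (simp add: restrict_restrict_space Int_absorb1)
    ultimately show "f \<in> borel_measurable (restrict_space (restrict_space borel S) \<Omega>)" by simp
  qed simp
qed

lemma borel_measurable_indicator_compact:
  fixes f :: "'e::euclidean_space \<Rightarrow> 'b::{banach, second_countable_topology}"
  assumes "open S" "compact K" "K \<subseteq> S" "f \<in> borel_measurable (restrict_space borel S)"
  shows "(\<lambda>u. indicator K u *\<^sub>R f u) \<in> borel_measurable lborel"
proof -
  have "f \<in> borel_measurable (restrict_space (restrict_space borel S) K)"
    by (rule measurable_restrict_space1[OF assms(4)])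
  then have "f \<in> borel_measurable (restrict_space borel K)"
    using assms by (simp add: restrict_restrict_space Int_absorb1 compact_imp_closed)
  then show ?thesis
    using assms(2) by (subst (asm) borel_measurable_restrict_space_iff) (auto simp: compact_imp_closed)
qed

context riemannian_charts
begin

lemma metric_expand:
  assumes "i \<in> chart_ix M" "u \<in> chart_img M i"
  shows "metric M i (chart_inv M i u) v w =
    (\<Sum>a\<in>Basis. \<Sum>b\<in>Basis. (v \<bullet> a) * (w \<bullet> b) * metric M i (chart_inv M i u) a b)"
  by (rule bilinear_sum_Basis[OF metric_bilin[OF assms]])

lemma metric_nonneg:
  assumes "i \<in> chart_ix M" "u \<in> chart_img M i"
  shows "metric M i (chart_inv M i u) v v \<ge> 0"
  using metric_posdef[OF assms, of v] bilinear_lzero[OF metric_bilin[OF assms], of 0]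
  by (cases "v = 0") auto

lemma metric_cont_compose:
  assumes i: "i \<in> chart_ix M"
    and f: "continuous_on T f" "f ` T \<subseteq> chart_img M i" and v: "continuous_on T v" and w: "continuous_on T w"
  shows "continuous_on T (\<lambda>x. metric M i (chart_inv M i (f x)) (v x) (w x))"
proof -
  have "continuous_on T (\<lambda>x. \<Sum>a\<in>Basis. \<Sum>b\<in>Basis. (v x \<bullet> a) * (w x \<bullet> b) * metric M i (chart_inv M i (f x)) a b)"
    by (intro continuous_intros v w continuous_on_compose2[OF metric_cont[OF i] f(1,2)])
  then show ?thesis
    by (rule continuous_on_eq) (use f(2) in \<open>auto simp: metric_expand[OF i, symmetric]\<close>)
qed

lemma metric_bound:
  assumes i: "i \<in> chart_ix M" and K: "compact K" "K \<subseteq> chart_img M i"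
  obtains C where "C > 0" "\<And>u v w. u \<in> K \<Longrightarrow> \<bar>metric M i (chart_inv M i u) v w\<bar> \<le> C * norm v * norm w"
proof -
  have "bounded ((\<lambda>u. metric M i (chart_inv M i u) a b) ` K)" for a b
    using K metric_cont[OF i] by (intro compact_imp_bounded compact_continuous_image) (auto intro: continuous_on_subset)
  then have "\<exists>c. \<forall>u\<in>K. \<bar>metric M i (chart_inv M i u) a b\<bar> \<le> c" for a b
    unfolding bounded_iff by auto
  then obtain c where c: "\<And>a b u. u \<in> K \<Longrightarrow> \<bar>metric M i (chart_inv M i u) a b\<bar> \<le> c a b" by metis
  define C where "C = (\<Sum>a\<in>Basis. \<Sum>b\<in>Basis. \<bar>c a b\<bar>)"
  have C0: "C \<ge> 0" unfolding C_def by (intro sum_nonneg) auto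
  have "\<bar>metric M i (chart_inv M i u) v w\<bar> \<le> (C + 1) * norm v * norm w" if u: "u \<in> K" for u v w
  proof -
    have "\<bar>metric M i (chart_inv M i u) v w\<bar> \<le> (\<Sum>a\<in>Basis. \<Sum>b\<in>Basis. \<bar>(v \<bullet> a) * (w \<bullet> b) * metric M i (chart_inv M i u) a b\<bar>)"
      using u K by (subst metric_expand[OF i]) (auto intro!: order_trans[OF sum_abs] sum_mono)
    also have "\<dots> \<le> (\<Sum>a\<in>Basis. \<Sum>b\<in>Basis. norm v * norm w * \<bar>c a b\<bar>)"
      unfolding abs_mult
      by (intro sum_mono mult_mono Basis_le_norm order_trans[OF c[OF u]]) auto
    also have "\<dots> = C * norm v * norm w"
      by (simp add: C_def sum_distrib_left mult_ac)
    also have "\<dots> \<le> (C + 1) * norm v * norm w"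
      by (intro mult_right_mono) auto
    finally show ?thesis .
  qed
  then show ?thesis using C0 by (intro that[of "C + 1"]) auto
qed

text \<open>The metric attains a positive minimum on the compact set of pairs of a point of \<open>K\<close> and a
  Euclidean unit vector.\<close>

lemma metric_lower_bound:
  assumes i: "i \<in> chart_ix M" and K: "compact K" "K \<subseteq> chart_img M i"
  obtains c where "c > 0" "\<And>u v. u \<in> K \<Longrightarrow> c * (norm v)\<^sup>2 \<le> metric M i (chart_inv M i u) v v"
proof (cases "K = {} \<or> sphere (0::'e) 1 = {}")
  case True
  then show ?thesis
  proof
    assume "K = {}"
    then show ?thesis using that[of 1] by auto
  next
    assume "sphere (0::'e) 1 = {}"
    moreover have "sphere (0::'e) 1 \<noteq> {}" by simp
    ultimately show ?thesis by blast
  qed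
next
  case False
  let ?f = "\<lambda>x. metric M i (chart_inv M i (fst x)) (snd x) (snd x)"
  have "compact (K \<times> sphere (0::'e) 1)" using K by (intro compact_Times) auto
  moreover have "K \<times> sphere (0::'e) 1 \<noteq> {}" using False by auto
  moreover have "continuous_on (K \<times> sphere (0::'e) 1) ?f"
    using K(2) by (intro metric_cont_compose[OF i] continuous_intros) auto
  ultimately obtain x where x: "x \<in> K \<times> sphere 0 1" "\<And>y. y \<in> K \<times> sphere 0 1 \<Longrightarrow> ?f x \<le> ?f y"
    using continuous_attains_inf[of "K \<times> sphere (0::'e) 1" ?f] by blast
  have pos: "?f x > 0" using x(1) K(2) by (intro metric_posdef[OF i]) auto
  have "?f x * (norm v)\<^sup>2 \<le> metric M i (chart_inv M i u) v v" if u: "u \<in> K" for u v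
  proof (cases "v = 0")
    case True
    then show ?thesis using metric_nonneg[OF i, of u v] u K(2) by auto
  next
    case False
    let ?v = "v /\<^sub>R norm v"
    have bil: "bilinear (metric M i (chart_inv M i u))" using u K(2) by (intro metric_bilin[OF i]) auto
    have "?f x \<le> metric M i (chart_inv M i u) ?v ?v"
      using x(2)[of "(u, ?v)"] u False by auto
    also have "\<dots> = metric M i (chart_inv M i u) v v / (norm v)\<^sup>2"
      by (simp add: bilinear_lmul[OF bil] bilinear_rmul[OF bil] power2_eq_square divide_inverse mult_ac)
    finally show ?thesis using False by (simp add: pos_le_divide_eq)
  qed
  with pos show ?thesis by (rule that)
qed

lemma metric_measurable:
  assumes i: "i \<in> chart_ix M"
    and f: "f \<in> measurable N (restrict_space borel (chart_img M i))"
    and [measurable]: "X \<in> borel_measurable N" "Y \<in> borel_measurable N"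
  shows "(\<lambda>x. metric M i (chart_inv M i (f x)) (X x) (Y x)) \<in> borel_measurable N"
proof -
  have "(\<lambda>u. metric M i (chart_inv M i u) a b) \<in> borel_measurable (restrict_space borel (chart_img M i))" for a b
    by (intro borel_measurable_continuous_on_restrict metric_cont i)
  from measurable_compose[OF f this] have [measurable]:
    "(\<lambda>x. metric M i (chart_inv M i (f x)) a b) \<in> borel_measurable N" for a b .
  have "(\<lambda>x. \<Sum>a\<in>Basis. \<Sum>b\<in>Basis. (X x \<bullet> a) * (Y x \<bullet> b) * metric M i (chart_inv M i (f x)) a b) \<in> borel_measurable N"
    by measurable
  also have "?this \<longleftrightarrow> ?thesis"
  proof (rule measurable_cong)
    fix x assume "x \<in> space N"
    then have "f x \<in> chart_img M i" using measurable_space[OF f] by (simp add: space_restrict_space)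
    then show "(\<Sum>a\<in>Basis. \<Sum>b\<in>Basis. (X x \<bullet> a) * (Y x \<bullet> b) * metric M i (chart_inv M i (f x)) a b)
        = metric M i (chart_inv M i (f x)) (X x) (Y x)"
      by (rule metric_expand[OF i, symmetric])
  qed
  finally show ?thesis .
qed

lemma metric_locally_integrable:
  assumes i: "i \<in> chart_ix M" and X: "locally_integrable_on X (chart_img M i)"
  shows "locally_integrable_on (\<lambda>u. metric M i (chart_inv M i u) (X u) w) (chart_img M i)"
  unfolding locally_integrable_on_def
proof (intro allI impI)
  fix K assume K: "compact K" "K \<subseteq> chart_img M i"
  then have [measurable]: "K \<in> sets borel" by (simp add: compact_imp_closed)
  obtain C where C: "C > 0" "\<And>u v w. u \<in> K \<Longrightarrow> \<bar>metric M i (chart_inv M i u) v w\<bar> \<le> C * norm v * norm w"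
    using metric_bound[OF i K] by metis
  have "(\<lambda>u. metric M i (chart_inv M i u) (X u) w) \<in> borel_measurable (restrict_space borel (chart_img M i))"
    by (rule metric_measurable[OF i]) (use locally_integrable_imp_measurable[OF open_img[OF i] X] in auto)
  then have m: "(\<lambda>u. indicator K u *\<^sub>R metric M i (chart_inv M i u) (X u) w) \<in> borel_measurable lborel"
    by (rule borel_measurable_indicator_compact[OF open_img[OF i] K])
  have "integrable lborel (\<lambda>u. C * norm w * norm (indicator K u *\<^sub>R X u))"
    using X K by (intro integrable_mult_right integrable_norm) (auto simp: locally_integrable_on_def set_integrable_def)
  then show "set_integrable lborel K (\<lambda>u. metric M i (chart_inv M i u) (X u) w)"
    unfolding set_integrable_def
  proof (rule Bochner_Integration.integrable_bound[OF _ m])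
    show "AE u in lborel. norm (indicator K u *\<^sub>R metric M i (chart_inv M i u) (X u) w) \<le> norm (C * norm w * norm (indicator K u *\<^sub>R X u))"
    proof (rule AE_I2)
      fix u
      show "norm (indicator K u *\<^sub>R metric M i (chart_inv M i u) (X u) w) \<le> norm (C * norm w * norm (indicator K u *\<^sub>R X u))"
        using C(1) C(2)[of u "X u" w] by (simp add: indicator_def abs_mult mult_ac)
    qed
  qed
qed

lemma weak_gradient_chart:
  assumes X: "weak_gradient M f X" and i: "i \<in> chart_ix M"
  shows "weak_dir_deriv (chart_img M i) w (\<lambda>u. f (chart_inv M i u)) (\<lambda>u. metric M i (chart_inv M i u) (X i (chart_inv M i u)) w)"
  using assms metric_locally_integrable[OF i, of "\<lambda>u. X i (chart_inv M i u)" w]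
  unfolding weak_gradient_def weak_dir_deriv_def by blast

lemma weak_gradientI:
  assumes "vector_field M X"
    and "\<And>i. i \<in> chart_ix M \<Longrightarrow> locally_integrable_on (\<lambda>u. X i (chart_inv M i u)) (chart_img M i)"
    and "\<And>i w. i \<in> chart_ix M \<Longrightarrow> weak_dir_deriv (chart_img M i) w (\<lambda>u. f (chart_inv M i u)) (\<lambda>u. metric M i (chart_inv M i u) (X i (chart_inv M i u)) w)"
  shows "weak_gradient M f X"
  using assms unfolding weak_gradient_def weak_dir_deriv_def by blast

lemma metric_eq_imp_eq:
  assumes i: "i \<in> chart_ix M" and u: "u \<in> chart_img M i"
    and eq: "\<And>b. b \<in> Basis \<Longrightarrow> metric M i (chart_inv M i u) v b = metric M i (chart_inv M i u) w b"
  shows "v = w"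
proof (rule ccontr)
  assume "v \<noteq> w"
  note bil = metric_bilin[OF i u]
  have "metric M i (chart_inv M i u) (v - w) z = 0" for z
  proof -
    have lin: "linear (metric M i (chart_inv M i u) (v - w))" using bil by (simp add: bilinear_def)
    have "metric M i (chart_inv M i u) (v - w) z = (\<Sum>b\<in>Basis. (z \<bullet> b) * metric M i (chart_inv M i u) (v - w) b)"
      by (subst euclidean_representation[of z, symmetric]) (simp add: linear_sum[OF lin] linear_scale[OF lin])
    also have "\<dots> = 0" using eq by (simp add: bilinear_lsub[OF bil])
    finally show ?thesis .
  qed
  then show False using metric_posdef[OF i u, of "v - w"] \<open>v \<noteq> w\<close> by simp
qed

lemma weak_gradient_unique_chart:
  assumes X: "weak_gradient M f X" and Y: "weak_gradient M f' Y" and i: "i \<in> chart_ix M"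
    and ff': "AE u in lborel. u \<in> chart_img M i \<longrightarrow> f (chart_inv M i u) = f' (chart_inv M i u)"
  shows "AE u in lborel. u \<in> chart_img M i \<longrightarrow> X i (chart_inv M i u) = Y i (chart_inv M i u)"
proof -
  let ?S = "chart_img M i" and ?g = "\<lambda>X w u. metric M i (chart_inv M i u) (X i (chart_inv M i u)) w"
  have "AE u in lborel. u \<in> ?S \<longrightarrow> ?g X w u - ?g Y w u = 0" for w
  proof (rule fundamental_lemma[OF open_img[OF i]])
    note wX = weak_gradient_chart[OF X i, of w] and wY = weak_gradient_chart[OF Y i, of w]
    then show "locally_integrable_on (\<lambda>u. ?g X w u - ?g Y w u) ?S"
      by (simp add: weak_dir_deriv_def locally_integrable_on_def)
    fix \<psi> assume \<psi>: "\<psi> \<in> test_functions ?S"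
    have "(LINT u|lborel. f (chart_inv M i u) * frechet_derivative \<psi> (at u) w)
        = (LINT u|lborel. f' (chart_inv M i u) * frechet_derivative \<psi> (at u) w)"
    proof (rule integral_cong_AE)
      show "AE u in lborel. f (chart_inv M i u) * frechet_derivative \<psi> (at u) w = f' (chart_inv M i u) * frechet_derivative \<psi> (at u) w"
        using ff' by eventually_elim (use test_function_deriv_eq_0[OF \<psi>] in force)
    next
      have "locally_integrable_on (\<lambda>u. f (chart_inv M i u)) ?S" "locally_integrable_on (\<lambda>u. f' (chart_inv M i u)) ?S"
        using wX wY by (simp_all add: weak_dir_deriv_def)
      from this[THEN locally_integrable_mult_test_function(2)[OF _ \<psi>], THEN borel_measurable_integrable]
      show "(\<lambda>u. f (chart_inv M i u) * frechet_derivative \<psi> (at u) w) \<in> borel_measurable lborel"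
        "(\<lambda>u. f' (chart_inv M i u) * frechet_derivative \<psi> (at u) w) \<in> borel_measurable lborel" by blast+
    qed
    then have "(LINT u|lborel. ?g X w u * \<psi> u) = (LINT u|lborel. ?g Y w u * \<psi> u)"
      using weak_dir_derivD[OF wX \<psi>] weak_dir_derivD[OF wY \<psi>] by simp
    then have "(LINT u|lborel. (?g X w u - ?g Y w u) * \<psi> u) = 0"
      using wX wY locally_integrable_mult_test_function(1)[OF _ \<psi>]
      by (simp add: left_diff_distrib weak_dir_deriv_def)
    then show "(LINT u:?S|lborel. (?g X w u - ?g Y w u) * \<psi> u) = 0"
      using set_integral_test_function[OF \<psi> order_refl] by simp
  qed
  then have "AE u in lborel. \<forall>b\<in>Basis. u \<in> ?S \<longrightarrow> ?g X b u - ?g Y b u = 0"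
    by (intro AE_finite_allI) auto
  then show ?thesis
  proof eventually_elim
    case (elim u)
    then show ?case by (auto intro: metric_eq_imp_eq[OF i])
  qed
qed

end

section \<open>The first variation of the free energy\<close>

lemma abs_x_ln_x_le: "0 \<le> t \<Longrightarrow> \<bar>t * ln t\<bar> \<le> 1 + t\<^sup>2" for t :: real
proof (cases "t = 0")
  case False
  assume "0 \<le> t"
  with False have t: "t > 0" by simp
  have "t * ln t \<le> t * t" using t ln_le_minus_one[OF t] by (intro mult_left_mono) auto
  moreover have "- (t * ln t) \<le> 1"
  proof -
    have "ln (1 / t) \<le> 1 / t - 1" using t by (intro ln_le_minus_one) simp
    then have "t * ln (1 / t) \<le> t * (1 / t - 1)" using t by (intro mult_left_mono) auto
    then show ?thesis using t by (simp add: ln_div algebra_simps)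
  qed
  moreover have "0 \<le> t\<^sup>2" by simp
  ultimately show ?thesis unfolding abs_le_iff power2_eq_square by linarith
qed simp

text \<open>The tangent to \<open>t ln t\<close> at \<open>r\<close> lies below the graph; this is \<open>ln z \<le> z - 1\<close> for \<open>z = r / t\<close>.\<close>

lemma x_ln_x_tangent:
  fixes t r :: real
  assumes t: "t \<ge> 0" and r: "r > 0"
  shows "r * ln r + (ln r + 1) * (t - r) \<le> t * ln t"
proof (cases "t = 0")
  case True
  then show ?thesis using r by (simp add: algebra_simps)
next
  case False
  with t have t: "t > 0" by simp
  have "ln (r / t) \<le> r / t - 1" using r t by (intro ln_le_minus_one) simp
  then have "t * ln (r / t) \<le> t * (r / t - 1)" using t by (intro mult_left_mono) auto
  then show ?thesis using t r by (simp add: ln_div algebra_simps)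
qed

lemma x_ln_x_convex:
  fixes a b s :: real
  assumes a: "a > 0" and b: "b \<ge> 0" and s: "0 < s" "s < 1"
  shows "(s * b + (1 - s) * a) * ln (s * b + (1 - s) * a) \<le> s * (b * ln b) + (1 - s) * (a * ln a)"
proof -
  define t where "t = s * b + (1 - s) * a"
  have t: "t > 0" unfolding t_def using a b s by (intro add_nonneg_pos mult_pos_pos mult_nonneg_nonneg) auto
  have "s * (t * ln t + (ln t + 1) * (b - t)) \<le> s * (b * ln b)"
    using x_ln_x_tangent[OF b t] s by (intro mult_left_mono) auto
  moreover have "(1 - s) * (t * ln t + (ln t + 1) * (a - t)) \<le> (1 - s) * (a * ln a)"
    using x_ln_x_tangent[of a t] a t s by (intro mult_left_mono) auto
  moreover have "s * (t * ln t + (ln t + 1) * (b - t)) + (1 - s) * (t * ln t + (ln t + 1) * (a - t)) = t * ln t"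
  proof -
    have "s * (b - t) + (1 - s) * (a - t) = 0" by (simp add: t_def algebra_simps)
    then have "(ln t + 1) * (s * (b - t) + (1 - s) * (a - t)) = 0" by simp
    then show ?thesis by (simp add: algebra_simps)
  qed
  ultimately show ?thesis unfolding t_def[symmetric] by linarith
qed

text \<open>By convexity the difference quotients lie between the derivative at \<open>\<rho>\<close> and the increment
  up to \<open>\<rho>'\<close>, which gives an integrable majorant.\<close>

lemma entropy_derivative:
  fixes \<rho> \<rho>' :: "'a \<Rightarrow> real"
  assumes [measurable]: "\<rho> \<in> borel_measurable M" "\<rho>' \<in> borel_measurable M"
    and pos: "AE x in M. \<rho> x > 0" and nonneg: "AE x in M. \<rho>' x \<ge> 0"
    and i0: "integrable M (\<lambda>x. \<rho> x * ln (\<rho> x))" and i1: "integrable M (\<lambda>x. \<rho>' x * ln (\<rho>' x))"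
    and id: "integrable M (\<lambda>x. (ln (\<rho> x) + 1) * (\<rho>' x - \<rho> x))"
  shows "((\<lambda>s. \<integral>x. (s * \<rho>' x + (1 - s) * \<rho> x) * ln (s * \<rho>' x + (1 - s) * \<rho> x) \<partial>M)
    has_real_derivative (\<integral>x. (ln (\<rho> x) + 1) * (\<rho>' x - \<rho> x) \<partial>M)) (at_right 0)"
proof -
  let ?r = "\<lambda>s x. s * \<rho>' x + (1 - s) * \<rho> x"
  define q where "q s x = (?r s x * ln (?r s x) - \<rho> x * ln (\<rho> x)) / s" for s x
  define w where "w x = \<bar>\<rho>' x * ln (\<rho>' x)\<bar> + \<bar>\<rho> x * ln (\<rho> x)\<bar> + \<bar>(ln (\<rho> x) + 1) * (\<rho>' x - \<rho> x)\<bar>" for x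
  have w: "integrable M w" unfolding w_def using i0 i1 id by simp
  have [measurable]: "q s \<in> borel_measurable M" for s unfolding q_def by measurable
  have bound: "AE x in M. norm (q s x) \<le> w x" if s: "0 < s" "s < 1" for s
    using pos nonneg
  proof eventually_elim
    case (elim x)
    have r: "?r s x \<ge> 0" using elim s by simp
    have eq: "?r s x - \<rho> x = s * (\<rho>' x - \<rho> x)" by (simp add: algebra_simps)
    have "\<rho> x * ln (\<rho> x) + (ln (\<rho> x) + 1) * (s * (\<rho>' x - \<rho> x)) \<le> ?r s x * ln (?r s x)"
      using x_ln_x_tangent[OF r elim(1)] unfolding eq .
    then have "(ln (\<rho> x) + 1) * (\<rho>' x - \<rho> x) * s \<le> ?r s x * ln (?r s x) - \<rho> x * ln (\<rho> x)"
      by (simp add: mult_ac)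
    then have lo: "(ln (\<rho> x) + 1) * (\<rho>' x - \<rho> x) \<le> q s x"
      unfolding q_def using s by (simp add: pos_le_divide_eq)
    have "?r s x * ln (?r s x) \<le> s * (\<rho>' x * ln (\<rho>' x)) + (1 - s) * (\<rho> x * ln (\<rho> x))"
      by (rule x_ln_x_convex[OF elim s])
    then have "?r s x * ln (?r s x) - \<rho> x * ln (\<rho> x) \<le> (\<rho>' x * ln (\<rho>' x) - \<rho> x * ln (\<rho> x)) * s"
      by (simp add: algebra_simps)
    then have up: "q s x \<le> \<rho>' x * ln (\<rho>' x) - \<rho> x * ln (\<rho> x)"
      unfolding q_def using s by (simp add: pos_divide_le_eq)
    show ?case unfolding w_def real_norm_def using lo up by linarith
  qed
  have lim: "AE x in M. (\<lambda>n. q (S n) x) \<longlonglongrightarrow> (ln (\<rho> x) + 1) * (\<rho>' x - \<rho> x)"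
    if S: "\<And>n. 0 < S n" "S \<longlonglongrightarrow> 0" for S
    using pos
  proof eventually_elim
    case (elim x)
    have "((\<lambda>s. ?r s x * ln (?r s x)) has_real_derivative (ln (\<rho> x) + 1) * (\<rho>' x - \<rho> x)) (at 0)"
      using elim by (auto intro!: derivative_eq_intros simp: algebra_simps)
    then have "((\<lambda>s. q s x) \<longlongrightarrow> (ln (\<rho> x) + 1) * (\<rho>' x - \<rho> x)) (at 0)"
      by (simp add: DERIV_def q_def)
    moreover have "filterlim S (at 0) sequentially"
      using S by (simp add: filterlim_at less_imp_neq[symmetric])
    ultimately show ?case by (rule filterlim_compose)
  qed
  have qi: "integrable M (q s)" if "0 < s" "s < 1" for s
    by (rule Bochner_Integration.integrable_bound[OF w]) (use bound[OF that] in \<open>auto elim: eventually_mono\<close>)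
  have eqH: "((\<integral>x. ?r s x * ln (?r s x) \<partial>M) - (\<integral>x. \<rho> x * ln (\<rho> x) \<partial>M)) / s = (\<integral>x. q s x \<partial>M)"
    if s: "0 < s" "s < 1" for s
  proof -
    have "integrable M (\<lambda>x. s * q s x + \<rho> x * ln (\<rho> x))" using qi[OF s] i0 by simp
    also have "(\<lambda>x. s * q s x + \<rho> x * ln (\<rho> x)) = (\<lambda>x. ?r s x * ln (?r s x))"
      using s by (simp add: q_def)
    finally show ?thesis using i0 by (simp add: q_def)
  qed
  have "((\<lambda>s. ((\<integral>x. ?r s x * ln (?r s x) \<partial>M) - (\<integral>x. \<rho> x * ln (\<rho> x) \<partial>M)) / s)
      \<longlongrightarrow> (\<integral>x. (ln (\<rho> x) + 1) * (\<rho>' x - \<rho> x) \<partial>M)) (at_right 0)"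
  proof (rule tendsto_at_right_sequentially[of 0 1])
    fix S :: "nat \<Rightarrow> real" assume S: "\<And>n. 0 < S n" "\<And>n. S n < 1" "decseq S" "S \<longlonglongrightarrow> 0"
    have "(\<lambda>n. \<integral>x. q (S n) x \<partial>M) \<longlonglongrightarrow> (\<integral>x. (ln (\<rho> x) + 1) * (\<rho>' x - \<rho> x) \<partial>M)"
      by (rule integral_dominated_convergence[OF _ _ w lim[OF S(1,4)] bound[OF S(1,2)]]) measurable
    then show "(\<lambda>n. ((\<integral>x. ?r (S n) x * ln (?r (S n) x) \<partial>M) - (\<integral>x. \<rho> x * ln (\<rho> x) \<partial>M)) / S n)
      \<longlonglongrightarrow> (\<integral>x. (ln (\<rho> x) + 1) * (\<rho>' x - \<rho> x) \<partial>M)"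
      by (simp only: eqH[OF S(1,2)])
  qed simp
  then show ?thesis by (simp add: has_field_derivative_iff)
qed

locale bounded_interaction = finite_measure m for m :: "'m measure" +
  fixes W :: "'m \<Rightarrow> 'm \<Rightarrow> real" and B :: real
  assumes W_meas: "(\<lambda>(x, y). W x y) \<in> borel_measurable (m \<Otimes>\<^sub>M m)"
    and W_bounded: "\<And>x y. \<bar>W x y\<bar> \<le> B"

sublocale bounded_interaction \<subseteq> pair: pair_sigma_finite m m ..

context bounded_interaction
begin

lemma W_section_measurable: "x \<in> space m \<Longrightarrow> (\<lambda>y. W x y) \<in> borel_measurable m"
  using measurable_Pair2[OF W_meas, of x] by simp

lemma integrable_W_mult:
  assumes "integrable m f" "x \<in> space m"
  shows "integrable m (\<lambda>y. W x y * f y)"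
  by (rule integrable_mult_bounded(2)[OF assms(1) W_section_measurable[OF assms(2)] W_bounded])

lemma integral_abs_W_mult_le:
  assumes f: "integrable m f" and x: "x \<in> space m"
  shows "(\<integral>y. \<bar>W x y * f y\<bar> \<partial>m) \<le> B * (\<integral>y. \<bar>f y\<bar> \<partial>m)"
proof -
  have "(\<integral>y. \<bar>W x y * f y\<bar> \<partial>m) \<le> (\<integral>y. B * \<bar>f y\<bar> \<partial>m)"
  proof (rule integral_mono)
    show "integrable m (\<lambda>y. \<bar>W x y * f y\<bar>)" by (rule integrable_abs[OF integrable_W_mult[OF f x]])
    show "integrable m (\<lambda>y. B * \<bar>f y\<bar>)" using f by simp
    show "\<bar>W x y * f y\<bar> \<le> B * \<bar>f y\<bar>" for y
      unfolding abs_mult using W_bounded by (intro mult_right_mono) auto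
  qed
  then show ?thesis by simp
qed

lemma conv_bound:
  assumes f: "integrable m f" and x: "x \<in> space m"
  shows "\<bar>conv m W f x\<bar> \<le> B * (\<integral>y. \<bar>f y\<bar> \<partial>m)"
  unfolding conv_def by (rule order_trans[OF integral_abs_bound integral_abs_W_mult_le[OF assms]])

lemma conv_measurable:
  assumes [measurable]: "f \<in> borel_measurable m"
  shows "conv m W f \<in> borel_measurable m"
proof -
  have "(\<lambda>(x, y). W x y * f y) \<in> borel_measurable (m \<Otimes>\<^sub>M m)"
    using W_meas by measurable
  from borel_measurable_lebesgue_integral[OF this] show ?thesis by (simp add: conv_def[abs_def])
qed

lemma integrable_mult_conv:
  assumes h: "integrable m h" and f: "integrable m f"
  shows "integrable m (\<lambda>x. h x * conv m W f x)"
proof (rule Bochner_Integration.integrable_bound)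
  show "integrable m (\<lambda>x. (B * (\<integral>y. \<bar>f y\<bar> \<partial>m)) * \<bar>h x\<bar>)" using h by simp
  show "(\<lambda>x. h x * conv m W f x) \<in> borel_measurable m"
    using h conv_measurable[of f] f by measurable
  show "AE x in m. norm (h x * conv m W f x) \<le> norm ((B * (\<integral>y. \<bar>f y\<bar> \<partial>m)) * \<bar>h x\<bar>)"
  proof (rule AE_I2)
    fix x assume "x \<in> space m"
    then have "\<bar>conv m W f x\<bar> * \<bar>h x\<bar> \<le> (B * (\<integral>y. \<bar>f y\<bar> \<partial>m)) * \<bar>h x\<bar>"
      using conv_bound[OF f] by (intro mult_right_mono) auto
    also have "\<dots> \<le> \<bar>(B * (\<integral>y. \<bar>f y\<bar> \<partial>m)) * \<bar>h x\<bar>\<bar>" by (rule abs_ge_self)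
    finally show "norm (h x * conv m W f x) \<le> norm ((B * (\<integral>y. \<bar>f y\<bar> \<partial>m)) * \<bar>h x\<bar>)"
      by (simp add: abs_mult mult_ac)
  qed
qed

lemma conv_lincomb:
  assumes f: "integrable m f" and h: "integrable m h" and x: "x \<in> space m"
  shows "conv m W (\<lambda>y. f y + s * h y) x = conv m W f x + s * conv m W h x"
proof -
  have "W x y * (f y + s * h y) = W x y * f y + s * (W x y * h y)" for y by (simp add: algebra_simps)
  then show ?thesis
    using integrable_W_mult[OF f x] integrable_W_mult[OF h x] by (simp add: conv_def)
qed

lemma conv_symmetric:
  assumes sym: "\<And>x y. W x y = W y x" and f: "integrable m f" and h: "integrable m h"
  shows "(\<integral>x. h x * conv m W f x \<partial>m) = (\<integral>x. f x * conv m W h x \<partial>m)"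
proof -
  have [measurable]: "f \<in> borel_measurable m" "h \<in> borel_measurable m" using f h by auto
  have meas: "(\<lambda>(x, y). h x * (W x y * f y)) \<in> borel_measurable (m \<Otimes>\<^sub>M m)"
    using W_meas by measurable
  have "integrable (m \<Otimes>\<^sub>M m) (\<lambda>(x, y). h x * (W x y * f y))"
  proof (rule pair.Fubini_integrable[OF meas])
    show "AE x in m. integrable m (\<lambda>y. case (x, y) of (x, y) \<Rightarrow> h x * (W x y * f y))"
      using integrable_W_mult[OF f] by (intro AE_I2) simp
    show "integrable m (\<lambda>x. \<integral>y. norm (case (x, y) of (x, y) \<Rightarrow> h x * (W x y * f y)) \<partial>m)"
    proof (rule Bochner_Integration.integrable_bound)
      show "integrable m (\<lambda>x. \<bar>h x\<bar> * (B * (\<integral>y. \<bar>f y\<bar> \<partial>m)))" using h by simp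
      show "(\<lambda>x. \<integral>y. norm (case (x, y) of (x, y) \<Rightarrow> h x * (W x y * f y)) \<partial>m) \<in> borel_measurable m"
      proof -
        have "(\<lambda>p. norm (case p of (x, y) \<Rightarrow> h x * (W x y * f y))) \<in> borel_measurable (m \<Otimes>\<^sub>M m)"
          using meas by measurable
        then have "(\<lambda>(x, y). norm (h x * (W x y * f y))) \<in> borel_measurable (m \<Otimes>\<^sub>M m)"
          by (simp only: case_prod_beta')
        from borel_measurable_lebesgue_integral[OF this] show ?thesis by simp
      qed
      show "AE x in m. norm (\<integral>y. norm (case (x, y) of (x, y) \<Rightarrow> h x * (W x y * f y)) \<partial>m) \<le> norm (\<bar>h x\<bar> * (B * (\<integral>y. \<bar>f y\<bar> \<partial>m)))"
      proof (rule AE_I2)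
        fix x assume x: "x \<in> space m"
        note integral_abs_W_mult_le[OF f x]
        then have "\<bar>h x\<bar> * (\<integral>y. \<bar>W x y * f y\<bar> \<partial>m) \<le> \<bar>h x\<bar> * (B * (\<integral>y. \<bar>f y\<bar> \<partial>m))"
          by (intro mult_left_mono) auto
        also have "\<dots> \<le> \<bar>\<bar>h x\<bar> * (B * (\<integral>y. \<bar>f y\<bar> \<partial>m))\<bar>" by (rule abs_ge_self)
        finally show "norm (\<integral>y. norm (case (x, y) of (x, y) \<Rightarrow> h x * (W x y * f y)) \<partial>m) \<le> norm (\<bar>h x\<bar> * (B * (\<integral>y. \<bar>f y\<bar> \<partial>m)))"
          by (simp add: abs_mult[of "h x"])
      qed
    qed
  qed
  from pair.Fubini_integral[OF this]
  have "(\<integral>x. h x * conv m W f x \<partial>m) = (\<integral>y. \<integral>x. h x * (W x y * f y) \<partial>m \<partial>m)"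
    by (simp add: conv_def)
  also have "\<dots> = (\<integral>y. f y * conv m W h y \<partial>m)"
    by (simp add: conv_def sym[of _ "_ :: 'm"] mult_ac flip: integral_mult_right_zero)
  finally show ?thesis .
qed

lemma interaction_energy_eq: "(\<integral>x. (\<integral>y. W x y * f x * f y \<partial>m) \<partial>m) = (\<integral>x. f x * conv m W f x \<partial>m)"
proof -
  have "(\<integral>y. W x y * f x * f y \<partial>m) = f x * conv m W f x" for x
  proof -
    have "(\<integral>y. W x y * f x * f y \<partial>m) = (\<integral>y. f x * (W x y * f y) \<partial>m)"
      by (rule Bochner_Integration.integral_cong) auto
    then show ?thesis by (simp add: conv_def)
  qed
  then show ?thesis by simp
qed

lemma interaction_derivative:
  assumes sym: "\<And>x y. W x y = W y x" and \<rho>: "integrable m \<rho>" and \<rho>': "integrable m \<rho>'"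
  shows "((\<lambda>s. 1 / 2 * (\<integral>x. (\<integral>y. W x y * (s * \<rho>' x + (1 - s) * \<rho> x) * (s * \<rho>' y + (1 - s) * \<rho> y) \<partial>m) \<partial>m))
    has_real_derivative (\<integral>x. (\<rho>' x - \<rho> x) * conv m W \<rho> x \<partial>m)) (at_right 0)"
proof -
  define d where "d x = \<rho>' x - \<rho> x" for x
  have d: "integrable m d" unfolding d_def using \<rho> \<rho>' by simp
  have eq: "s * \<rho>' x + (1 - s) * \<rho> x = \<rho> x + s * d x" for s x by (simp add: d_def algebra_simps)
  note I = integrable_mult_conv
  have "(\<integral>x. (\<rho> x + s * d x) * conv m W (\<lambda>x. \<rho> x + s * d x) x \<partial>m)
      = (\<integral>x. \<rho> x * conv m W \<rho> x \<partial>m) + 2 * s * (\<integral>x. d x * conv m W \<rho> x \<partial>m) + s * s * (\<integral>x. d x * conv m W d x \<partial>m)" for s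
  proof -
    have "(\<integral>x. (\<rho> x + s * d x) * conv m W (\<lambda>x. \<rho> x + s * d x) x \<partial>m)
        = (\<integral>x. \<rho> x * conv m W \<rho> x + s * (\<rho> x * conv m W d x) + s * (d x * conv m W \<rho> x) + s * s * (d x * conv m W d x) \<partial>m)"
      by (rule Bochner_Integration.integral_cong) (simp_all add: conv_lincomb[OF \<rho> d] algebra_simps)
    also have "\<dots> = (\<integral>x. \<rho> x * conv m W \<rho> x \<partial>m) + s * (\<integral>x. \<rho> x * conv m W d x \<partial>m)
        + s * (\<integral>x. d x * conv m W \<rho> x \<partial>m) + s * s * (\<integral>x. d x * conv m W d x \<partial>m)"
      using I[OF \<rho> \<rho>] I[OF \<rho> d] I[OF d \<rho>] I[OF d d] by simp
    also have "(\<integral>x. \<rho> x * conv m W d x \<partial>m) = (\<integral>x. d x * conv m W \<rho> x \<partial>m)"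
      by (rule conv_symmetric[OF sym d \<rho>])
    finally show ?thesis by simp
  qed
  then have "(\<lambda>s. 1 / 2 * (\<integral>x. (\<integral>y. W x y * (s * \<rho>' x + (1 - s) * \<rho> x) * (s * \<rho>' y + (1 - s) * \<rho> y) \<partial>m) \<partial>m))
     = (\<lambda>s. 1 / 2 * ((\<integral>x. \<rho> x * conv m W \<rho> x \<partial>m) + 2 * s * (\<integral>x. d x * conv m W \<rho> x \<partial>m) + s * s * (\<integral>x. d x * conv m W d x \<partial>m)))"
    unfolding eq interaction_energy_eq by simp
  moreover have "((\<lambda>s. 1 / 2 * ((\<integral>x. \<rho> x * conv m W \<rho> x \<partial>m) + 2 * s * (\<integral>x. d x * conv m W \<rho> x \<partial>m) + s * s * (\<integral>x. d x * conv m W d x \<partial>m)))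
      has_real_derivative (\<integral>x. d x * conv m W \<rho> x \<partial>m)) (at_right 0)"
    by (auto intro!: derivative_eq_intros)
  ultimately show ?thesis by (simp add: d_def)
qed

text \<open>The first variation of the free energy is the integral of the increment against
  the chemical potential \<open>\<gamma>\<^sup>-\<^sup>1 ln \<rho> + W * \<rho>\<close>, up to a constant that mass conservation removes.\<close>

lemma free_energy_derivative:
  assumes sym: "\<And>x y. W x y = W y x"
    and \<rho>: "\<rho> \<in> P_ac_pos m" and \<rho>': "\<rho>' \<in> P_ac m"
    and i0: "integrable m (\<lambda>x. \<rho> x * ln (\<rho> x))" and i1: "integrable m (\<lambda>x. \<rho>' x * ln (\<rho>' x))"
    and id: "integrable m (\<lambda>x. (\<rho>' x - \<rho> x) * ln (\<rho> x))"
  shows "((\<lambda>s. free_energy m W \<gamma> (\<lambda>x. s * \<rho>' x + (1 - s) * \<rho> x)) has_real_derivative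
    (\<integral>x. (\<rho>' x - \<rho> x) * (inverse \<gamma> * ln (\<rho> x) + conv m W \<rho> x) \<partial>m)) (at_right 0)"
proof -
  have int: "integrable m \<rho>" "integrable m \<rho>'" and one: "(\<integral>x. \<rho> x \<partial>m) = 1" "(\<integral>x. \<rho>' x \<partial>m) = 1"
    and pos: "AE x in m. \<rho> x > 0" "AE x in m. \<rho>' x \<ge> 0"
    using \<rho> \<rho>' by (auto simp: P_ac_pos_def P_ac_def)
  have e: "(ln (\<rho> x) + 1) * (\<rho>' x - \<rho> x) = (\<rho>' x - \<rho> x) * ln (\<rho> x) + (\<rho>' x - \<rho> x)" for x
    by (simp add: algebra_simps)
  have id': "integrable m (\<lambda>x. (ln (\<rho> x) + 1) * (\<rho>' x - \<rho> x))"
    unfolding e using id int by simp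
  have "((\<lambda>s. inverse \<gamma> * (\<integral>x. (s * \<rho>' x + (1 - s) * \<rho> x) * ln (s * \<rho>' x + (1 - s) * \<rho> x) \<partial>m)
      + 1 / 2 * (\<integral>x. (\<integral>y. W x y * (s * \<rho>' x + (1 - s) * \<rho> x) * (s * \<rho>' y + (1 - s) * \<rho> y) \<partial>m) \<partial>m))
    has_real_derivative inverse \<gamma> * (\<integral>x. (ln (\<rho> x) + 1) * (\<rho>' x - \<rho> x) \<partial>m) + (\<integral>x. (\<rho>' x - \<rho> x) * conv m W \<rho> x \<partial>m)) (at_right 0)"
    by (intro DERIV_add DERIV_cmult entropy_derivative interaction_derivative sym int pos i0 i1 id') (use int in auto)
  moreover have "(\<integral>x. (ln (\<rho> x) + 1) * (\<rho>' x - \<rho> x) \<partial>m) = (\<integral>x. (\<rho>' x - \<rho> x) * ln (\<rho> x) \<partial>m)"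
    unfolding e using id int one by simp
  moreover have "inverse \<gamma> * (\<integral>x. (\<rho>' x - \<rho> x) * ln (\<rho> x) \<partial>m) + (\<integral>x. (\<rho>' x - \<rho> x) * conv m W \<rho> x \<partial>m)
      = (\<integral>x. (\<rho>' x - \<rho> x) * (inverse \<gamma> * ln (\<rho> x) + conv m W \<rho> x) \<partial>m)"
  proof -
    have "(\<rho>' x - \<rho> x) * (inverse \<gamma> * ln (\<rho> x) + conv m W \<rho> x)
        = inverse \<gamma> * ((\<rho>' x - \<rho> x) * ln (\<rho> x)) + (\<rho>' x - \<rho> x) * conv m W \<rho> x" for x
      by (simp add: algebra_simps)
    moreover have "integrable m (\<lambda>x. (\<rho>' x - \<rho> x) * conv m W \<rho> x)"
      using int by (intro integrable_mult_conv) auto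
    ultimately show ?thesis using id by simp
  qed
  ultimately show ?thesis by (simp add: free_energy_def)
qed

lemma integrable_entropy:
  assumes "\<rho> \<in> P_ac m" "integrable m (\<lambda>x. (\<rho> x)\<^sup>2)"
  shows "integrable m (\<lambda>x. \<rho> x * ln (\<rho> x))"
proof (rule Bochner_Integration.integrable_bound)
  show "integrable m (\<lambda>x. 1 + (\<rho> x)\<^sup>2)" using assms by simp
  have "AE x in m. \<rho> x \<ge> 0" and [measurable]: "\<rho> \<in> borel_measurable m" using assms by (auto simp: P_ac_def)
  then show "AE x in m. norm (\<rho> x * ln (\<rho> x)) \<le> norm (1 + (\<rho> x)\<^sup>2)"
    by (elim eventually_mono) (use abs_x_ln_x_le in auto)
  show "(\<lambda>x. \<rho> x * ln (\<rho> x)) \<in> borel_measurable m" by measurable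
qed

lemma conv_bound_P_ac:
  assumes "\<rho> \<in> P_ac m" "x \<in> space m"
  shows "\<bar>conv m W \<rho> x\<bar> \<le> B"
proof -
  have "(\<integral>y. \<bar>\<rho> y\<bar> \<partial>m) = (\<integral>y. \<rho> y \<partial>m)"
    using assms by (intro integral_cong_AE) (auto simp: P_ac_def elim: eventually_mono)
  then show ?thesis using conv_bound[of \<rho> x] assms by (simp add: P_ac_def)
qed

lemma gibbs_weight_integrable:
  assumes \<rho>: "\<rho> \<in> P_ac m"
  shows "integrable m (\<lambda>x. exp (- \<gamma> * conv m W \<rho> x))"
proof (rule integrable_const_bound)
  show "AE x in m. norm (exp (- \<gamma> * conv m W \<rho> x)) \<le> exp (\<bar>\<gamma>\<bar> * B)"
  proof (rule AE_I2)
    fix x assume "x \<in> space m"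
    have "- \<gamma> * conv m W \<rho> x \<le> \<bar>\<gamma> * conv m W \<rho> x\<bar>" by simp
    also have "\<dots> \<le> \<bar>\<gamma>\<bar> * B" unfolding abs_mult by (intro mult_left_mono conv_bound_P_ac[OF \<rho> \<open>x \<in> space m\<close>]) simp
    finally show "norm (exp (- \<gamma> * conv m W \<rho> x)) \<le> exp (\<bar>\<gamma>\<bar> * B)" by simp
  qed
  show "(\<lambda>x. exp (- \<gamma> * conv m W \<rho> x)) \<in> borel_measurable m"
    using conv_measurable[of \<rho>] \<rho> by (auto simp: P_ac_def)
qed

text \<open>A density proportional to the Gibbs weight is normalised by the partition function.\<close>

lemma gibbs_zero_if_proportional:
  assumes \<rho>: "\<rho> \<in> P_ac m" and t: "AE x in m. \<rho> x = t * exp (- \<gamma> * conv m W \<rho> x)"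
  shows "gibbs_zero m W \<gamma> \<rho>"
proof -
  have "1 = (\<integral>x. \<rho> x \<partial>m)" using \<rho> by (simp add: P_ac_def)
  also have "\<dots> = (\<integral>x. t * exp (- \<gamma> * conv m W \<rho> x) \<partial>m)"
    using \<rho> t gibbs_weight_integrable[OF \<rho>, of \<gamma>] by (intro integral_cong_AE) (auto simp: P_ac_def)
  also have "\<dots> = t * partition_fn m W \<gamma> \<rho>" by (simp add: partition_fn_def)
  finally have eq: "1 = t * partition_fn m W \<gamma> \<rho>" .
  then have "partition_fn m W \<gamma> \<rho> \<noteq> 0" by auto
  with eq have "t = 1 / partition_fn m W \<gamma> \<rho>" by (simp add: eq_divide_eq)
  with t show ?thesis by (simp add: gibbs_zero_def)
qed

lemma gibbs_zero_partition_fn_pos: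
  assumes \<rho>: "\<rho> \<in> P_ac m" and gibbs: "gibbs_zero m W \<gamma> \<rho>"
  shows "partition_fn m W \<gamma> \<rho> > 0"
proof (rule ccontr)
  assume "\<not> ?thesis"
  moreover have "partition_fn m W \<gamma> \<rho> \<ge> 0" unfolding partition_fn_def by (rule Bochner_Integration.integral_nonneg) simp
  ultimately have "partition_fn m W \<gamma> \<rho> = 0" by simp
  with gibbs have "AE x in m. \<rho> x = 0" by (simp add: gibbs_zero_def)
  then have "(\<integral>x. \<rho> x \<partial>m) = (\<integral>x. 0 \<partial>m)" using \<rho> by (intro integral_cong_AE) (auto simp: P_ac_def)
  with \<rho> show False by (simp add: P_ac_def)
qed

text \<open>Under the Gibbs equation \<open>ln \<rho>\<close> is bounded and the chemical potential is constant, so the first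
  variation is a multiple of the difference of the masses.\<close>

lemma gibbs_imp_critical:
  assumes sym: "\<And>x y. W x y = W y x" and \<rho>: "\<rho> \<in> P_ac_pos m" and sq: "integrable m (\<lambda>x. (\<rho> x)\<^sup>2)"
    and \<gamma>: "\<gamma> > 0" and gibbs: "gibbs_zero m W \<gamma> \<rho>"
  shows "critical_point m W \<gamma> \<rho>"
  unfolding critical_point_def
proof (intro ballI impI)
  fix \<rho>' assume \<rho>': "\<rho>' \<in> P_ac m" and i1: "integrable m (\<lambda>x. \<rho>' x * ln (\<rho>' x))"
  have \<rho>1: "\<rho> \<in> P_ac m" using \<rho> by (simp add: P_ac_pos_def)
  have int: "integrable m \<rho>" "integrable m \<rho>'" and one: "(\<integral>x. \<rho> x \<partial>m) = 1" "(\<integral>x. \<rho>' x \<partial>m) = 1"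
    using \<rho>1 \<rho>' by (auto simp: P_ac_def)
  have [measurable]: "\<rho> \<in> borel_measurable m" "\<rho>' \<in> borel_measurable m" using int by auto
  note [measurable] = conv_measurable[of \<rho>, OF \<open>\<rho> \<in> borel_measurable m\<close>]
  define Z where "Z = partition_fn m W \<gamma> \<rho>"
  have Z: "Z > 0" unfolding Z_def by (rule gibbs_zero_partition_fn_pos[OF \<rho>1 gibbs])
  have ln: "AE x in m. ln (\<rho> x) = - ln Z - \<gamma> * conv m W \<rho> x"
    using gibbs unfolding gibbs_zero_def Z_def[symmetric]
    by eventually_elim (use Z in \<open>simp add: ln_mult ln_div\<close>)
  have "integrable m (\<lambda>x. (\<rho>' x - \<rho> x) * (- ln Z) - \<gamma> * ((\<rho>' x - \<rho> x) * conv m W \<rho> x))"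
    using int integrable_mult_conv[of "\<lambda>x. \<rho>' x - \<rho> x" \<rho>] by simp
  then have id: "integrable m (\<lambda>x. (\<rho>' x - \<rho> x) * ln (\<rho> x))"
  proof (rule integrable_cong_AE_imp)
    show "AE x in m. (\<rho>' x - \<rho> x) * (- ln Z) - \<gamma> * ((\<rho>' x - \<rho> x) * conv m W \<rho> x) = (\<rho>' x - \<rho> x) * ln (\<rho> x)"
      using ln
    proof eventually_elim
      case (elim x)
      show ?case unfolding elim by (simp add: algebra_simps)
    qed
  qed measurable
  have "(\<integral>x. (\<rho>' x - \<rho> x) * (inverse \<gamma> * ln (\<rho> x) + conv m W \<rho> x) \<partial>m) = (\<integral>x. (\<rho>' x - \<rho> x) * (- inverse \<gamma> * ln Z) \<partial>m)"
  proof (rule integral_cong_AE)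
    show "AE x in m. (\<rho>' x - \<rho> x) * (inverse \<gamma> * ln (\<rho> x) + conv m W \<rho> x) = (\<rho>' x - \<rho> x) * (- inverse \<gamma> * ln Z)"
      using ln
    proof eventually_elim
      case (elim x)
      have "inverse \<gamma> * ln (\<rho> x) + conv m W \<rho> x = - inverse \<gamma> * ln Z"
        using \<gamma> unfolding elim by (simp add: field_simps)
      then show ?case by (simp only:)
    qed
  qed measurable
  also have "\<dots> = 0" using int one by simp
  finally show "((\<lambda>s. free_energy m W \<gamma> (\<lambda>x. s * \<rho>' x + (1 - s) * \<rho> x)) has_real_derivative 0) (at_right 0)"
    using free_energy_derivative[OF sym \<rho> \<rho>' integrable_entropy[OF \<rho>1 sq] i1 id, of \<gamma>] by simp
qed

text \<open>Tilting \<open>\<rho>\<close> by a bounded increasing function of its chemical potential \<open>u\<close> stays inside the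
  class of competitors; the first variation then is the covariance of \<open>u\<close> with that
  function, which vanishes only if \<open>u\<close> is constant.\<close>

lemma critical_imp_gibbs:
  assumes sym: "\<And>x y. W x y = W y x" and \<rho>: "\<rho> \<in> P_ac_pos m" and sq: "integrable m (\<lambda>x. (\<rho> x)\<^sup>2)"
    and \<gamma>: "\<gamma> > 0" and crit: "critical_point m W \<gamma> \<rho>"
  shows "gibbs_zero m W \<gamma> \<rho>"
proof -
  have \<rho>1: "\<rho> \<in> P_ac m" and pos: "AE x in m. \<rho> x > 0" using \<rho> by (auto simp: P_ac_pos_def)
  have int: "integrable m \<rho>" and one: "(\<integral>x. \<rho> x \<partial>m) = 1" using \<rho>1 by (auto simp: P_ac_def)
  have [measurable]: "\<rho> \<in> borel_measurable m" using int by auto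
  note [measurable] = conv_measurable[of \<rho>, OF \<open>\<rho> \<in> borel_measurable m\<close>]
  note ent = integrable_entropy[OF \<rho>1 sq]
  define u where "u x = inverse \<gamma> * ln (\<rho> x) + conv m W \<rho> x" for x
  have [measurable]: "u \<in> borel_measurable m" unfolding u_def by measurable
  have \<rho>u: "integrable m (\<lambda>x. \<rho> x * u x)"
  proof -
    have "integrable m (\<lambda>x. inverse \<gamma> * (\<rho> x * ln (\<rho> x)) + \<rho> x * conv m W \<rho> x)"
      using ent integrable_mult_conv[OF int int] by simp
    then show ?thesis by (simp add: u_def algebra_simps)
  qed
  define c where "c = (\<integral>x. \<rho> x * u x \<partial>m)"
  define \<kappa> where "\<kappa> x = arctan (u x - c)" for x
  have [measurable]: "\<kappa> \<in> borel_measurable m" unfolding \<kappa>_def by measurable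
  have \<kappa>2: "\<bar>\<kappa> x\<bar> \<le> 2" for x
    using arctan_lbound[of "u x - c"] arctan_ubound[of "u x - c"] pi_less_4 unfolding \<kappa>_def by linarith
  have \<rho>\<kappa>: "integrable m (\<lambda>x. \<rho> x * \<kappa> x)" by (rule integrable_mult_bounded(1)[OF int _ \<kappa>2]) measurable
  define k where "k = (\<integral>x. \<rho> x * \<kappa> x \<partial>m)"
  have k2: "\<bar>k\<bar> \<le> 2"
  proof -
    have "\<bar>k\<bar> \<le> (\<integral>x. \<bar>\<rho> x * \<kappa> x\<bar> \<partial>m)" unfolding k_def by (rule integral_abs_bound)
    also have "\<dots> \<le> (\<integral>x. \<rho> x * 2 \<partial>m)"
    proof (rule integral_mono_AE)
      show "AE x in m. \<bar>\<rho> x * \<kappa> x\<bar> \<le> \<rho> x * 2"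
        using pos by eventually_elim (use \<kappa>2 in \<open>auto simp: abs_mult\<close>)
    qed (use \<rho>\<kappa> int in auto)
    finally show ?thesis using one by simp
  qed
  \<comment> \<open>As \<open>\<bar>\<kappa> x - k\<bar> \<le> 4\<close>, the factor keeps \<open>1 + h\<close> between \<open>1/2\<close> and \<open>3/2\<close>.\<close>
  define h where "h x = (\<kappa> x - k) / 8" for x
  have [measurable]: "h \<in> borel_measurable m" unfolding h_def by measurable
  have h: "\<bar>h x\<bar> \<le> 1 / 2" for x
    using \<kappa>2[of x] k2 unfolding h_def by (simp add: abs_le_iff)
  define \<rho>' where "\<rho>' x = \<rho> x * (1 + h x)" for x
  have \<rho>h: "integrable m (\<lambda>x. \<rho> x * h x)" by (rule integrable_mult_bounded(1)[OF int _ h]) measurable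
  have \<rho>h0: "(\<integral>x. \<rho> x * h x \<partial>m) = 0"
  proof -
    have "(\<lambda>x. \<rho> x * h x) = (\<lambda>x. (\<rho> x * \<kappa> x - k * \<rho> x) / 8)"
      by (rule ext) (simp add: h_def algebra_simps)
    then show ?thesis using \<rho>\<kappa> int one by (simp add: k_def)
  qed
  have "\<rho>' \<in> P_ac m"
  proof -
    have "\<rho>' = (\<lambda>x. \<rho> x + \<rho> x * h x)" by (rule ext) (simp add: \<rho>'_def algebra_simps)
    then have "integrable m \<rho>'" "(\<integral>x. \<rho>' x \<partial>m) = 1" using int \<rho>h \<rho>h0 one by simp_all
    moreover have "AE x in m. \<rho>' x \<ge> 0"
      using pos
    proof eventually_elim
      case (elim x)
      then show ?case using h[of x] unfolding \<rho>'_def by (intro mult_nonneg_nonneg) linarith+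
    qed
    ultimately show ?thesis by (simp add: P_ac_def)
  qed
  moreover have "integrable m (\<lambda>x. \<rho>' x * ln (\<rho>' x))"
  proof -
    have ln_h: "\<bar>(1 + h x) * ln (1 + h x)\<bar> \<le> 4" for x
    proof -
      have "0 \<le> 1 + h x" "1 + h x \<le> 3 / 2" using h[of x] by linarith+
      then have "\<bar>(1 + h x) * ln (1 + h x)\<bar> \<le> 1 + (1 + h x)\<^sup>2" "(1 + h x)\<^sup>2 \<le> (3 / 2)\<^sup>2"
        by (auto intro: abs_x_ln_x_le power_mono)
      moreover have "(3 / 2 :: real)\<^sup>2 = 9 / 4" by (simp add: power2_eq_square)
      ultimately show ?thesis by linarith
    qed
    have "\<bar>1 + h x\<bar> \<le> 2" for x using h[of x] by linarith
    then have "integrable m (\<lambda>x. \<rho> x * ln (\<rho> x) * (1 + h x))"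
      by (intro integrable_mult_bounded(1)[OF ent]) auto
    moreover have "integrable m (\<lambda>x. \<rho> x * ((1 + h x) * ln (1 + h x)))"
      by (rule integrable_mult_bounded(1)[OF int _ ln_h]) measurable
    ultimately have "integrable m (\<lambda>x. \<rho> x * ln (\<rho> x) * (1 + h x) + \<rho> x * ((1 + h x) * ln (1 + h x)))" by simp
    then show ?thesis
    proof (rule integrable_cong_AE_imp)
      show "AE x in m. \<rho> x * ln (\<rho> x) * (1 + h x) + \<rho> x * ((1 + h x) * ln (1 + h x)) = \<rho>' x * ln (\<rho>' x)"
        using pos
      proof eventually_elim
        case (elim x)
        have "1 + h x > 0" using h[of x] by linarith
        with elim have "ln (\<rho> x * (1 + h x)) = ln (\<rho> x) + ln (1 + h x)" by (simp add: ln_mult)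
        then show ?case unfolding \<rho>'_def by (simp only:) (simp add: algebra_simps)
      qed
    qed (auto simp: \<rho>'_def)
  qed
  ultimately have d0: "((\<lambda>s. free_energy m W \<gamma> (\<lambda>x. s * \<rho>' x + (1 - s) * \<rho> x)) has_real_derivative 0) (at_right 0)"
    and i1: "integrable m (\<lambda>x. \<rho>' x * ln (\<rho>' x))" and \<rho>': "\<rho>' \<in> P_ac m"
    using crit by (auto simp: critical_point_def)
  have diff: "\<rho>' x - \<rho> x = \<rho> x * h x" for x by (simp add: \<rho>'_def algebra_simps)
  have "integrable m (\<lambda>x. \<rho> x * ln (\<rho> x) * h x)" by (rule integrable_mult_bounded(1)[OF ent _ h]) measurable
  then have id: "integrable m (\<lambda>x. (\<rho>' x - \<rho> x) * ln (\<rho> x))" unfolding diff by (simp add: mult_ac)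
  from free_energy_derivative[OF sym \<rho> \<rho>' ent i1 id, of \<gamma>] d0
  have "(\<integral>x. (\<rho>' x - \<rho> x) * u x \<partial>m) = 0"
    unfolding has_field_derivative_iff u_def by (rule tendsto_unique[rotated]) simp
  then have hu: "(\<integral>x. \<rho> x * u x * h x \<partial>m) = 0" by (simp add: diff mult_ac)
  have \<rho>u\<kappa>: "integrable m (\<lambda>x. \<rho> x * u x * \<kappa> x)" by (rule integrable_mult_bounded(1)[OF \<rho>u _ \<kappa>2]) measurable
  have "(\<integral>x. \<rho> x * \<kappa> x * (u x - c) \<partial>m) = 0"
  proof -
    have "\<rho> x * u x * h x = (\<rho> x * u x * \<kappa> x - k * (\<rho> x * u x)) / 8" for x by (simp add: h_def algebra_simps)
    with hu have "(\<integral>x. \<rho> x * u x * \<kappa> x \<partial>m) = k * c" using \<rho>u \<rho>u\<kappa> by (simp add: c_def)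
    moreover have "\<rho> x * \<kappa> x * (u x - c) = \<rho> x * u x * \<kappa> x - c * (\<rho> x * \<kappa> x)" for x by (simp add: algebra_simps)
    ultimately show ?thesis using \<rho>u\<kappa> \<rho>\<kappa> by (simp add: k_def)
  qed
  moreover have "integrable m (\<lambda>x. \<rho> x * \<kappa> x * (u x - c))"
  proof -
    have "\<rho> x * \<kappa> x * (u x - c) = \<rho> x * u x * \<kappa> x - c * (\<rho> x * \<kappa> x)" for x by (simp add: algebra_simps)
    then show ?thesis using \<rho>u\<kappa> \<rho>\<kappa> by simp
  qed
  moreover have \<kappa>u: "\<kappa> x * (u x - c) \<ge> 0" for x
    unfolding \<kappa>_def using arctan_less_zero_iff[of "u x - c"] zero_le_arctan_iff[of "u x - c"]
    by (cases "u x - c \<ge> 0") (auto intro: mult_nonneg_nonneg mult_nonpos_nonpos)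
  moreover have "AE x in m. 0 \<le> \<rho> x * \<kappa> x * (u x - c)"
    using pos by eventually_elim (use \<kappa>u in \<open>simp add: mult.assoc\<close>)
  ultimately have "AE x in m. \<rho> x * \<kappa> x * (u x - c) = 0"
    using integral_nonneg_eq_0_iff_AE by blast
  then have "AE x in m. \<rho> x = exp (\<gamma> * c) * exp (- \<gamma> * conv m W \<rho> x)"
    using pos
  proof eventually_elim
    case (elim x)
    then have "u x = c" by (auto simp: \<kappa>_def)
    then have "ln (\<rho> x) = \<gamma> * c + - \<gamma> * conv m W \<rho> x" using \<gamma> by (simp add: u_def field_simps)
    then show ?case using elim by (metis exp_add exp_ln)
  qed
  then show ?thesis by (rule gibbs_zero_if_proportional[OF \<rho>1])
qed

end

locale riemannian_atlas = riemannian_charts M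
  for M :: "('i, 'm::{t2_space, second_countable_topology}, 'e::euclidean_space) riem" +
  assumes cover: "(\<Union>i\<in>chart_ix M. chart_dom M i) = UNIV"
    and open_dom: "i \<in> chart_ix M \<Longrightarrow> open (chart_dom M i)"
    and homeo: "i \<in> chart_ix M \<Longrightarrow>
      homeomorphism (chart_dom M i) (chart_img M i) (coord M i) (chart_inv M i)"
    and transform: "i \<in> chart_ix M \<Longrightarrow> j \<in> chart_ix M \<Longrightarrow> x \<in> chart_dom M i \<inter> chart_dom M j \<Longrightarrow>
      metric M i x v w = metric M j x (trans_deriv M i j x v) (trans_deriv M i j x w)"
    and compact_space: "compact (UNIV :: 'm set)"
begin

lemma chart_inv_in: "i \<in> chart_ix M \<Longrightarrow> u \<in> chart_img M i \<Longrightarrow> chart_inv M i u \<in> chart_dom M i"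
  using homeo[of i] by (auto simp: homeomorphism_def)

lemma coord_in: "i \<in> chart_ix M \<Longrightarrow> x \<in> chart_dom M i \<Longrightarrow> coord M i x \<in> chart_img M i"
  by (simp add: chart_img_def)

lemma coord_chart_inv: "i \<in> chart_ix M \<Longrightarrow> u \<in> chart_img M i \<Longrightarrow> coord M i (chart_inv M i u) = u"
  using homeo[of i] by (auto simp: homeomorphism_def)

lemma chart_inv_coord: "i \<in> chart_ix M \<Longrightarrow> x \<in> chart_dom M i \<Longrightarrow> chart_inv M i (coord M i x) = x"
  using homeo[of i] by (auto simp: homeomorphism_def)

lemma coord_measurable:
  assumes i: "i \<in> chart_ix M"
  shows "coord M i \<in> measurable (restrict_space borel (chart_dom M i)) (restrict_space borel (chart_img M i))"
proof (rule measurable_restrict_space2)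
  show "coord M i \<in> space (restrict_space borel (chart_dom M i)) \<rightarrow> chart_img M i"
    using coord_in[OF i] by (auto simp: space_restrict_space)
  show "coord M i \<in> borel_measurable (restrict_space borel (chart_dom M i))"
    using homeo[OF i] by (intro borel_measurable_continuous_on_restrict) (auto simp: homeomorphism_def)
qed

lemma chart_inv_measurable:
  assumes i: "i \<in> chart_ix M"
  shows "chart_inv M i \<in> measurable (restrict_space borel (chart_img M i)) borel"
  using homeo[OF i] by (intro borel_measurable_continuous_on_restrict) (auto simp: homeomorphism_def)

lemma chart_at: "chart_at M x \<in> chart_ix M" "x \<in> chart_dom M (chart_at M x)"
proof -
  have "\<exists>i. i \<in> chart_ix M \<and> x \<in> chart_dom M i" using cover by blast
  from someI_ex[OF this] show "chart_at M x \<in> chart_ix M" "x \<in> chart_dom M (chart_at M x)"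
    by (auto simp: chart_at_def)
qed

lemma finite_atlas:
  obtains I where "finite I" "I \<subseteq> chart_ix M" "\<And>x. \<exists>i\<in>I. x \<in> chart_dom M i"
proof -
  obtain I where "I \<subseteq> chart_ix M" "finite I" "UNIV \<subseteq> (\<Union>i\<in>I. chart_dom M i)"
    using compactE_image[OF compact_space, of "chart_ix M" "chart_dom M"] open_dom cover by auto
  then show ?thesis using that[of I] by blast
qed

lemma rinner_chart:
  assumes X: "vector_field M X" and Y: "vector_field M Y" and i: "i \<in> chart_ix M" and x: "x \<in> chart_dom M i"
  shows "rinner M X Y x = metric M i x (X i x) (Y i x)"
proof -
  have xx: "x \<in> chart_dom M i \<inter> chart_dom M (chart_at M x)" using x chart_at by simp
  have "X (chart_at M x) x = trans_deriv M i (chart_at M x) x (X i x)"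
    "Y (chart_at M x) x = trans_deriv M i (chart_at M x) x (Y i x)"
    using X Y i xx chart_at unfolding vector_field_def by blast+
  then show ?thesis
    unfolding rinner_def using transform[OF i chart_at(1) xx] by simp
qed

lemma metric_at:
  assumes i: "i \<in> chart_ix M" and x: "x \<in> chart_dom M i"
  shows "bilinear (metric M i x)" "metric M i x v v \<ge> 0" "metric M i x v v = 0 \<longleftrightarrow> v = 0"
proof -
  have u: "coord M i x \<in> chart_img M i" using coord_in[OF i x] .
  note eq = chart_inv_coord[OF i x]
  show bil: "bilinear (metric M i x)" using metric_bilin[OF i u] by (simp add: eq)
  show "metric M i x v v \<ge> 0" using metric_nonneg[OF i u, of v] by (simp add: eq)
  show "metric M i x v v = 0 \<longleftrightarrow> v = 0"
    using metric_posdef[OF i u, of v] bilinear_lzero[OF bil, of 0] by (cases "v = 0") (auto simp: eq)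
qed

lemma rinner_nonneg: "rinner M X X x \<ge> 0"
  unfolding rinner_def by (rule metric_at(2)[OF chart_at])

lemma borel_measurable_charts:
  fixes g :: "'m \<Rightarrow> 'b::topological_space"
  assumes g: "\<And>i. i \<in> chart_ix M \<Longrightarrow> (\<lambda>u. g (chart_inv M i u)) \<in> borel_measurable (restrict_space borel (chart_img M i))"
  shows "g \<in> borel_measurable borel"
proof -
  obtain I where I: "finite I" "I \<subseteq> chart_ix M" "\<And>x. \<exists>i\<in>I. x \<in> chart_dom M i" using finite_atlas by metis
  show ?thesis
  proof (rule measurable_piecewise_restrict[where C="chart_dom M ` I"])
    show "countable (chart_dom M ` I)" using I by (simp add: countable_finite)
    show "space borel \<subseteq> \<Union> (chart_dom M ` I)" using I by blast
    fix \<Omega> assume "\<Omega> \<in> chart_dom M ` I"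
    then obtain i where i: "i \<in> chart_ix M" and \<Omega>: "\<Omega> = chart_dom M i" using I by blast
    show "\<Omega> \<inter> space borel \<in> sets borel" using open_dom[OF i] \<Omega> by simp
    have "(\<lambda>x. g (chart_inv M i (coord M i x))) \<in> borel_measurable (restrict_space borel \<Omega>)"
      unfolding \<Omega> by (rule measurable_compose[OF coord_measurable[OF i] g[OF i]])
    also have "?this \<longleftrightarrow> g \<in> borel_measurable (restrict_space borel \<Omega>)"
      by (rule measurable_cong) (simp add: \<Omega> space_restrict_space chart_inv_coord[OF i])
    finally show "g \<in> borel_measurable (restrict_space borel \<Omega>)" .
  qed
qed

lemma borel_measurable_chart_inv:
  assumes "g \<in> borel_measurable borel" "i \<in> chart_ix M"
  shows "(\<lambda>u. g (chart_inv M i u)) \<in> borel_measurable (restrict_space borel (chart_img M i))"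
  by (rule measurable_compose[OF chart_inv_measurable[OF assms(2)] assms(1)])

definition chart_measurable :: "('i, 'm, 'e) vfield \<Rightarrow> bool" where
  "chart_measurable X \<longleftrightarrow>
     (\<forall>i\<in>chart_ix M. (\<lambda>u. X i (chart_inv M i u)) \<in> borel_measurable (restrict_space borel (chart_img M i)))"

lemma weak_gradient_measurable:
  "weak_gradient M f X \<Longrightarrow> chart_measurable X"
  unfolding chart_measurable_def weak_gradient_def
  using locally_integrable_imp_measurable[OF open_img] by blast

lemma rinner_measurable:
  assumes X: "vector_field M X" "chart_measurable X" and Y: "vector_field M Y" "chart_measurable Y"
  shows "rinner M X Y \<in> borel_measurable borel"
proof (rule borel_measurable_charts)
  fix i assume i: "i \<in> chart_ix M"
  have "(\<lambda>u. metric M i (chart_inv M i u) (X i (chart_inv M i u)) (Y i (chart_inv M i u))) \<in> borel_measurable (restrict_space borel (chart_img M i))"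
    by (rule metric_measurable[OF i]) (use X Y i in \<open>auto simp: chart_measurable_def\<close>)
  also have "?this \<longleftrightarrow> (\<lambda>u. rinner M X Y (chart_inv M i u)) \<in> borel_measurable (restrict_space borel (chart_img M i))"
    by (rule measurable_cong) (use X Y chart_inv_in[OF i] in \<open>auto simp: space_restrict_space rinner_chart[OF _ _ i]\<close>)
  finally show "(\<lambda>u. rinner M X Y (chart_inv M i u)) \<in> borel_measurable (restrict_space borel (chart_img M i))" .
qed

end

text \<open>A compact atlas with a Borel measure for which chart-wise null sets are null sets. The manifold with
  its volume and its square with the product volume are both instances, so that the uniqueness of
  weak gradients is available for \<open>\<rho>\<close> as well as for \<open>W\<close>.\<close>

locale riemannian_measure_atlas = riemannian_atlas M
  for M :: "('i, 'm::{t2_space, second_countable_topology}, 'e::euclidean_space) riem" +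
  fixes \<mu> :: "'m measure"
  assumes sets_\<mu>: "sets \<mu> = sets borel"
    and null_charts: "i \<in> chart_ix M \<Longrightarrow> (AE u in lborel. u \<in> chart_img M i \<longrightarrow> P (chart_inv M i u)) \<Longrightarrow>
      (AE x in \<mu>. x \<in> chart_dom M i \<longrightarrow> P x)"
begin

lemma AE_charts:
  assumes "\<And>i. i \<in> chart_ix M \<Longrightarrow> AE u in lborel. u \<in> chart_img M i \<longrightarrow> P (chart_inv M i u)"
  shows "AE x in \<mu>. P x"
proof -
  obtain I where I: "finite I" "I \<subseteq> chart_ix M" "\<And>x. \<exists>i\<in>I. x \<in> chart_dom M i" using finite_atlas by metis
  have "AE x in \<mu>. x \<in> chart_dom M i \<longrightarrow> P x" if "i \<in> I" for i
    using that I assms by (intro null_charts) auto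
  then have "AE x in \<mu>. \<forall>i\<in>I. x \<in> chart_dom M i \<longrightarrow> P x"
    using I by (intro AE_finite_allI) auto
  then show ?thesis by eventually_elim (use I in blast)
qed

lemma weak_gradient_unique:
  assumes X: "weak_gradient M f X" and Y: "weak_gradient M f' Y"
    and ff': "\<And>i. i \<in> chart_ix M \<Longrightarrow> AE u in lborel. u \<in> chart_img M i \<longrightarrow> f (chart_inv M i u) = f' (chart_inv M i u)"
  shows "AE x in \<mu>. X (chart_at M x) x = Y (chart_at M x) x"
proof (rule AE_charts)
  fix i assume i: "i \<in> chart_ix M"
  show "AE u in lborel. u \<in> chart_img M i \<longrightarrow>
      X (chart_at M (chart_inv M i u)) (chart_inv M i u) = Y (chart_at M (chart_inv M i u)) (chart_inv M i u)"
    using weak_gradient_unique_chart[OF X Y i ff'[OF i]]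
  proof eventually_elim
    case (elim u)
    show ?case
    proof
      let ?x = "chart_inv M i u"
      assume u: "u \<in> chart_img M i"
      then have x: "?x \<in> chart_dom M i \<inter> chart_dom M (chart_at M ?x)" using chart_inv_in[OF i] chart_at by simp
      have "X (chart_at M ?x) ?x = trans_deriv M i (chart_at M ?x) ?x (X i ?x)"
        "Y (chart_at M ?x) ?x = trans_deriv M i (chart_at M ?x) ?x (Y i ?x)"
        using X Y i x chart_at(1)[of ?x] unfolding weak_gradient_def vector_field_def by blast+
      with elim u show "X (chart_at M ?x) ?x = Y (chart_at M ?x) ?x" by simp
    qed
  qed
qed

lemma H1_grad:
  assumes f: "f \<in> H1 M \<mu>"
  shows "weak_gradient M f (grad M f)" "integrable \<mu> (rinner M (grad M f) (grad M f))"
proof -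
  obtain X where X: "weak_gradient M f X" "integrable \<mu> (rinner M X X)" using f by (auto simp: H1_def)
  show g: "weak_gradient M f (grad M f)" unfolding grad_def
    by (rule someI[of "weak_gradient M f"]) (rule X(1))
  have "AE x in \<mu>. X (chart_at M x) x = grad M f (chart_at M x) x"
    by (rule weak_gradient_unique[OF X(1) g]) simp
  then have "AE x in \<mu>. rinner M X X x = rinner M (grad M f) (grad M f) x"
    by eventually_elim (simp add: rinner_def)
  moreover have "rinner M (grad M f) (grad M f) \<in> borel_measurable \<mu>"
    using rinner_measurable[of "grad M f" "grad M f"] weak_gradient_measurable[OF g] g
    by (simp add: measurable_cong_sets[OF sets_\<mu> refl] weak_gradient_def)
  ultimately show "integrable \<mu> (rinner M (grad M f) (grad M f))"
    using X(2) by (subst integrable_cong_AE[of _ _ "rinner M X X"]) (auto dest: borel_measurable_integrable elim: eventually_mono)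
qed

end

section \<open>The manifold, its volume and its square\<close>

context riemannian_manifold
begin

lemma riemannian_atlas_compact:
  assumes "compact (UNIV :: 'm set)"
  shows "riemannian_atlas M"
proof
  fix i assume i: "i \<in> chart_ix M"
  have in_dom: "chart_inv M i u \<in> chart_dom M i" if "u \<in> chart_img M i" for u
    using chart_homeomorphism[OF i] that by (auto simp: homeomorphism_def)
  show "open (chart_img M i)" "open (chart_dom M i)"
    "homeomorphism (chart_dom M i) (chart_img M i) (coord M i) (chart_inv M i)"
    using i chart_img_open chart_dom_open chart_homeomorphism by auto
  show "bilinear (metric M i (chart_inv M i u))" if "u \<in> chart_img M i" for u
    using metric_bilinear[OF i in_dom[OF that]] .
  show "metric M i (chart_inv M i u) v v > 0" if "u \<in> chart_img M i" "v \<noteq> 0" for u v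
    using metric_pos[OF i in_dom[OF that(1)] that(2)] .
  show "continuous_on (chart_img M i) (\<lambda>u. metric M i (chart_inv M i u) v w)" for v w
    using metric_smooth[OF i, of v w] unfolding smooth_on_def by (metis Ck_on.simps(1))
next
  show "(\<Union>i\<in>chart_ix M. chart_dom M i) = UNIV" by (rule charts_cover)
  show "compact (UNIV :: 'm set)" by (rule assms)
  show "metric M i x v w = metric M j x (trans_deriv M i j x v) (trans_deriv M i j x w)"
    if "i \<in> chart_ix M" "j \<in> chart_ix M" "x \<in> chart_dom M i \<inter> chart_dom M j" for i j x v w
    using metric_transform[OF that] .
qed

lemma transition_has_derivative:
  assumes i: "i \<in> chart_ix M" and j: "j \<in> chart_ix M" and x: "x \<in> chart_dom M i \<inter> chart_dom M j"
  shows "((\<lambda>u. coord M j (chart_inv M i u)) has_derivative trans_deriv M i j x) (at (coord M i x))"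
proof -
  have "Ck_on (Suc 0) (coord M i ` (chart_dom M i \<inter> chart_dom M j)) (coord M j \<circ> chart_inv M i)"
    using transition_smooth[OF i j] by (simp only: smooth_on_def)
  then have "(coord M j \<circ> chart_inv M i) differentiable (at (coord M i x))"
    using x by auto
  then show ?thesis
    by (simp add: trans_deriv_def frechet_derivative_works o_def)
qed

lemma trans_deriv_linear:
  assumes "i \<in> chart_ix M" "j \<in> chart_ix M" "x \<in> chart_dom M i \<inter> chart_dom M j"
  shows "bounded_linear (trans_deriv M i j x)"
  using transition_has_derivative[OF assms] by (rule has_derivative_bounded_linear)

lemma trans_deriv_inverse:
  assumes i: "i \<in> chart_ix M" and j: "j \<in> chart_ix M" and x: "x \<in> chart_dom M i \<inter> chart_dom M j"
  shows "trans_deriv M j i x (trans_deriv M i j x v) = v"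
proof -
  have hi: "homeomorphism (chart_dom M i) (chart_img M i) (coord M i) (chart_inv M i)"
    and hj: "homeomorphism (chart_dom M j) (chart_img M j) (coord M j) (chart_inv M j)"
    using i j chart_homeomorphism by auto
  define O' where "O' = chart_img M i \<inter> chart_inv M i -` chart_dom M j"
  have O': "open O'"
    unfolding O'_def using hi chart_img_open[OF i] chart_dom_open[OF j]
    by (intro continuous_open_preimage) (auto simp: homeomorphism_def)
  have inv: "chart_inv M i (coord M i x) = x" "chart_inv M j (coord M j x) = x"
    using hi hj x by (auto simp: homeomorphism_def)
  have x': "coord M i x \<in> O'" using x inv by (auto simp: O'_def chart_img_def)
  have "((\<lambda>u. coord M i (chart_inv M j u)) has_derivative trans_deriv M j i x) (at (coord M j x))"
    using transition_has_derivative[OF j i] x by auto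
  then have "((\<lambda>u. coord M i (chart_inv M j u)) has_derivative trans_deriv M j i x) (at (coord M j (chart_inv M i (coord M i x))))"
    by (simp add: inv)
  from diff_chain_at[OF transition_has_derivative[OF i j x] this]
  have "((\<lambda>u. coord M i (chart_inv M j (coord M j (chart_inv M i u)))) has_derivative (\<lambda>v. trans_deriv M j i x (trans_deriv M i j x v))) (at (coord M i x))"
    by (simp add: o_def)
  moreover have "coord M i (chart_inv M j (coord M j (chart_inv M i u))) = u" if "u \<in> O'" for u
    using that hi hj by (auto simp: O'_def homeomorphism_def)
  ultimately have "((\<lambda>u. u) has_derivative (\<lambda>v. trans_deriv M j i x (trans_deriv M i j x v))) (at (coord M i x))"
    by (rule has_derivative_transform_within_open[OF _ O' x'])
  then have "(\<lambda>v. trans_deriv M j i x (trans_deriv M i j x v)) = (\<lambda>v. v)"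
    by (rule has_derivative_unique) (rule has_derivative_ident)
  then show ?thesis by (rule fun_cong)
qed

lemma chart_img_prod: "chart_img (prod_riem M M) (i, j) = chart_img M i \<times> chart_img M j"
  by (auto simp: chart_img_def prod_riem_def)

lemma chart_inv_prod:
  assumes i: "i \<in> chart_ix M" and j: "j \<in> chart_ix M" and u: "u \<in> chart_img M i" and v: "v \<in> chart_img M j"
  shows "chart_inv (prod_riem M M) (i, j) (u, v) = (chart_inv M i u, chart_inv M j v)"
proof -
  have hi: "homeomorphism (chart_dom M i) (chart_img M i) (coord M i) (chart_inv M i)"
    and hj: "homeomorphism (chart_dom M j) (chart_img M j) (coord M j) (chart_inv M j)"
    using i j chart_homeomorphism by auto
  have inj: "inj_on (coord M i) (chart_dom M i)" "inj_on (coord M j) (chart_dom M j)"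
    using hi hj by (auto simp: homeomorphism_def intro: inj_on_inverseI)
  show ?thesis
    unfolding chart_inv_def[of "prod_riem M M"]
  proof (rule inv_into_f_eq)
    show "inj_on (coord (prod_riem M M) (i, j)) (chart_dom (prod_riem M M) (i, j))"
      using inj by (auto simp: inj_on_def prod_riem_def)
    show "(chart_inv M i u, chart_inv M j v) \<in> chart_dom (prod_riem M M) (i, j)"
      "coord (prod_riem M M) (i, j) (chart_inv M i u, chart_inv M j v) = (u, v)"
      using hi hj u v by (auto simp: prod_riem_def homeomorphism_def)
  qed
qed

lemma trans_deriv_prod:
  assumes i: "i \<in> chart_ix M" "k \<in> chart_ix M" and x: "x \<in> chart_dom M i \<inter> chart_dom M k"
    and j: "j \<in> chart_ix M" "l \<in> chart_ix M" and y: "y \<in> chart_dom M j \<inter> chart_dom M l"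
  shows "trans_deriv (prod_riem M M) (i, j) (k, l) (x, y) (v, w) = (trans_deriv M i k x v, trans_deriv M j l y w)"
proof -
  let ?a = "coord M i x" and ?b = "coord M j y"
  have crd: "coord (prod_riem M M) (i', j') (x', y') = (coord M i' x', coord M j' y')" for i' j' x' y'
    by (simp add: prod_riem_def)
  have ab: "?a \<in> chart_img M i" "?b \<in> chart_img M j" using x y by (auto simp: chart_img_def)
  have "((\<lambda>u. coord M k (chart_inv M i u)) has_derivative trans_deriv M i k x) (at (fst (?a, ?b)))"
    using transition_has_derivative[OF i x] by simp
  from diff_chain_at[OF has_derivative_fst[OF has_derivative_ident] this]
  have 1: "((\<lambda>p. coord M k (chart_inv M i (fst p))) has_derivative (\<lambda>p. trans_deriv M i k x (fst p))) (at (?a, ?b))"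
    by (simp add: o_def)
  have "((\<lambda>u. coord M l (chart_inv M j u)) has_derivative trans_deriv M j l y) (at (snd (?a, ?b)))"
    using transition_has_derivative[OF j y] by simp
  from diff_chain_at[OF has_derivative_snd[OF has_derivative_ident] this]
  have 2: "((\<lambda>p. coord M l (chart_inv M j (snd p))) has_derivative (\<lambda>p. trans_deriv M j l y (snd p))) (at (?a, ?b))"
    by (simp add: o_def)
  have "((coord (prod_riem M M) (k, l) \<circ> chart_inv (prod_riem M M) (i, j)) has_derivative
      (\<lambda>p. (trans_deriv M i k x (fst p), trans_deriv M j l y (snd p)))) (at (?a, ?b))"
  proof (rule has_derivative_transform_within_open[OF has_derivative_Pair[OF 1 2]])
    show "open (chart_img M i \<times> chart_img M j)"
      using i j by (intro open_Times chart_img_open) auto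
    show "(?a, ?b) \<in> chart_img M i \<times> chart_img M j" using ab by simp
    show "(coord M k (chart_inv M i (fst p)), coord M l (chart_inv M j (snd p)))
        = (coord (prod_riem M M) (k, l) \<circ> chart_inv (prod_riem M M) (i, j)) p"
      if "p \<in> chart_img M i \<times> chart_img M j" for p
    proof -
      obtain u v where p: "p = (u, v)" "u \<in> chart_img M i" "v \<in> chart_img M j" using \<open>p \<in> _\<close> by auto
      have "chart_inv (prod_riem M M) (i, j) p = (chart_inv M i u, chart_inv M j v)"
        unfolding p(1) by (rule chart_inv_prod[OF i(1) j(1) p(2,3)])
      then show ?thesis by (simp add: p(1) crd)
    qed
  qed
  from frechet_derivative_at[OF this] show ?thesis
    by (simp add: trans_deriv_def[of "prod_riem M M"] crd fun_eq_iff)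
qed

lemma riemannian_atlas_prod:
  assumes cpt: "compact (UNIV :: 'm set)"
  shows "riemannian_atlas (prod_riem M M)"
proof -
  interpret A: riemannian_atlas M by (rule riemannian_atlas_compact[OF cpt])
  let ?P = "prod_riem M M"
  have ix: "chart_ix ?P = chart_ix M \<times> chart_ix M" by (simp add: prod_riem_def)
  have dom: "chart_dom ?P (i, j) = chart_dom M i \<times> chart_dom M j" for i j by (simp add: prod_riem_def)
  have crd: "coord ?P (i, j) (x, y) = (coord M i x, coord M j y)" for i j x y by (simp add: prod_riem_def)
  have met: "metric ?P (i, j) (x, y) (v, v') (w, w') = metric M i x v w + metric M j y v' w'" for i j x y v v' w w'
    by (simp add: prod_riem_def)
  show ?thesis
  proof
    fix p assume "p \<in> chart_ix ?P"
    then obtain i j where p: "p = (i, j)" and i: "i \<in> chart_ix M" and j: "j \<in> chart_ix M" by (auto simp: ix)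
    show "open (chart_img ?P p)" unfolding p chart_img_prod by (intro open_Times chart_img_open i j)
    show "open (chart_dom ?P p)" unfolding p dom by (intro open_Times chart_dom_open i j)
    have hi: "homeomorphism (chart_dom M i) (chart_img M i) (coord M i) (chart_inv M i)"
      and hj: "homeomorphism (chart_dom M j) (chart_img M j) (coord M j) (chart_inv M j)"
      using i j chart_homeomorphism by auto
    have inv: "chart_inv ?P (i, j) q = (chart_inv M i (fst q), chart_inv M j (snd q))"
      if "q \<in> chart_img M i \<times> chart_img M j" for q
    proof -
      have "chart_inv ?P (i, j) (fst q, snd q) = (chart_inv M i (fst q), chart_inv M j (snd q))"
        by (rule chart_inv_prod[OF i j]) (use that in auto)
      then show ?thesis by simp
    qed
    show "homeomorphism (chart_dom ?P p) (chart_img ?P p) (coord ?P p) (chart_inv ?P p)"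
      unfolding p dom chart_img_prod
    proof (rule homeomorphismI)
      have c: "continuous_on (chart_dom M i) (coord M i)" "continuous_on (chart_dom M j) (coord M j)"
        "continuous_on (chart_img M i) (chart_inv M i)" "continuous_on (chart_img M j) (chart_inv M j)"
        using hi hj unfolding homeomorphism_def by blast+
      note fs = continuous_on_fst[OF continuous_on_id] continuous_on_snd[OF continuous_on_id]
      have "continuous_on (chart_dom M i \<times> chart_dom M j) (\<lambda>q. (coord M i (fst q), coord M j (snd q)))"
        by (rule continuous_on_Pair[OF continuous_on_compose2[OF c(1) fs(1)] continuous_on_compose2[OF c(2) fs(2)]]) auto
      then show "continuous_on (chart_dom M i \<times> chart_dom M j) (coord ?P (i, j))"
        by (rule continuous_on_eq) (auto simp: crd)
      have "continuous_on (chart_img M i \<times> chart_img M j) (\<lambda>q. (chart_inv M i (fst q), chart_inv M j (snd q)))"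
        by (rule continuous_on_Pair[OF continuous_on_compose2[OF c(3) fs(1)] continuous_on_compose2[OF c(4) fs(2)]]) auto
      then show "continuous_on (chart_img M i \<times> chart_img M j) (chart_inv ?P (i, j))"
        by (rule continuous_on_eq) (auto simp: inv)
    qed (use hi hj inv A.coord_in[OF i] A.coord_in[OF j] in \<open>auto simp: homeomorphism_def crd\<close>)
    fix q :: "'e \<times> 'e" assume "q \<in> chart_img ?P p"
    then have q: "fst q \<in> chart_img M i" "snd q \<in> chart_img M j" by (auto simp: p chart_img_prod)
    then have iq: "chart_inv ?P p q = (chart_inv M i (fst q), chart_inv M j (snd q))"
      unfolding p by (intro inv) (auto simp: mem_Times_iff)
    have met': "metric ?P p (chart_inv ?P p q) v w
        = metric M i (chart_inv M i (fst q)) (fst v) (fst w) + metric M j (chart_inv M j (snd q)) (snd v) (snd w)" for v w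
      unfolding iq unfolding p using met[of i j _ _ "fst v" "snd v" "fst w" "snd w"] by simp
    have bl: "bilinear (metric M i (chart_inv M i (fst q)))" "bilinear (metric M j (chart_inv M j (snd q)))"
      using A.metric_bilin i j q by auto
    show "bilinear (metric ?P p (chart_inv ?P p q))"
      unfolding bilinear_def linear_iff met'
      by (auto simp: bilinear_ladd[OF bl(1)] bilinear_ladd[OF bl(2)] bilinear_radd[OF bl(1)] bilinear_radd[OF bl(2)]
          bilinear_lmul[OF bl(1)] bilinear_lmul[OF bl(2)] bilinear_rmul[OF bl(1)] bilinear_rmul[OF bl(2)] distrib_left)
    show "metric ?P p (chart_inv ?P p q) v v > 0" if "v \<noteq> 0" for v
    proof -
      have "fst v \<noteq> 0 \<or> snd v \<noteq> 0" using that by (auto simp: prod_eq_iff)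
      then show ?thesis
        unfolding met' using A.metric_posdef[OF i q(1), of "fst v"] A.metric_posdef[OF j q(2), of "snd v"]
          A.metric_nonneg[OF i q(1), of "fst v"] A.metric_nonneg[OF j q(2), of "snd v"] by fastforce
    qed
  next
    fix p v w assume "p \<in> chart_ix ?P"
    then obtain i j where p: "p = (i, j)" and i: "i \<in> chart_ix M" and j: "j \<in> chart_ix M" by (auto simp: ix)
    have "continuous_on (chart_img M i \<times> chart_img M j)
       (\<lambda>q. metric M i (chart_inv M i (fst q)) (fst v) (fst w) + metric M j (chart_inv M j (snd q)) (snd v) (snd w))"
      by (intro continuous_on_add A.metric_cont_compose i j continuous_intros) auto
    then show "continuous_on (chart_img ?P p) (\<lambda>q. metric ?P p (chart_inv ?P p q) v w)"
      unfolding p chart_img_prod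
    proof (rule continuous_on_eq)
      fix q assume "q \<in> chart_img M i \<times> chart_img M j"
      then have "chart_inv ?P (i, j) q = (chart_inv M i (fst q), chart_inv M j (snd q))"
        using chart_inv_prod[OF i j, of "fst q" "snd q"] by (auto simp: mem_Times_iff)
      then show "metric M i (chart_inv M i (fst q)) (fst v) (fst w) + metric M j (chart_inv M j (snd q)) (snd v) (snd w)
          = metric ?P (i, j) (chart_inv ?P (i, j) q) v w"
        using met[of i j _ _ "fst v" "snd v" "fst w" "snd w"] by simp
    qed
  next
    show "(\<Union>p\<in>chart_ix ?P. chart_dom ?P p) = UNIV"
    proof -
      have "\<exists>p\<in>chart_ix ?P. q \<in> chart_dom ?P p" for q
      proof (cases q)
        case (Pair x y)
        then show ?thesis using A.chart_at[of x] A.chart_at[of y]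
          by (intro bexI[of _ "(chart_at M x, chart_at M y)"]) (auto simp: ix dom)
      qed
      then show ?thesis by blast
    qed
    show "compact (UNIV :: ('m \<times> 'm) set)" using compact_Times[OF cpt cpt] by simp
    fix p q and z :: "'m \<times> 'm" and v w
    assume pq: "p \<in> chart_ix ?P" "q \<in> chart_ix ?P" "z \<in> chart_dom ?P p \<inter> chart_dom ?P q"
    obtain i j k l x y where e: "p = (i, j)" "q = (k, l)" "z = (x, y)" by (metis surj_pair)
    have h: "i \<in> chart_ix M" "k \<in> chart_ix M" "x \<in> chart_dom M i \<inter> chart_dom M k"
      "j \<in> chart_ix M" "l \<in> chart_ix M" "y \<in> chart_dom M j \<inter> chart_dom M l"
      using pq by (auto simp: e ix dom)
    have td: "trans_deriv ?P p q z a = (trans_deriv M i k x (fst a), trans_deriv M j l y (snd a))" for a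
      unfolding e using trans_deriv_prod[OF h, of "fst a" "snd a"] by simp
    have "metric ?P p z v w = metric M i x (fst v) (fst w) + metric M j y (snd v) (snd w)"
      unfolding e using met[of i j x y "fst v" "snd v" "fst w" "snd w"] by simp
    also have "\<dots> = metric M k x (trans_deriv M i k x (fst v)) (trans_deriv M i k x (fst w))
        + metric M l y (trans_deriv M j l y (snd v)) (trans_deriv M j l y (snd w))"
      using metric_transform[OF h(1-3), of "fst v" "fst w"] metric_transform[OF h(4-6), of "snd v" "snd w"] by simp
    also have "\<dots> = metric ?P q z (trans_deriv ?P p q z v) (trans_deriv ?P p q z w)"
      unfolding td unfolding e met ..
    finally show "metric ?P p z v w = metric ?P q z (trans_deriv ?P p q z v) (trans_deriv ?P p q z w)" .
  qed
qed

end

text \<open>The matrices on the segment from the unit matrix to the Gram matrix are positive definite, hence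
  invertible, so the determinant keeps its sign along the segment.\<close>

lemma det_gram_pos:
  fixes B :: "real ^ 'n \<Rightarrow> real ^ 'n \<Rightarrow> real"
  assumes B: "bilinear B" and pos: "\<And>v. v \<noteq> 0 \<Longrightarrow> B v v > 0"
  shows "det (\<chi> a b. B (axis a 1) (axis b 1)) > 0"
proof (rule ccontr)
  define A where "A t = (\<chi> a b. (1 - t) * (if a = b then 1 else 0) + t * B (axis a 1) (axis b 1))" for t :: real
  have quad: "x \<bullet> (A t *v x) = (1 - t) * (x \<bullet> x) + t * B x x" for t x
  proof -
    have "B x x = B (\<Sum>a\<in>UNIV. (x $ a) *\<^sub>R axis a 1) (\<Sum>b\<in>UNIV. (x $ b) *\<^sub>R axis b 1)"
      using basis_expansion[of x] by (simp add: scalar_mult_eq_scaleR)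
    also have "\<dots> = (\<Sum>a\<in>UNIV. \<Sum>b\<in>UNIV. B ((x $ a) *\<^sub>R axis a 1) ((x $ b) *\<^sub>R axis b 1))"
      by (simp add: bilinear_sum[OF B] sum.cartesian_product)
    also have "\<dots> = (\<Sum>a\<in>UNIV. \<Sum>b\<in>UNIV. x $ a * (x $ b * B (axis a 1) (axis b 1)))"
      by (simp add: bilinear_lmul[OF B] bilinear_rmul[OF B] mult.left_commute)
    finally have 1: "B x x = (\<Sum>a\<in>UNIV. \<Sum>b\<in>UNIV. x $ a * (x $ b * B (axis a 1) (axis b 1)))" .
    have "x \<bullet> (A t *v x) = (\<Sum>a\<in>UNIV. x $ a * (\<Sum>b\<in>UNIV. ((1 - t) * (if a = b then 1 else 0) + t * B (axis a 1) (axis b 1)) * x $ b))"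
      by (simp add: inner_vec_def matrix_vector_mult_def A_def)
    also have "\<dots> = (\<Sum>a\<in>UNIV. (1 - t) * (x $ a * x $ a) + t * (\<Sum>b\<in>UNIV. x $ a * (x $ b * B (axis a 1) (axis b 1))))"
    proof (rule sum.cong[OF refl])
      fix a
      have "(\<Sum>b\<in>UNIV. ((1 - t) * (if a = b then 1 else 0) + t * B (axis a 1) (axis b 1)) * x $ b)
          = (\<Sum>b\<in>UNIV. (if a = b then (1 - t) * x $ b else 0)) + (\<Sum>b\<in>UNIV. t * (x $ b * B (axis a 1) (axis b 1)))"
        unfolding sum.distrib[symmetric] by (rule sum.cong) (auto simp: algebra_simps)
      also have "(\<Sum>b\<in>UNIV. (if a = b then (1 - t) * x $ b else 0)) = (1 - t) * x $ a" by simp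
      finally show "x $ a * (\<Sum>b\<in>UNIV. ((1 - t) * (if a = b then 1 else 0) + t * B (axis a 1) (axis b 1)) * x $ b)
          = (1 - t) * (x $ a * x $ a) + t * (\<Sum>b\<in>UNIV. x $ a * (x $ b * B (axis a 1) (axis b 1)))"
        by (simp add: sum_distrib_left distrib_left mult_ac)
    qed
    also have "\<dots> = (1 - t) * (x \<bullet> x) + t * B x x"
      unfolding 1 by (simp add: sum.distrib sum_distrib_left inner_vec_def)
    finally show ?thesis .
  qed
  have nz: "det (A t) \<noteq> 0" if t: "0 \<le> t" "t \<le> 1" for t
  proof -
    have "x = 0" if "A t *v x = 0" for x
    proof (rule ccontr)
      assume x: "x \<noteq> 0"
      have "0 < (1 - t) * (x \<bullet> x) + t * B x x"
      proof (cases "t = 0")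
        case True
        with x show ?thesis by simp
      next
        case False
        then have "0 < t * B x x" using t pos[OF x] by simp
        moreover have "0 \<le> (1 - t) * (x \<bullet> x)" using t by simp
        ultimately show ?thesis by linarith
      qed
      with quad[of x t] that show False by simp
    qed
    then obtain A' where "A' ** A t = mat 1" using matrix_left_invertible_ker by blast
    then have "invertible (A t)" using invertible_left_inverse by blast
    then show ?thesis by (simp add: invertible_det_nz)
  qed
  have cont: "continuous_on {0..1} (\<lambda>t. det (A t))"
    unfolding det_def A_def by (simp, intro continuous_intros)
  have "A 0 = mat 1" by (simp add: A_def mat_def vec_eq_iff)
  then have 0: "det (A 0) = 1" by simp
  have 1: "A 1 = (\<chi> a b. B (axis a 1) (axis b 1))" by (simp add: A_def vec_eq_iff)
  assume "\<not> ?thesis"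
  then have "det (A 1) \<le> 0" by (simp add: 1)
  then obtain t where "0 \<le> t" "t \<le> 1" "det (A t) = 0"
    using IVT2'[of "\<lambda>t. det (A t)" 1 0 0] cont 0 by auto
  with nz show False by blast
qed

locale riemannian_volume_space = riemannian_manifold M
  for M :: "('i, 'm::{t2_space, second_countable_topology}, real ^ 'n) riem" +
  fixes m :: "'m measure"
  assumes cpt: "compact (UNIV :: 'm set)"
    and volume: "riemannian_volume M m"

sublocale riemannian_volume_space \<subseteq> riemannian_atlas M
  by (rule riemannian_atlas_compact[OF cpt])

context riemannian_volume_space
begin

lemma sets_m [measurable_cong]: "sets m = sets borel"
  using volume by (simp add: riemannian_volume_def)

lemma space_m [simp]: "space m = UNIV"
  using sets_eq_imp_space_eq[OF sets_m] by simp

definition vol_density :: "'i \<Rightarrow> real ^ 'n \<Rightarrow> real" where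
  "vol_density i u = sqrt (det (\<chi> a b. metric M i (chart_inv M i u) (axis a 1) (axis b 1)))"

lemma vol_density_pos:
  assumes "i \<in> chart_ix M" "u \<in> chart_img M i"
  shows "vol_density i u > 0"
  unfolding vol_density_def
  using det_gram_pos[OF metric_bilin[OF assms] metric_posdef[OF assms]] by simp

lemma vol_density_cont:
  assumes "i \<in> chart_ix M"
  shows "continuous_on (chart_img M i) (vol_density i)"
  unfolding vol_density_def det_def using metric_cont[OF assms]
  by (intro continuous_intros) auto

lemma vol_density_measurable:
  assumes "i \<in> chart_ix M"
  shows "vol_density i \<in> borel_measurable (restrict_space borel (chart_img M i))"
  by (rule borel_measurable_continuous_on_restrict[OF vol_density_cont[OF assms]])

lemma coord_image:
  assumes "i \<in> chart_ix M"
  shows "coord M i ` (A \<inter> chart_dom M i) = {u \<in> chart_img M i. chart_inv M i u \<in> A}"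
proof (intro equalityI subsetI)
  fix u assume "u \<in> coord M i ` (A \<inter> chart_dom M i)"
  then show "u \<in> {u \<in> chart_img M i. chart_inv M i u \<in> A}"
    using coord_in[OF assms] chart_inv_coord[OF assms] by auto
next
  fix u assume "u \<in> {u \<in> chart_img M i. chart_inv M i u \<in> A}"
  then show "u \<in> coord M i ` (A \<inter> chart_dom M i)"
    using chart_inv_in[OF assms] coord_chart_inv[OF assms] by (intro image_eqI[of _ _ "chart_inv M i u"]) auto
qed

lemma emeasure_chart:
  assumes i: "i \<in> chart_ix M" and A: "A \<in> sets borel"
  shows "emeasure m (A \<inter> chart_dom M i) =
    (\<integral>\<^sup>+u. ennreal (vol_density i u) * indicator {u \<in> chart_img M i. chart_inv M i u \<in> A} u \<partial>lborel)"
proof -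
  have "A \<inter> chart_dom M i \<in> sets borel" using A open_dom[OF i] by auto
  then show ?thesis
    using volume i by (simp add: riemannian_volume_def vol_density_def coord_image[OF i, symmetric])
qed

lemma nn_integral_chart:
  assumes i: "i \<in> chart_ix M" and F: "F \<in> borel_measurable borel"
  shows "(\<integral>\<^sup>+x. F x * indicator (chart_dom M i) x \<partial>m) =
    (\<integral>\<^sup>+u. ennreal (vol_density i u) * F (chart_inv M i u) * indicator (chart_img M i) u \<partial>lborel)"
proof -
  let ?N = "restrict_space lborel (chart_img M i)"
  have img: "chart_img M i \<in> sets borel" using open_img[OF i] by simp
  have setsN: "sets ?N = sets (restrict_space borel (chart_img M i))" by (simp add: sets_restrict_space)
  have [measurable]: "vol_density i \<in> borel_measurable ?N"
    using vol_density_measurable[OF i] by (simp add: measurable_cong_sets[OF setsN refl])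
  have inv[measurable]: "chart_inv M i \<in> borel_measurable ?N"
    using chart_inv_measurable[OF i] by (simp add: measurable_cong_sets[OF setsN refl])
  have [measurable]: "chart_dom M i \<in> sets borel" using open_dom[OF i] by simp
  note F[measurable]
  have eq: "density m (indicator (chart_dom M i)) = distr (density ?N (vol_density i)) borel (chart_inv M i)"
  proof (rule measure_eqI)
    fix A assume "A \<in> sets (density m (indicator (chart_dom M i)))"
    then have A[measurable]: "A \<in> sets borel" by (simp add: sets_m)
    have "emeasure (density m (indicator (chart_dom M i))) A = (\<integral>\<^sup>+x. indicator (A \<inter> chart_dom M i) x \<partial>m)"
      by (subst emeasure_density) (auto simp: sets_m indicator_inter_arith mult.commute simp del: nn_integral_indicator intro!: nn_integral_cong)
    also have "\<dots> = emeasure m (A \<inter> chart_dom M i)"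
      by (rule nn_integral_indicator) (simp add: sets_m)
    also have "\<dots> = (\<integral>\<^sup>+u. ennreal (vol_density i u) * indicator A (chart_inv M i u) * indicator (chart_img M i) u \<partial>lborel)"
      unfolding emeasure_chart[OF i A] by (rule nn_integral_cong) (auto simp: indicator_def)
    also have "\<dots> = (\<integral>\<^sup>+u. ennreal (vol_density i u) * indicator A (chart_inv M i u) \<partial>?N)"
      using img by (simp add: nn_integral_restrict_space)
    also have "\<dots> = (\<integral>\<^sup>+u. ennreal (vol_density i u) * indicator (chart_inv M i -` A \<inter> space ?N) u \<partial>?N)"
      by (rule nn_integral_cong) (auto simp: indicator_def)
    also have "\<dots> = emeasure (density ?N (vol_density i)) (chart_inv M i -` A \<inter> space ?N)"
      by (rule emeasure_density[symmetric]) (simp, rule measurable_sets[OF inv A])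
    also have "\<dots> = emeasure (distr (density ?N (vol_density i)) borel (chart_inv M i)) A"
      by (subst emeasure_distr) simp_all
    finally show "emeasure (density m (indicator (chart_dom M i))) A = emeasure (distr (density ?N (vol_density i)) borel (chart_inv M i)) A" .
  qed (simp add: sets_m)
  have "(\<integral>\<^sup>+x. F x * indicator (chart_dom M i) x \<partial>m) = (\<integral>\<^sup>+x. F x \<partial>density m (indicator (chart_dom M i)))"
    by (subst nn_integral_density) (auto simp: mult.commute)
  also have "\<dots> = (\<integral>\<^sup>+u. ennreal (vol_density i u) * F (chart_inv M i u) \<partial>?N)"
    unfolding eq by (simp add: nn_integral_distr nn_integral_density)
  also have "\<dots> = (\<integral>\<^sup>+u. ennreal (vol_density i u) * F (chart_inv M i u) * indicator (chart_img M i) u \<partial>lborel)"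
    using img by (simp add: nn_integral_restrict_space)
  finally show ?thesis .
qed

text \<open>On a compact piece of a chart the density of the volume is bounded below, hence Lebesgue measure is
  dominated by the volume and integrability on the manifold passes to the chart.\<close>

lemma chart_le_volume:
  assumes i: "i \<in> chart_ix M" and K: "compact K" "K \<subseteq> chart_img M i"
  obtains C where "C > 0" "\<And>F. F \<in> borel_measurable borel \<Longrightarrow>
    (\<integral>\<^sup>+u. F (chart_inv M i u) * indicator K u \<partial>lborel) \<le> ennreal C * (\<integral>\<^sup>+x. F x \<partial>m)"
proof -
  have "\<exists>c>0. \<forall>u\<in>K. c \<le> vol_density i u"
  proof (cases "K = {}")
    case False
    have "continuous_on K (vol_density i)" by (rule continuous_on_subset[OF vol_density_cont[OF i] K(2)])
    then obtain u where u: "u \<in> K" "\<And>v. v \<in> K \<Longrightarrow> vol_density i u \<le> vol_density i v"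
      using continuous_attains_inf[OF K(1) False] by blast
    then show ?thesis using vol_density_pos[OF i, of u] K(2) by (intro exI[of _ "vol_density i u"]) auto
  qed (auto intro: exI[of _ 1])
  then obtain c where c: "c > 0" "\<And>u. u \<in> K \<Longrightarrow> c \<le> vol_density i u" by blast
  have "(\<integral>\<^sup>+u. F (chart_inv M i u) * indicator K u \<partial>lborel) \<le> ennreal (1 / c) * (\<integral>\<^sup>+x. F x \<partial>m)"
    if F: "F \<in> borel_measurable borel" for F
  proof -
    have [measurable]: "F \<in> borel_measurable borel" "chart_dom M i \<in> sets borel" using F open_dom[OF i] by auto
    have meas: "(\<lambda>u. ennreal (vol_density i u) * F (chart_inv M i u) * indicator (chart_img M i) u) \<in> borel_measurable lborel"
    proof -
      have "(\<lambda>u. ennreal (vol_density i u) * F (chart_inv M i u)) \<in> borel_measurable (restrict_space borel (chart_img M i))"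
        using vol_density_measurable[OF i] borel_measurable_chart_inv[OF F i] by measurable
      then show ?thesis using open_img[OF i]
        by (subst (asm) borel_measurable_restrict_space_iff_ennreal) auto
    qed
    have "(\<integral>\<^sup>+u. F (chart_inv M i u) * indicator K u \<partial>lborel)
        \<le> (\<integral>\<^sup>+u. ennreal (1 / c) * (ennreal (vol_density i u) * F (chart_inv M i u) * indicator (chart_img M i) u) \<partial>lborel)"
    proof (rule nn_integral_mono)
      fix u
      show "F (chart_inv M i u) * indicator K u \<le> ennreal (1 / c) * (ennreal (vol_density i u) * F (chart_inv M i u) * indicator (chart_img M i) u)"
      proof (cases "u \<in> K")
        case True
        have "1 = ennreal (1 / c) * ennreal c" using c(1) by (simp add: ennreal_mult[symmetric])
        also have "\<dots> \<le> ennreal (1 / c) * ennreal (vol_density i u)" using c(2)[OF True] by (intro mult_left_mono ennreal_leI) auto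
        finally have "1 * F (chart_inv M i u) \<le> ennreal (1 / c) * ennreal (vol_density i u) * F (chart_inv M i u)"
          by (rule mult_right_mono) simp
        with True K(2) show ?thesis by (auto simp: mult.assoc)
      qed simp
    qed
    also have "\<dots> = ennreal (1 / c) * (\<integral>\<^sup>+x. F x * indicator (chart_dom M i) x \<partial>m)"
      using meas by (subst nn_integral_cmult) (auto simp: nn_integral_chart[OF i F])
    also have "\<dots> \<le> ennreal (1 / c) * (\<integral>\<^sup>+x. F x \<partial>m)"
      by (intro mult_left_mono nn_integral_mono) (auto simp: indicator_def)
    finally show ?thesis .
  qed
  with c(1) show ?thesis by (intro that[of "1 / c"]) auto
qed

lemma null_chartsI:
  assumes i: "i \<in> chart_ix M" and ae: "AE u in lborel. u \<in> chart_img M i \<longrightarrow> P (chart_inv M i u)"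
  shows "AE x in m. x \<in> chart_dom M i \<longrightarrow> P x"
proof -
  obtain N where N: "{u \<in> space lborel. \<not> (u \<in> chart_img M i \<longrightarrow> P (chart_inv M i u))} \<subseteq> N"
    "emeasure lborel N = 0" "N \<in> sets lborel"
    using AE_E[OF ae] by blast
  define A where "A = coord M i -` N \<inter> chart_dom M i"
  have "coord M i \<in> measurable (restrict_space borel (chart_dom M i)) borel"
    using coord_measurable[OF i] by (simp add: measurable_restrict_space2_iff)
  then have A: "A \<in> sets borel" "A \<subseteq> chart_dom M i"
    using measurable_sets[of "coord M i" "restrict_space borel (chart_dom M i)" borel N] N(3) open_dom[OF i]
    by (auto simp: A_def sets_restrict_space_iff space_restrict_space Int_commute)
  have "emeasure m (A \<inter> chart_dom M i) = (\<integral>\<^sup>+u. ennreal (vol_density i u) * indicator {u \<in> chart_img M i. chart_inv M i u \<in> A} u \<partial>lborel)"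
    by (rule emeasure_chart[OF i A(1)])
  also have "\<dots> = (\<integral>\<^sup>+u. 0 \<partial>(lborel :: (real ^ 'n) measure))"
  proof (rule nn_integral_cong_AE)
    have "N \<in> null_sets lborel" using N by (auto simp: null_sets_def)
    then have "AE u in lborel. u \<notin> N" by (rule AE_not_in)
    then show "AE u in lborel. ennreal (vol_density i u) * indicator {u \<in> chart_img M i. chart_inv M i u \<in> A} u = 0"
      by eventually_elim (auto simp: A_def indicator_def coord_chart_inv[OF i])
  qed
  finally have "A \<in> null_sets m" using A by (auto simp: null_sets_def sets_m Int_absorb2)
  then show ?thesis
    by (rule AE_I') (use N(1) in \<open>auto simp: A_def chart_inv_coord[OF i] coord_in[OF i] subset_iff\<close>)
qed

lemma AE_chart_inv:
  assumes i: "i \<in> chart_ix M" and ae: "AE x in m. P x"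
  shows "AE u in lborel. u \<in> chart_img M i \<longrightarrow> P (chart_inv M i u)"
proof -
  obtain N where N: "{x \<in> space m. \<not> P x} \<subseteq> N" "emeasure m N = 0" "N \<in> sets m"
    using AE_E[OF ae] by blast
  then have Nb: "N \<in> sets borel" by (simp add: sets_m)
  let ?S = "{u \<in> chart_img M i. chart_inv M i u \<in> N}"
  have S[measurable]: "?S \<in> sets borel"
    using measurable_sets[OF chart_inv_measurable[OF i] Nb] open_img[OF i]
    by (auto simp: sets_restrict_space_iff space_restrict_space vimage_def Int_def conj_commute)
  have vd[measurable]: "(\<lambda>u. ennreal (vol_density i u) * indicator ?S u) \<in> borel_measurable lborel"
  proof -
    have "(\<lambda>u. ennreal (vol_density i u)) \<in> borel_measurable (restrict_space borel (chart_img M i))"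
      using vol_density_measurable[OF i] by measurable
    then have [measurable]: "(\<lambda>u. ennreal (vol_density i u) * indicator (chart_img M i) u) \<in> borel_measurable borel"
      using open_img[OF i] by (subst (asm) borel_measurable_restrict_space_iff_ennreal) auto
    have "(\<lambda>u. ennreal (vol_density i u) * indicator (chart_img M i) u * indicator ?S u) \<in> borel_measurable borel"
      by measurable
    also have "(\<lambda>u. ennreal (vol_density i u) * indicator (chart_img M i) u * indicator ?S u) = (\<lambda>u. ennreal (vol_density i u) * indicator ?S u)"
      by (auto simp: indicator_def fun_eq_iff)
    finally show ?thesis by simp
  qed
  have "emeasure m (N \<inter> chart_dom M i) \<le> emeasure m N"
    using N(3) by (intro emeasure_mono) auto
  then have "(\<integral>\<^sup>+u. ennreal (vol_density i u) * indicator ?S u \<partial>lborel) = 0"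
    using emeasure_chart[OF i Nb] N(2) by simp
  then have "AE u in lborel. ennreal (vol_density i u) * indicator ?S u = 0"
    by (subst (asm) nn_integral_0_iff_AE) auto
  then show ?thesis
  proof eventually_elim
    case (elim u)
    show ?case
    proof
      assume u: "u \<in> chart_img M i"
      with elim vol_density_pos[OF i u] have "chart_inv M i u \<notin> N" by (auto simp: indicator_def split: if_splits)
      then show "P (chart_inv M i u)" using N(1) by auto
    qed
  qed
qed

lemma finite_measure_m: "finite_measure m"
proof
  have "\<exists>N. open N \<and> x \<in> N \<and> emeasure m N < \<infinity>" for x
  proof -
    define i where "i = chart_at M x"
    have i: "i \<in> chart_ix M" and x: "x \<in> chart_dom M i" using chart_at by (auto simp: i_def)
    obtain r where r: "r > 0" "cball (coord M i x) r \<subseteq> chart_img M i"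
      using open_contains_cball coord_in[OF i x] open_img[OF i] by metis
    let ?K = "cball (coord M i x) r"
    have "continuous_on ?K (vol_density i)" by (rule continuous_on_subset[OF vol_density_cont[OF i] r(2)])
    then obtain C where C: "\<And>u. u \<in> ?K \<Longrightarrow> vol_density i u \<le> C"
      using continuous_attains_sup[of ?K "vol_density i"] r(1) by (metis cball_eq_empty compact_cball not_less_iff_gr_or_eq)
    define N where "N = coord M i -` ball (coord M i x) r \<inter> chart_dom M i"
    have "continuous_on (chart_dom M i) (coord M i)" using homeo[OF i] by (simp add: homeomorphism_def)
    then have N: "open N" unfolding N_def
      using open_dom[OF i] continuous_open_preimage[of "chart_dom M i" "coord M i" "ball (coord M i x) r"] by (simp add: Int_commute)
    have "emeasure m (N \<inter> chart_dom M i) = (\<integral>\<^sup>+u. ennreal (vol_density i u) * indicator {u \<in> chart_img M i. chart_inv M i u \<in> N} u \<partial>lborel)"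
      using N by (intro emeasure_chart[OF i]) auto
    also have "\<dots> \<le> (\<integral>\<^sup>+u. ennreal C * indicator ?K u \<partial>lborel)"
    proof (rule nn_integral_mono)
      fix u
      show "ennreal (vol_density i u) * indicator {u \<in> chart_img M i. chart_inv M i u \<in> N} u \<le> ennreal C * indicator ?K u"
        by (auto simp: N_def indicator_def coord_chart_inv[OF i] intro!: ennreal_leI C)
    qed
    also have "\<dots> = ennreal C * emeasure lborel ?K"
      by (rule nn_integral_cmult_indicator) simp
    also have "\<dots> < \<infinity>" using emeasure_bounded_finite[of ?K] by (simp add: ennreal_mult_less_top)
    finally have "emeasure m N < \<infinity>" by (simp add: N_def Int_absorb2 Int_assoc)
    moreover have "x \<in> N" using x r by (simp add: N_def)
    ultimately show ?thesis using N by blast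
  qed
  then obtain N where N: "\<And>x. open (N x)" "\<And>x. x \<in> N x" "\<And>x. emeasure m (N x) < \<infinity>" by metis
  have "UNIV \<subseteq> (\<Union>x\<in>UNIV. N x)" using N(2) by blast
  with compactE_image[OF cpt, of UNIV N] N(1)
  obtain X where X: "finite X" "UNIV \<subseteq> (\<Union>x\<in>X. N x)" by metis
  have "emeasure m (space m) = emeasure m (\<Union>x\<in>X. N x)" using X(2) by (simp add: top.extremum_unique)
  also have "\<dots> \<le> (\<Sum>x\<in>X. emeasure m (N x))"
    using N X by (intro emeasure_subadditive_finite) (auto simp: sets_m)
  also have "\<dots> < \<infinity>" using X N(3) by simp
  finally show "emeasure m (space m) \<noteq> \<infinity>" by simp
qed

lemma open_nonnull:
  assumes U: "open U" "x \<in> U" and ae: "AE y in m. y \<in> U \<longrightarrow> P y"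
  shows "\<exists>y\<in>U. P y"
proof -
  define i where "i = chart_at M x"
  have i: "i \<in> chart_ix M" and x: "x \<in> chart_dom M i" using chart_at by (auto simp: i_def)
  have "continuous_on (chart_img M i) (chart_inv M i)" using homeo[OF i] by (simp add: homeomorphism_def)
  then have "open (chart_img M i \<inter> chart_inv M i -` U)"
    by (rule continuous_open_preimage[OF _ open_img[OF i] U(1)])
  moreover have "coord M i x \<in> chart_img M i \<inter> chart_inv M i -` U"
    using U(2) coord_in[OF i x] chart_inv_coord[OF i x] by simp
  ultimately obtain r where r: "r > 0" "ball (coord M i x) r \<subseteq> chart_img M i \<inter> chart_inv M i -` U"
    using open_contains_ball by metis
  have "AE u in lborel. u \<in> ball (coord M i x) r \<longrightarrow> P (chart_inv M i u)"
    using AE_chart_inv[OF i ae] by eventually_elim (use r(2) in blast)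
  from AE_ball_imp_ex[OF r(1) this] show ?thesis using r(2) by blast
qed

end

sublocale riemannian_volume_space \<subseteq> finite_measure m
  by (rule finite_measure_m)

sublocale riemannian_volume_space \<subseteq> riemannian_measure_atlas M m
  by unfold_locales (rule sets_m null_chartsI; assumption)+

sublocale riemannian_volume_space \<subseteq> mm: pair_sigma_finite m m ..

sublocale riemannian_volume_space \<subseteq> Lm: pair_sigma_finite "lborel :: (real ^ 'n) measure" m ..

context riemannian_volume_space
begin

lemma sets_mm: "sets (m \<Otimes>\<^sub>M m) = sets borel"
  using sets_pair_measure_cong[OF sets_m sets_m] unfolding borel_prod .

text \<open>The predicate in the definition of the locale may fail to be measurable. The set where it fails
  is therefore enlarged in the chart to a Borel null set before Fubini's theorem is used in both factors.\<close>

lemma riemannian_measure_atlas_prod: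
  "riemannian_measure_atlas (prod_riem M M) (m \<Otimes>\<^sub>M m)"
proof -
  interpret P: riemannian_atlas "prod_riem M M" by (rule riemannian_atlas_prod[OF cpt])
  show ?thesis
  proof
    show "sets (m \<Otimes>\<^sub>M m) = sets borel" by (rule sets_mm)
    fix p P assume p: "p \<in> chart_ix (prod_riem M M)"
      and ae: "AE w in lborel. w \<in> chart_img (prod_riem M M) p \<longrightarrow> P (chart_inv (prod_riem M M) p w)"
    obtain i j where pij: "p = (i, j)" and i: "i \<in> chart_ix M" and j: "j \<in> chart_ix M"
      using p by (auto simp: prod_riem_def)
    \<comment> \<open>Replace the failure set by a Borel null set, whose slices are measurable.\<close>
    obtain N where N: "{w \<in> space lborel. \<not> (w \<in> chart_img (prod_riem M M) p \<longrightarrow> P (chart_inv (prod_riem M M) p w))} \<subseteq> N"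
      "emeasure lborel N = 0" "N \<in> sets lborel"
      using AE_E[OF ae] by blast
    define Q where "Q x y \<longleftrightarrow> (x \<in> chart_dom M i \<longrightarrow> y \<in> chart_dom M j \<longrightarrow> (coord M i x, coord M j y) \<notin> N)" for x y
    have "N \<in> null_sets lborel" using N by (auto simp: null_sets_def)
    then have "AE w in lborel. w \<notin> N" by (rule AE_not_in)
    then have "AE w in (lborel \<Otimes>\<^sub>M lborel). w \<notin> N" unfolding lborel_prod .
    then have "AE u in lborel. AE v in lborel. (u, v) \<notin> N" by (rule lborel_pair.AE_pair)
    then have "AE u in lborel. AE y in m. y \<in> chart_dom M j \<longrightarrow> (u, coord M j y) \<notin> N"
    proof eventually_elim
      case (elim u)
      have "AE v in lborel. v \<in> chart_img M j \<longrightarrow> (u, coord M j (chart_inv M j v)) \<notin> N"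
        using elim by eventually_elim (simp add: coord_chart_inv[OF j])
      then show ?case by (rule null_chartsI[OF j])
    qed
    then have "AE u in lborel. u \<in> chart_img M i \<longrightarrow> (AE y in m. y \<in> chart_dom M j \<longrightarrow> (coord M i (chart_inv M i u), coord M j y) \<notin> N)"
      by eventually_elim (simp add: coord_chart_inv[OF i])
    from null_chartsI[OF i this]
    have "AE x in m. AE y in m. Q x y"
      by eventually_elim (auto simp: Q_def elim: eventually_mono)
    moreover have "{z \<in> space (m \<Otimes>\<^sub>M m). Q (fst z) (snd z)} \<in> sets (m \<Otimes>\<^sub>M m)"
    proof -
      have "coord (prod_riem M M) p \<in> measurable (restrict_space borel (chart_dom (prod_riem M M) p)) borel"
        using P.coord_measurable[OF p] by (simp add: measurable_restrict_space2_iff)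
      from measurable_sets[OF this, of N] N(3)
      have "coord (prod_riem M M) p -` N \<inter> chart_dom (prod_riem M M) p \<in> sets (restrict_space borel (chart_dom (prod_riem M M) p))"
        by (simp add: space_restrict_space)
      then have "coord (prod_riem M M) p -` N \<inter> chart_dom (prod_riem M M) p \<in> sets borel"
        using P.open_dom[OF p] by (simp add: sets_restrict_space_iff)
      then have "UNIV - (coord (prod_riem M M) p -` N \<inter> chart_dom (prod_riem M M) p) \<in> sets borel" by auto
      also have "UNIV - (coord (prod_riem M M) p -` N \<inter> chart_dom (prod_riem M M) p) = {z \<in> space (m \<Otimes>\<^sub>M m). Q (fst z) (snd z)}"
        by (auto simp: Q_def pij prod_riem_def space_pair_measure)
      finally show ?thesis by (simp add: sets_mm)
    qed
    ultimately have "AE z in m \<Otimes>\<^sub>M m. Q (fst z) (snd z)"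
      by (intro mm.AE_pair_measure) auto
    then show "AE z in m \<Otimes>\<^sub>M m. z \<in> chart_dom (prod_riem M M) p \<longrightarrow> P z"
    proof eventually_elim
      case (elim z)
      show ?case
      proof
        assume z: "z \<in> chart_dom (prod_riem M M) p"
        then have "coord (prod_riem M M) p z \<notin> N"
          using elim by (auto simp: Q_def pij prod_riem_def split: prod.splits)
        moreover have "coord (prod_riem M M) p z \<in> chart_img (prod_riem M M) p" by (rule P.coord_in[OF p z])
        ultimately have "P (chart_inv (prod_riem M M) p (coord (prod_riem M M) p z))" using N(1) by auto
        then show "P z" by (simp add: P.chart_inv_coord[OF p z])
      qed
    qed
  qed
qed

end

subsection \<open>Weak gradients on a compact manifold\<close>

lemma weak_dir_deriv_AE_cong:
  assumes w: "weak_dir_deriv S w f g"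
    and g': "locally_integrable_on g' S" and eq: "AE u in lborel. u \<in> S \<longrightarrow> g u = g' u"
  shows "weak_dir_deriv S w f g'"
  unfolding weak_dir_deriv_def
proof (intro conjI ballI)
  show "locally_integrable_on f S" "locally_integrable_on g' S" using w g' by (auto simp: weak_dir_deriv_def)
  have g: "locally_integrable_on g S" using w by (simp add: weak_dir_deriv_def)
  fix \<psi> assume \<psi>: "\<psi> \<in> test_functions S"
  have "(LINT u|lborel. g u * \<psi> u) = (LINT u|lborel. g' u * \<psi> u)"
  proof (rule integral_cong_AE)
    show "AE u in lborel. g u * \<psi> u = g' u * \<psi> u"
      using eq by eventually_elim (use test_function_eq_0[OF \<psi>] in force)
  qed (rule borel_measurable_integrable[OF locally_integrable_mult_test_function(1)[OF g \<psi>]]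
      borel_measurable_integrable[OF locally_integrable_mult_test_function(1)[OF g' \<psi>]])+
  then show "(LINT u:S|lborel. f u * frechet_derivative \<psi> (at u) w) = - (LINT u:S|lborel. g' u * \<psi> u)"
    using weak_dir_derivD[OF w \<psi>] set_integral_test_function[OF \<psi> order_refl] by simp
qed

lemma locally_integrable_on_zero: "locally_integrable_on (\<lambda>_. 0) S"
  by (simp add: locally_integrable_on_def set_integrable_def)

context riemannian_volume_space
begin

text \<open>On a connected space the local constants agree, because two of them are attained almost
  everywhere on the same nonempty open set, and such a set is not null.\<close>

lemma weak_gradient_zero_imp_const:
  assumes conn: "connected (UNIV :: 'm set)"
    and X: "weak_gradient M f X" and zero: "AE x in m. rinner M X X x = 0"
  shows "\<exists>c. AE x in m. f x = c"
proof -
  have vf: "vector_field M X" using X by (simp add: weak_gradient_def)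
  define A where "A c = {x. \<exists>N. open N \<and> x \<in> N \<and> (AE y in m. y \<in> N \<longrightarrow> f y = c)}" for c
  have openA: "open (A c)" for c
  proof -
    have "A c = \<Union>{N. open N \<and> (AE y in m. y \<in> N \<longrightarrow> f y = c)}" by (auto simp: A_def)
    then show ?thesis by (auto intro: open_Union)
  qed
  have local: "\<exists>c. x \<in> A c" for x
  proof -
    define i where "i = chart_at M x"
    have i: "i \<in> chart_ix M" and x: "x \<in> chart_dom M i" using chart_at by (auto simp: i_def)
    let ?S = "chart_img M i"
    have X0: "AE u in lborel. u \<in> ?S \<longrightarrow> X i (chart_inv M i u) = 0"
      using AE_chart_inv[OF i zero]
    proof eventually_elim
      case (elim u)
      show ?case
      proof
        assume u: "u \<in> ?S"
        note d = chart_inv_in[OF i u]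
        have "metric M i (chart_inv M i u) (X i (chart_inv M i u)) (X i (chart_inv M i u)) = 0"
          using elim u rinner_chart[OF vf vf i d] by simp
        then show "X i (chart_inv M i u) = 0" by (simp add: metric_at(3)[OF i d])
      qed
    qed
    have "weak_dir_deriv ?S w (\<lambda>u. f (chart_inv M i u)) (\<lambda>_. 0)" for w
    proof (rule weak_dir_deriv_AE_cong[OF weak_gradient_chart[OF X i] locally_integrable_on_zero])
      show "AE u in lborel. u \<in> ?S \<longrightarrow> metric M i (chart_inv M i u) (X i (chart_inv M i u)) w = 0"
        using X0 by eventually_elim (simp add: bilinear_lzero[OF metric_bilin[OF i]])
    qed
    from weak_dir_deriv_zero_locally_const[OF open_img[OF i] coord_in[OF i x] this]
    obtain r c where r: "r > 0" "ball (coord M i x) r \<subseteq> ?S"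
      and c: "AE u in lborel. u \<in> ball (coord M i x) r \<longrightarrow> f (chart_inv M i u) = c" by blast
    define N where "N = chart_dom M i \<inter> coord M i -` ball (coord M i x) r"
    have "continuous_on (chart_dom M i) (coord M i)" using homeo[OF i] by (simp add: homeomorphism_def)
    then have "open N" unfolding N_def
      by (rule continuous_open_preimage[OF _ open_dom[OF i] open_ball])
    moreover have "x \<in> N" using x r by (simp add: N_def)
    moreover have "AE u in lborel. u \<in> ?S \<longrightarrow> (coord M i (chart_inv M i u) \<in> ball (coord M i x) r \<longrightarrow> f (chart_inv M i u) = c)"
      using c by eventually_elim (simp add: coord_chart_inv[OF i])
    from null_chartsI[OF i this]
    have "AE y in m. y \<in> N \<longrightarrow> f y = c" by eventually_elim (simp add: N_def)
    ultimately show ?thesis unfolding A_def by blast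
  qed
  obtain c where c: "undefined \<in> A c" using local by blast
  have "A c = UNIV"
  proof -
    have disj: "c' = c" if x: "x \<in> A c" "x \<in> A c'" for x c'
    proof (rule ccontr)
      assume ne: "c' \<noteq> c"
      obtain N where N: "open N" "x \<in> N" "AE y in m. y \<in> N \<longrightarrow> f y = c"
        using x(1) by (auto simp: A_def)
      obtain N' where N': "open N'" "x \<in> N'" "AE y in m. y \<in> N' \<longrightarrow> f y = c'"
        using x(2) by (auto simp: A_def)
      from N(3) N'(3) have "AE y in m. y \<in> N \<inter> N' \<longrightarrow> False"
        by eventually_elim (use ne in auto)
      from open_nonnull[OF open_Int[OF N(1) N'(1)] IntI[OF N(2) N'(2)] this] show False by blast
    qed
    have "- A c = (\<Union>c'\<in>- {c}. A c')"
    proof (rule set_eqI)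
      fix x
      obtain c' where c': "x \<in> A c'" using local by blast
      show "x \<in> - A c \<longleftrightarrow> x \<in> (\<Union>c'\<in>- {c}. A c')"
      proof (cases "x \<in> A c")
        case True
        have "x \<notin> (\<Union>c'\<in>- {c}. A c')"
        proof
          assume "x \<in> (\<Union>c'\<in>- {c}. A c')"
          then obtain c'' where "c'' \<in> - {c}" "x \<in> A c''" by (rule UN_E)
          with disj[OF True, of c''] show False by simp
        qed
        with True show ?thesis by simp
      next
        case False
        then have "c' \<in> - {c}" using c' by auto
        then have "x \<in> (\<Union>c'\<in>- {c}. A c')" using c' by (rule UN_I)
        with False show ?thesis by simp
      qed
    qed
    then have "open (- A c)" using openA by (simp add: open_UN)
    from connectedD[OF conn openA[of c] this] c show ?thesis by blast
  qed
  then have "\<forall>x. \<exists>N. open N \<and> x \<in> N \<and> (AE y in m. y \<in> N \<longrightarrow> f y = c)" unfolding A_def by blast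
  then obtain N where N: "\<And>x. open (N x)" "\<And>x. x \<in> N x" "\<And>x. AE y in m. y \<in> N x \<longrightarrow> f y = c" by metis
  have "UNIV \<subseteq> (\<Union>x\<in>UNIV. N x)" using N(2) by blast
  with compactE_image[OF cpt, of UNIV N] N(1)
  obtain Y where Y: "finite Y" "UNIV \<subseteq> (\<Union>x\<in>Y. N x)" by metis
  have "AE y in m. \<forall>x\<in>Y. y \<in> N x \<longrightarrow> f y = c"
    by (rule AE_finite_allI[OF Y(1) N(3)])
  then have "AE y in m. f y = c" by eventually_elim (use Y(2) in blast)
  then show ?thesis by blast
qed

lemma vector_field_lincomb:
  assumes "vector_field M X" "vector_field M Y"
  shows "vector_field M (\<lambda>i x. a x *\<^sub>R X i x + b x *\<^sub>R Y i x)"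
  unfolding vector_field_def
proof (intro ballI)
  fix i j x assume h: "i \<in> chart_ix M" "j \<in> chart_ix M" "x \<in> chart_dom M i \<inter> chart_dom M j"
  interpret T: bounded_linear "trans_deriv M i j x" by (rule trans_deriv_linear[OF h])
  show "a x *\<^sub>R X j x + b x *\<^sub>R Y j x = trans_deriv M i j x (a x *\<^sub>R X i x + b x *\<^sub>R Y i x)"
  proof -
    have "X j x = trans_deriv M i j x (X i x)" "Y j x = trans_deriv M i j x (Y i x)"
      using assms h unfolding vector_field_def by blast+
    then show ?thesis by (simp only: T.add T.scaleR)
  qed
qed

lemma locally_integrable_chart_lincomb:
  assumes i: "i \<in> chart_ix M"
    and X: "locally_integrable_on X (chart_img M i)" and Y: "locally_integrable_on Y (chart_img M i)"
    and a: "a \<in> borel_measurable (restrict_space borel (chart_img M i))" "\<And>u. u \<in> chart_img M i \<Longrightarrow> \<bar>a u\<bar> \<le> C"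
    and b: "b \<in> borel_measurable (restrict_space borel (chart_img M i))" "\<And>u. u \<in> chart_img M i \<Longrightarrow> \<bar>b u\<bar> \<le> C"
  shows "locally_integrable_on (\<lambda>u. a u *\<^sub>R X u + b u *\<^sub>R Y u :: real ^ 'n) (chart_img M i)"
  unfolding locally_integrable_on_def
proof (intro allI impI)
  fix K assume K: "compact K" "K \<subseteq> chart_img M i"
  note [measurable] = a(1) b(1) locally_integrable_imp_measurable[OF open_img[OF i] X]
    locally_integrable_imp_measurable[OF open_img[OF i] Y]
  have "(\<lambda>u. a u *\<^sub>R X u + b u *\<^sub>R Y u) \<in> borel_measurable (restrict_space borel (chart_img M i))" by measurable
  then have m: "(\<lambda>u. indicator K u *\<^sub>R (a u *\<^sub>R X u + b u *\<^sub>R Y u)) \<in> borel_measurable lborel"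
    by (rule borel_measurable_indicator_compact[OF open_img[OF i] K])
  have "integrable lborel (\<lambda>u. C * norm (indicator K u *\<^sub>R X u) + C * norm (indicator K u *\<^sub>R Y u))"
    using X Y K by (intro Bochner_Integration.integrable_add integrable_mult_right integrable_norm)
      (auto simp: locally_integrable_on_def set_integrable_def)
  then show "set_integrable lborel K (\<lambda>u. a u *\<^sub>R X u + b u *\<^sub>R Y u)"
    unfolding set_integrable_def
  proof (rule Bochner_Integration.integrable_bound[OF _ m])
    show "AE u in lborel. norm (indicator K u *\<^sub>R (a u *\<^sub>R X u + b u *\<^sub>R Y u))
        \<le> norm (C * norm (indicator K u *\<^sub>R X u) + C * norm (indicator K u *\<^sub>R Y u))"
    proof (rule AE_I2)
      fix u
      show "norm (indicator K u *\<^sub>R (a u *\<^sub>R X u + b u *\<^sub>R Y u))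
        \<le> norm (C * norm (indicator K u *\<^sub>R X u) + C * norm (indicator K u *\<^sub>R Y u))"
      proof (cases "u \<in> K")
        case True
        then have u: "u \<in> chart_img M i" using K(2) by blast
        have "norm (a u *\<^sub>R X u + b u *\<^sub>R Y u) \<le> \<bar>a u\<bar> * norm (X u) + \<bar>b u\<bar> * norm (Y u)"
          using norm_triangle_ineq[of "a u *\<^sub>R X u" "b u *\<^sub>R Y u"] by simp
        also have "\<dots> \<le> C * norm (X u) + C * norm (Y u)"
          using a(2)[OF u] b(2)[OF u] by (intro add_mono mult_right_mono) auto
        finally show ?thesis using True by simp
      qed simp
    qed
  qed
qed

theorem weak_gradient_chain:
  assumes f: "weak_gradient M f X" and h: "weak_gradient M h Y"
    and B: "B \<ge> 0" "\<And>x. \<bar>h x\<bar> \<le> B"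
    and G1: "\<And>r v. ((\<lambda>r. G r v) has_real_derivative G1 r v) (at r)"
    and G2: "\<And>r v. ((\<lambda>v. G r v) has_real_derivative G2 r v) (at v)"
    and cont: "continuous_on UNIV (\<lambda>x. G (fst x) (snd x))"
      "continuous_on UNIV (\<lambda>x. G1 (fst x) (snd x))"
      "continuous_on UNIV (\<lambda>x. G2 (fst x) (snd x))"
    and C: "\<And>r v. \<bar>v\<bar> \<le> B \<Longrightarrow> \<bar>G r v\<bar> \<le> C" "\<And>r v. \<bar>v\<bar> \<le> B \<Longrightarrow> \<bar>G1 r v\<bar> \<le> C"
      "\<And>r v. \<bar>v\<bar> \<le> B \<Longrightarrow> \<bar>G2 r v\<bar> \<le> C"
  shows "weak_gradient M (\<lambda>x. G (f x) (h x)) (\<lambda>i x. G1 (f x) (h x) *\<^sub>R X i x + G2 (f x) (h x) *\<^sub>R Y i x)"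
proof (rule weak_gradientI)
  show "vector_field M (\<lambda>i x. G1 (f x) (h x) *\<^sub>R X i x + G2 (f x) (h x) *\<^sub>R Y i x)"
    using f h by (intro vector_field_lincomb) (auto simp: weak_gradient_def)
next
  fix i assume i: "i \<in> chart_ix M"
  let ?S = "chart_img M i" and ?inv = "chart_inv M i"
  have loc: "locally_integrable_on (\<lambda>u. f (?inv u)) ?S" "locally_integrable_on (\<lambda>u. h (?inv u)) ?S"
    "locally_integrable_on (\<lambda>u. X i (?inv u)) ?S" "locally_integrable_on (\<lambda>u. Y i (?inv u)) ?S"
    using f h i by (auto simp: weak_gradient_def)
  note meas = loc(1,2)[THEN locally_integrable_imp_measurable[OF open_img[OF i]]]
  show "locally_integrable_on (\<lambda>u. G1 (f (?inv u)) (h (?inv u)) *\<^sub>R X i (?inv u) + G2 (f (?inv u)) (h (?inv u)) *\<^sub>R Y i (?inv u)) ?S"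
  proof (rule locally_integrable_chart_lincomb[OF i loc(3,4)])
    show "(\<lambda>u. G1 (f (?inv u)) (h (?inv u))) \<in> borel_measurable (restrict_space borel ?S)"
      by (rule borel_measurable_continuous_Pair[OF meas cont(2)])
    show "(\<lambda>u. G2 (f (?inv u)) (h (?inv u))) \<in> borel_measurable (restrict_space borel ?S)"
      by (rule borel_measurable_continuous_Pair[OF meas cont(3)])
    show "\<bar>G1 (f (?inv u)) (h (?inv u))\<bar> \<le> C" "\<bar>G2 (f (?inv u)) (h (?inv u))\<bar> \<le> C" for u
      by (rule C(2)[OF B(2)], rule C(3)[OF B(2)])
  qed
  fix w
  have eq: "metric M i (?inv u) (G1 (f (?inv u)) (h (?inv u)) *\<^sub>R X i (?inv u) + G2 (f (?inv u)) (h (?inv u)) *\<^sub>R Y i (?inv u)) w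
      = G1 (f (?inv u)) (h (?inv u)) * metric M i (?inv u) (X i (?inv u)) w + G2 (f (?inv u)) (h (?inv u)) * metric M i (?inv u) (Y i (?inv u)) w"
    if "u \<in> ?S" for u
    using metric_bilin[OF i that] by (simp add: bilinear_ladd bilinear_lmul)
  have "weak_dir_deriv ?S w (\<lambda>u. G (f (?inv u)) (h (?inv u)))
      (\<lambda>u. G1 (f (?inv u)) (h (?inv u)) * metric M i (?inv u) (X i (?inv u)) w + G2 (f (?inv u)) (h (?inv u)) * metric M i (?inv u) (Y i (?inv u)) w)"
    by (rule weak_dir_deriv_chain[OF open_img[OF i] weak_gradient_chart[OF f i] weak_gradient_chart[OF h i] B(1) B(2) G1 G2 cont C])
  then show "weak_dir_deriv ?S w (\<lambda>u. G (f (?inv u)) (h (?inv u)))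
      (\<lambda>u. metric M i (?inv u) (G1 (f (?inv u)) (h (?inv u)) *\<^sub>R X i (?inv u) + G2 (f (?inv u)) (h (?inv u)) *\<^sub>R Y i (?inv u)) w)"
    by (rule weak_dir_deriv_restrict[OF _ order_refl refl]) (rule eq)
qed

text \<open>Inequality between arithmetic and geometric mean for \<open>g\<^sub>x\<close>, in a scaled form that replaces
  the Cauchy--Schwarz inequality for the norms.\<close>

lemma metric_AM_GM:
  assumes i: "i \<in> chart_ix M" and x: "x \<in> chart_dom M i" and a: "a > 0"
  shows "2 * \<bar>metric M i x v w\<bar> \<le> a * metric M i x v v + metric M i x w w / a"
proof -
  note bil = metric_at(1)[OF i x]
  have sym: "metric M i x w v = metric M i x v w" using metric_sym[OF i x] .
  have 1: "metric M i x (a *\<^sub>R v + s *\<^sub>R w) (a *\<^sub>R v + s *\<^sub>R w)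
      = a * a * metric M i x v v + 2 * s * a * metric M i x v w + s * s * metric M i x w w" for s
    by (simp add: bilinear_ladd[OF bil] bilinear_radd[OF bil] bilinear_lmul[OF bil] bilinear_rmul[OF bil] sym algebra_simps)
  have "0 \<le> a * a * metric M i x v v + 2 * 1 * a * metric M i x v w + 1 * 1 * metric M i x w w"
    "0 \<le> a * a * metric M i x v v + 2 * (- 1) * a * metric M i x v w + (- 1) * (- 1) * metric M i x w w"
    unfolding 1[symmetric] by (rule metric_at(2)[OF i x])+
  then have "a * (2 * \<bar>metric M i x v w\<bar>) \<le> a * (a * metric M i x v v + metric M i x w w / a)"
    using a by (auto simp: abs_if algebra_simps)
  then show ?thesis using a by simp
qed

lemma rinner_AM_GM: "2 * \<bar>rinner M X Y x\<bar> \<le> rinner M X X x + rinner M Y Y x"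
  unfolding rinner_def using metric_AM_GM[OF chart_at, of 1] by simp

lemma rinner_integrable:
  assumes X: "vector_field M X" "chart_measurable X" "integrable m (rinner M X X)"
    and Y: "vector_field M Y" "chart_measurable Y" "integrable m (rinner M Y Y)"
  shows "integrable m (rinner M X Y)"
proof (rule Bochner_Integration.integrable_bound)
  show "integrable m (\<lambda>x. rinner M X X x + rinner M Y Y x)" using X Y by simp
  show "rinner M X Y \<in> borel_measurable m"
    using rinner_measurable[OF X(1,2) Y(1,2)] by (simp add: measurable_cong_sets[OF sets_m refl])
  show "AE x in m. norm (rinner M X Y x) \<le> norm (rinner M X X x + rinner M Y Y x)"
  proof (rule AE_I2)
    fix x
    show "norm (rinner M X Y x) \<le> norm (rinner M X X x + rinner M Y Y x)"
      using rinner_AM_GM[of X Y x] rinner_nonneg[of X x] rinner_nonneg[of Y x] by simp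
  qed
qed

end

section \<open>The weak gradient of the convolution\<close>

lemma test_function_tensor:
  fixes \<psi> :: "'a::euclidean_space \<Rightarrow> real" and \<eta> :: "'b::euclidean_space \<Rightarrow> real"
  assumes \<psi>: "\<psi> \<in> test_functions S" and \<eta>: "\<eta> \<in> test_functions T"
  shows "(\<lambda>p. \<psi> (fst p) * \<eta> (snd p)) \<in> test_functions (S \<times> T)"
    and "frechet_derivative (\<lambda>p. \<psi> (fst p) * \<eta> (snd p)) (at (u, v)) (w, 0) = frechet_derivative \<psi> (at u) w * \<eta> v"
proof -
  have "smooth_on UNIV (\<lambda>p :: 'a \<times> 'b. \<psi> (fst p))" "smooth_on UNIV (\<lambda>p :: 'a \<times> 'b. \<eta> (snd p))"
    using smooth_on_compose_affine[OF _ bounded_linear_fst, of \<psi> 0] smooth_on_compose_affine[OF _ bounded_linear_snd, of \<eta> 0] \<psi> \<eta>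
    by (auto simp: test_functions_def)
  then have sm: "smooth_on UNIV (\<lambda>p. \<psi> (fst p) * \<eta> (snd p))" by (rule smooth_on_mult)
  let ?A = "closure {u. \<psi> u \<noteq> 0}" and ?B = "closure {v. \<eta> v \<noteq> 0}"
  have AB: "compact ?A" "?A \<subseteq> S" "compact ?B" "?B \<subseteq> T" using \<psi> \<eta> by (auto simp: test_functions_def)
  have "{p. \<psi> (fst p) * \<eta> (snd p) \<noteq> 0} \<subseteq> ?A \<times> ?B"
    using closure_subset[of "{u. \<psi> u \<noteq> 0}"] closure_subset[of "{v. \<eta> v \<noteq> 0}"] by auto
  then have sub: "closure {p. \<psi> (fst p) * \<eta> (snd p) \<noteq> 0} \<subseteq> ?A \<times> ?B"
    by (rule closure_minimal) (intro closed_Times closed_closure)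
  moreover have "compact (?A \<times> ?B)" using AB by (intro compact_Times)
  ultimately have "compact (closure {p. \<psi> (fst p) * \<eta> (snd p) \<noteq> 0})"
    using compact_Int_closed[of "?A \<times> ?B" "closure {p. \<psi> (fst p) * \<eta> (snd p) \<noteq> 0}"] by (simp add: Int_absorb1)
  moreover have "closure {p. \<psi> (fst p) * \<eta> (snd p) \<noteq> 0} \<subseteq> S \<times> T"
    using sub AB by (meson Sigma_mono order_trans)
  ultimately show "(\<lambda>p. \<psi> (fst p) * \<eta> (snd p)) \<in> test_functions (S \<times> T)"
    using sm by (simp add: test_functions_def)
  have "(\<psi> has_derivative frechet_derivative \<psi> (at u)) (at (fst (u, v)))"
    "(\<eta> has_derivative frechet_derivative \<eta> (at v)) (at (snd (u, v)))"
    using test_function_has_derivative \<psi> \<eta> by auto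
  from diff_chain_at[OF has_derivative_fst[OF has_derivative_ident] this(1)]
    diff_chain_at[OF has_derivative_snd[OF has_derivative_ident] this(2)]
  have "((\<lambda>p. \<psi> (fst p)) has_derivative (\<lambda>p. frechet_derivative \<psi> (at u) (fst p))) (at (u, v))"
    "((\<lambda>p. \<eta> (snd p)) has_derivative (\<lambda>p. frechet_derivative \<eta> (at v) (snd p))) (at (u, v))"
    by (simp_all add: o_def)
  from frechet_derivative_at[OF has_derivative_mult[OF this]]
  have "frechet_derivative (\<lambda>p. \<psi> (fst p) * \<eta> (snd p)) (at (u, v)) (w, 0)
      = \<psi> u * frechet_derivative \<eta> (at v) 0 + frechet_derivative \<psi> (at u) w * \<eta> v"
    by (simp add: fun_eq_iff)
  moreover have "frechet_derivative \<eta> (at v) 0 = 0"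
    by (rule linear_0[OF linear_frechet_derivative[OF test_function_differentiable[OF \<eta>]]])
  ultimately show "frechet_derivative (\<lambda>p. \<psi> (fst p) * \<eta> (snd p)) (at (u, v)) (w, 0) = frechet_derivative \<psi> (at u) w * \<eta> v"
    by simp
qed

text \<open>Testing with tensor products and varying the second factor shows that almost every slice of
  a weakly differentiable function satisfies the weak equation against one fixed test function.\<close>

lemma weak_dir_deriv_slice:
  fixes f g :: "'a::euclidean_space \<times> 'b::euclidean_space \<Rightarrow> real"
  assumes T: "open T" and w: "weak_dir_deriv (S \<times> T) (w, 0) f g" and \<psi>: "\<psi> \<in> test_functions S"
  shows "AE v in lborel. v \<in> T \<longrightarrow>
    (LINT u|lborel. f (u, v) * frechet_derivative \<psi> (at u) w) + (LINT u|lborel. g (u, v) * \<psi> u) = 0"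
proof -
  obtain K where K: "compact K" "K \<subseteq> S" "\<And>u. u \<notin> K \<Longrightarrow> \<psi> u = 0"
    "\<And>u w. u \<notin> K \<Longrightarrow> frechet_derivative \<psi> (at u) w = 0" using test_function_support[OF \<psi>] by metis
  obtain C where C: "\<And>u. \<bar>\<psi> u\<bar> \<le> C" using test_function_bounded[OF \<psi>] by metis
  obtain C' where C': "\<And>u. \<bar>frechet_derivative \<psi> (at u) w\<bar> \<le> C'" using test_function_deriv_bounded[OF \<psi>] by metis
  note [measurable] = borel_measurable_test_function[OF \<psi>] borel_measurable_test_function_deriv[OF \<psi>]
  have loc: "locally_integrable_on f (S \<times> T)" "locally_integrable_on g (S \<times> T)"
    using w by (auto simp: weak_dir_deriv_def)
  have slice: "locally_integrable_on (\<lambda>v. LINT u|lborel. h (u, v) * \<beta> u) T"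
    if h: "locally_integrable_on h (S \<times> T)" and [measurable]: "\<beta> \<in> borel_measurable borel"
      and \<beta>: "\<And>u. \<bar>\<beta> u\<bar> \<le> C" "\<And>u. u \<notin> K \<Longrightarrow> \<beta> u = 0" for h :: "'a \<times> 'b \<Rightarrow> real" and \<beta> C
    unfolding locally_integrable_on_def set_integrable_def
  proof (intro allI impI)
    fix L assume L: "compact L" "L \<subseteq> T"
    have KL: "compact (K \<times> L)" "K \<times> L \<subseteq> S \<times> T" using K L by (auto intro: compact_Times)
    have "integrable lborel (\<lambda>p. (indicator (K \<times> L) p *\<^sub>R h p) * \<beta> (fst p))"
    proof (rule integrable_mult_bounded)
      show "integrable lborel (\<lambda>p. indicator (K \<times> L) p *\<^sub>R h p)"
        using h KL by (simp add: locally_integrable_on_def set_integrable_def)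
      show "(\<lambda>p. \<beta> (fst p)) \<in> borel_measurable (lborel :: ('a \<times> 'b) measure)"
        using measurable_compose[of fst borel borel \<beta> borel] that(2) by (simp add: borel_measurable_continuous_onI continuous_on_fst continuous_on_id)
      show "\<bar>\<beta> (fst p)\<bar> \<le> C" for p by (rule \<beta>(1))
    qed
    then have "integrable (lborel \<Otimes>\<^sub>M lborel) (\<lambda>p. (indicator (K \<times> L) p *\<^sub>R h p) * \<beta> (fst p))"
      by (simp only: lborel_prod)
    also have "(\<lambda>p. (indicator (K \<times> L) p *\<^sub>R h p) * \<beta> (fst p)) = (\<lambda>(u, v). indicator L v * (h (u, v) * \<beta> u))"
      using \<beta>(2) by (auto simp: fun_eq_iff indicator_def)
    finally have "integrable lborel (\<lambda>v. LINT u|lborel. indicator L v * (h (u, v) * \<beta> u))"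
      by (rule lborel_pair.integrable_snd)
    then show "integrable lborel (\<lambda>v. indicator L v *\<^sub>R (LINT u|lborel. h (u, v) * \<beta> u))" by simp
  qed
  have l1: "locally_integrable_on (\<lambda>v. LINT u|lborel. f (u, v) * frechet_derivative \<psi> (at u) w) T"
    by (rule slice[OF loc(1) _ C' K(4)]) simp_all
  have l2: "locally_integrable_on (\<lambda>v. LINT u|lborel. g (u, v) * \<psi> u) T"
    by (rule slice[OF loc(2) _ C K(3)]) simp_all
  show ?thesis
  proof (rule fundamental_lemma[OF T])
    show "locally_integrable_on (\<lambda>v. (LINT u|lborel. f (u, v) * frechet_derivative \<psi> (at u) w) + (LINT u|lborel. g (u, v) * \<psi> u)) T"
      using l1 l2 by (simp add: locally_integrable_on_def)
    fix \<eta> assume \<eta>: "\<eta> \<in> test_functions T"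
    note tensor = test_function_tensor[OF \<psi> \<eta>]
    have tensor_deriv: "frechet_derivative (\<lambda>p. \<psi> (fst p) * \<eta> (snd p)) (at p) (w, 0) = frechet_derivative \<psi> (at (fst p)) w * \<eta> (snd p)" for p
      using tensor(2)[of "fst p" "snd p" w] by simp
    have "integrable lborel (\<lambda>p. f p * frechet_derivative (\<lambda>p. \<psi> (fst p) * \<eta> (snd p)) (at p) (w, 0))"
      by (rule locally_integrable_mult_test_function(2)[OF loc(1) tensor(1)])
    also have "(\<lambda>p. f p * frechet_derivative (\<lambda>p. \<psi> (fst p) * \<eta> (snd p)) (at p) (w, 0))
        = (\<lambda>(u, v). f (u, v) * frechet_derivative \<psi> (at u) w * \<eta> v)"
      using tensor(2) by (auto simp: fun_eq_iff)
    finally have i1: "integrable (lborel \<Otimes>\<^sub>M lborel) (\<lambda>(u, v). f (u, v) * frechet_derivative \<psi> (at u) w * \<eta> v)"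
      by (simp only: lborel_prod)
    have "integrable lborel (\<lambda>p. g p * (\<psi> (fst p) * \<eta> (snd p)))"
      by (rule locally_integrable_mult_test_function(1)[OF loc(2) tensor(1)])
    also have "(\<lambda>p. g p * (\<psi> (fst p) * \<eta> (snd p))) = (\<lambda>(u, v). g (u, v) * \<psi> u * \<eta> v)"
      by (auto simp: fun_eq_iff)
    finally have i2: "integrable (lborel \<Otimes>\<^sub>M lborel) (\<lambda>(u, v). g (u, v) * \<psi> u * \<eta> v)"
      by (simp only: lborel_prod)
    have "(LINT v|lborel. (LINT u|lborel. f (u, v) * frechet_derivative \<psi> (at u) w) * \<eta> v)
        = (LINT v|lborel. LINT u|lborel. f (u, v) * frechet_derivative \<psi> (at u) w * \<eta> v)" by simp
    also have "\<dots> = (LINT p|lborel. f p * frechet_derivative (\<lambda>p. \<psi> (fst p) * \<eta> (snd p)) (at p) (w, 0))"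
      by (subst lborel_pair.integral_snd[OF i1]) (simp add: lborel_prod case_prod_beta' tensor_deriv mult.assoc)
    also have "\<dots> = - (LINT p|lborel. g p * (\<psi> (fst p) * \<eta> (snd p)))"
      by (rule weak_dir_derivD[OF w tensor(1)])
    also have "(LINT p|lborel. g p * (\<psi> (fst p) * \<eta> (snd p))) = (LINT v|lborel. LINT u|lborel. g (u, v) * \<psi> u * \<eta> v)"
      by (subst lborel_pair.integral_snd[OF i2]) (simp add: lborel_prod case_prod_beta' mult.assoc)
    finally have "(LINT v|lborel. (LINT u|lborel. f (u, v) * frechet_derivative \<psi> (at u) w) * \<eta> v)
        = - (LINT v|lborel. (LINT u|lborel. g (u, v) * \<psi> u) * \<eta> v)" by simp
    moreover have "integrable lborel (\<lambda>v. (LINT u|lborel. f (u, v) * frechet_derivative \<psi> (at u) w) * \<eta> v)"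
      "integrable lborel (\<lambda>v. (LINT u|lborel. g (u, v) * \<psi> u) * \<eta> v)"
      by (rule locally_integrable_mult_test_function(1)[OF l1 \<eta>], rule locally_integrable_mult_test_function(1)[OF l2 \<eta>])
    ultimately have "(LINT v|lborel. ((LINT u|lborel. f (u, v) * frechet_derivative \<psi> (at u) w) + (LINT u|lborel. g (u, v) * \<psi> u)) * \<eta> v) = 0"
      by (simp add: distrib_right)
    then show "(LINT v:T|lborel. ((LINT u|lborel. f (u, v) * frechet_derivative \<psi> (at u) w) + (LINT u|lborel. g (u, v) * \<psi> u)) * \<eta> v) = 0"
      using set_integral_test_function[OF \<eta> order_refl] by simp
  qed
qed

lemma (in riemannian_volume_space) trans_deriv_same:
  assumes i: "i \<in> chart_ix M" and x: "x \<in> chart_dom M i"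
  shows "trans_deriv M i i x v = v"
proof -
  have "((\<lambda>u. coord M i (chart_inv M i u)) has_derivative trans_deriv M i i x) (at (coord M i x))"
    using transition_has_derivative[OF i i] x by simp
  then have "((\<lambda>u. u) has_derivative trans_deriv M i i x) (at (coord M i x))"
    by (rule has_derivative_transform_within_open[OF _ open_img[OF i] coord_in[OF i x]]) (rule coord_chart_inv[OF i])
  then have "trans_deriv M i i x = (\<lambda>v. v)" by (rule has_derivative_unique) (rule has_derivative_ident)
  then show ?thesis by simp
qed

locale interaction_potential = riemannian_volume_space M m
  for M :: "('i, 'm::{t2_space, second_countable_topology}, real ^ 'n) riem" and m +
  fixes W :: "'m \<Rightarrow> 'm \<Rightarrow> real" and \<rho> :: "'m \<Rightarrow> real" and B :: real
  assumes W_H1: "(\<lambda>(x, y). W x y) \<in> H1 (prod_riem M M) (m \<Otimes>\<^sub>M m)"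
    and W_bound: "\<And>x y. \<bar>W x y\<bar> \<le> B"
    and \<rho>_P_ac: "\<rho> \<in> P_ac m" and \<rho>_sq: "integrable m (\<lambda>x. (\<rho> x)\<^sup>2)"

sublocale interaction_potential \<subseteq> bounded_interaction m W B
  by unfold_locales (use W_H1 W_bound in \<open>auto simp: H1_def\<close>)

sublocale interaction_potential \<subseteq> P: riemannian_measure_atlas "prod_riem M M" "m \<Otimes>\<^sub>M m"
  by (rule riemannian_measure_atlas_prod)

context interaction_potential
begin

abbreviation "PM \<equiv> prod_riem M M"
abbreviation "gradW \<equiv> grad PM (\<lambda>(x, y). W x y)"
abbreviation "g \<equiv> grad_fst M W"

text \<open>The integrable majorant for everything that concerns the first component of the gradient: its
  squared norm is one of the two summands of \<open>R\<close>.\<close>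

definition R :: "'m \<times> 'm \<Rightarrow> real" where "R = rinner PM gradW gradW"

lemma W_measurable [measurable]: "(\<lambda>(x, y). W x y) \<in> borel_measurable (m \<Otimes>\<^sub>M m)"
  by (rule W_meas)

lemma \<rho>_int: "integrable m \<rho>" and \<rho>_one: "(\<integral>x. \<rho> x \<partial>m) = 1"
  using \<rho>_P_ac by (simp_all add: P_ac_def)

lemma \<rho>_measurable [measurable]: "\<rho> \<in> borel_measurable m"
  using \<rho>_int by auto

lemma gradW: "weak_gradient PM (\<lambda>(x, y). W x y) gradW" "integrable (m \<Otimes>\<^sub>M m) R"
  unfolding R_def by (rule P.H1_grad[OF W_H1])+

lemma prod_ix: "i \<in> chart_ix M \<Longrightarrow> k \<in> chart_ix M \<Longrightarrow> (i, k) \<in> chart_ix PM"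
  by (simp add: prod_riem_def)

lemma prod_dom: "x \<in> chart_dom M i \<Longrightarrow> y \<in> chart_dom M k \<Longrightarrow> (x, y) \<in> chart_dom PM (i, k)"
  by (simp add: prod_riem_def)

lemma gradW_trans:
  assumes "i \<in> chart_ix M" "j \<in> chart_ix M" "x \<in> chart_dom M i \<inter> chart_dom M j"
    and "k \<in> chart_ix M" "l \<in> chart_ix M" "y \<in> chart_dom M k \<inter> chart_dom M l"
  shows "fst (gradW (j, l) (x, y)) = trans_deriv M i j x (fst (gradW (i, k) (x, y)))"
proof -
  have "gradW (j, l) (x, y) = trans_deriv PM (i, k) (j, l) (x, y) (gradW (i, k) (x, y))"
    using gradW(1) prod_ix assms prod_dom unfolding weak_gradient_def vector_field_def by blast
  also have "\<dots> = trans_deriv PM (i, k) (j, l) (x, y) (fst (gradW (i, k) (x, y)), snd (gradW (i, k) (x, y)))" by simp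
  also have "\<dots> = (trans_deriv M i j x (fst (gradW (i, k) (x, y))), trans_deriv M k l y (snd (gradW (i, k) (x, y))))"
    by (rule trans_deriv_prod[OF assms])
  finally show ?thesis by (metis fst_conv)
qed

lemma g_chart:
  assumes i: "i \<in> chart_ix M" "x \<in> chart_dom M i" and k: "k \<in> chart_ix M" "y \<in> chart_dom M k"
  shows "g i x y = fst (gradW (i, k) (x, y))"
  unfolding grad_fst_def
  using gradW_trans[of i i x k "chart_at M y" y] i k chart_at trans_deriv_same[OF i] by simp

lemma g_trans:
  assumes "i \<in> chart_ix M" "j \<in> chart_ix M" "x \<in> chart_dom M i \<inter> chart_dom M j"
  shows "g j x y = trans_deriv M i j x (g i x y)"
  unfolding grad_fst_def by (rule gradW_trans[OF assms]) (simp_all add: chart_at)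

lemma R_nonneg: "0 \<le> R z"
  unfolding R_def by (rule P.rinner_nonneg)

lemma g_le_R:
  assumes i: "i \<in> chart_ix M" "x \<in> chart_dom M i"
  shows "metric M i x (g i x y) (g i x y) \<le> R (x, y)"
proof -
  let ?k = "chart_at M y" and ?G = "gradW (i, chart_at M y) (x, y)"
  have vf: "vector_field PM gradW" using gradW(1) by (simp add: weak_gradient_def)
  have "R (x, y) = metric PM (i, ?k) (x, y) ?G ?G"
    unfolding R_def by (rule P.rinner_chart[OF vf vf prod_ix prod_dom]) (use i chart_at in auto)
  also have "\<dots> = metric M i x (fst ?G) (fst ?G) + metric M ?k y (snd ?G) (snd ?G)"
    by (simp add: prod_riem_def case_prod_beta')
  finally show ?thesis using metric_at(2)[OF chart_at, of y "snd ?G"] by (simp add: grad_fst_def)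
qed

lemma R_measurable [measurable]: "R \<in> borel_measurable (m \<Otimes>\<^sub>M m)"
  using gradW(2) by auto

lemma sets_Lm: "sets ((lborel :: (real ^ 'n) measure) \<Otimes>\<^sub>M m) = sets borel"
proof -
  have "sets ((lborel :: (real ^ 'n) measure) \<Otimes>\<^sub>M m) = sets (borel \<Otimes>\<^sub>M borel)"
    by (rule sets_pair_measure_cong) (simp_all add: sets_m)
  then show ?thesis unfolding borel_prod .
qed

text \<open>The chart around \<open>y\<close> in the definition of \<open>grad_fst\<close> is an arbitrary choice at every point. Since the
  first component is independent of that chart, it may be computed with one and the same chart
  on each of finitely many open sets that cover the manifold.\<close>

lemma g_measurable:
  assumes i: "i \<in> chart_ix M"
  shows "(\<lambda>(u, y). indicator (chart_img M i) u *\<^sub>R g i (chart_inv M i u) y) \<in> borel_measurable (lborel \<Otimes>\<^sub>M m)"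
proof -
  obtain I where I: "finite I" "I \<subseteq> chart_ix M" "\<And>x. \<exists>k\<in>I. x \<in> chart_dom M k" using finite_atlas by metis
  let ?S = "chart_img M i" and ?f = "\<lambda>p. indicator (chart_img M i) (fst p) *\<^sub>R g i (chart_inv M i (fst p)) (snd p)"
  have openS: "open ?S" by (rule open_img[OF i])
  have [measurable]: "?S \<in> sets borel" using openS by simp
  have "?f \<in> borel_measurable borel"
  proof (rule measurable_piecewise_restrict[where C="insert ((- ?S) \<times> UNIV) ((\<lambda>k. ?S \<times> chart_dom M k) ` I)"])
    show "countable (insert ((- ?S) \<times> UNIV) ((\<lambda>k. ?S \<times> chart_dom M k) ` I))" using I by (simp add: countable_finite)
    show "space borel \<subseteq> \<Union> (insert ((- ?S) \<times> UNIV) ((\<lambda>k. ?S \<times> chart_dom M k) ` I))" using I(3) by fastforce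
    fix \<Omega> assume "\<Omega> \<in> insert ((- ?S) \<times> UNIV) ((\<lambda>k. ?S \<times> chart_dom M k) ` I)"
    then consider "\<Omega> = (- ?S) \<times> UNIV" | k where "k \<in> I" "\<Omega> = ?S \<times> chart_dom M k" by blast
    then have "\<Omega> \<in> sets borel \<and> ?f \<in> borel_measurable (restrict_space borel \<Omega>)"
    proof cases
      case 1
      have "closed ((- ?S) \<times> (UNIV :: 'm set))" using openS by (intro closed_Times) auto
      moreover have "(\<lambda>_. 0) \<in> borel_measurable (restrict_space borel \<Omega>)" by simp
      then have "?f \<in> borel_measurable (restrict_space borel \<Omega>)"
        by (rule measurable_cong[THEN iffD1, rotated]) (auto simp: 1 space_restrict_space)
      ultimately show ?thesis by (simp add: 1)
    next
      case 2
      then have k: "k \<in> chart_ix M" using I by blast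
      have op: "open (?S \<times> chart_dom M k)" using openS open_dom[OF k] by (rule open_Times)
      have "continuous_on (?S \<times> chart_dom M k) (\<lambda>p. (fst p, coord M k (snd p)))"
        using homeo[OF k] by (intro continuous_on_Pair continuous_on_fst continuous_on_id
            continuous_on_compose2[of "chart_dom M k" "coord M k", OF _ continuous_on_snd[OF continuous_on_id]])
          (auto simp: homeomorphism_def)
      then have c: "(\<lambda>p. (fst p, coord M k (snd p))) \<in> measurable (restrict_space borel (?S \<times> chart_dom M k)) (restrict_space borel (chart_img PM (i, k)))"
        unfolding chart_img_prod
        by (intro measurable_restrict_space2 borel_measurable_continuous_on_restrict)
           (auto simp: space_restrict_space coord_in[OF k])
      have "(\<lambda>w. gradW (i, k) (chart_inv PM (i, k) w)) \<in> borel_measurable (restrict_space borel (chart_img PM (i, k)))"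
        using P.weak_gradient_measurable[OF gradW(1)] prod_ix[OF i k] unfolding P.chart_measurable_def by blast
      then have "(\<lambda>w. fst (gradW (i, k) (chart_inv PM (i, k) w))) \<in> borel_measurable (restrict_space borel (chart_img PM (i, k)))"
        by (rule measurable_compose) (simp add: borel_measurable_continuous_onI continuous_on_fst continuous_on_id)
      from measurable_compose[OF c this]
      have "(\<lambda>p. fst (gradW (i, k) (chart_inv PM (i, k) (fst p, coord M k (snd p))))) \<in> borel_measurable (restrict_space borel (?S \<times> chart_dom M k))" .
      also have "?this \<longleftrightarrow> ?f \<in> borel_measurable (restrict_space borel (?S \<times> chart_dom M k))"
      proof (rule measurable_cong)
        fix p assume "p \<in> space (restrict_space borel (?S \<times> chart_dom M k))"
        then have p: "fst p \<in> ?S" "snd p \<in> chart_dom M k" by (auto simp: space_restrict_space)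
        have "chart_inv PM (i, k) (fst p, coord M k (snd p)) = (chart_inv M i (fst p), snd p)"
          using chart_inv_prod[OF i k p(1) coord_in[OF k p(2)]] chart_inv_coord[OF k p(2)] by simp
        then show "fst (gradW (i, k) (chart_inv PM (i, k) (fst p, coord M k (snd p)))) = ?f p"
          using g_chart[OF i chart_inv_in[OF i p(1)] k p(2)] p by simp
      qed
      finally show ?thesis using op 2 by simp
    qed
    then show "\<Omega> \<inter> space borel \<in> sets borel" "?f \<in> borel_measurable (restrict_space borel \<Omega>)" by auto
  qed
  then show ?thesis by (simp add: case_prod_beta' measurable_cong_sets[OF sets_Lm refl])
qed

text \<open>Young's inequality separates the two square integrable factors; the lower bound of the metric
  on a compact piece of the chart turns the Euclidean norm into the Riemannian one.\<close>

lemma \<rho>_g_integrable: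
  assumes i: "i \<in> chart_ix M" and K: "compact K" "K \<subseteq> chart_img M i"
  shows "integrable (lborel \<Otimes>\<^sub>M m) (\<lambda>(u, y). \<rho> y *\<^sub>R (indicator K u *\<^sub>R g i (chart_inv M i u) y))"
proof (rule integrableI_bounded)
  let ?G = "\<lambda>u y. indicator (chart_img M i) u *\<^sub>R g i (chart_inv M i u) y"
  have [measurable]: "K \<in> sets borel" using K(1) by (simp add: compact_imp_closed)
  note g_measurable[OF i, measurable]
  have "(\<lambda>(u, y). \<rho> y *\<^sub>R (indicator K u *\<^sub>R ?G u y)) \<in> borel_measurable (lborel \<Otimes>\<^sub>M m)" by measurable
  also have "(\<lambda>(u, y). \<rho> y *\<^sub>R (indicator K u *\<^sub>R ?G u y)) = (\<lambda>(u, y). \<rho> y *\<^sub>R (indicator K u *\<^sub>R g i (chart_inv M i u) y))"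
    using K(2) by (auto simp: fun_eq_iff indicator_def)
  finally show meas: "(\<lambda>(u, y). \<rho> y *\<^sub>R (indicator K u *\<^sub>R g i (chart_inv M i u) y)) \<in> borel_measurable (lborel \<Otimes>\<^sub>M m)" .
  obtain c where c: "c > 0" "\<And>u v. u \<in> K \<Longrightarrow> c * (norm v)\<^sup>2 \<le> metric M i (chart_inv M i u) v v"
    using metric_lower_bound[OF i K] by metis
  obtain C where C: "C > 0" "\<And>F. F \<in> borel_measurable borel \<Longrightarrow>
      (\<integral>\<^sup>+u. F (chart_inv M i u) * indicator K u \<partial>lborel) \<le> ennreal C * (\<integral>\<^sup>+x. F x \<partial>m)"
    using chart_le_volume[OF i K] by metis
  have pt: "norm (\<rho> y *\<^sub>R (indicator K u *\<^sub>R g i (chart_inv M i u) y))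
      \<le> indicator K u * (\<rho> y)\<^sup>2 + indicator K u * (R (chart_inv M i u, y) / c)" for u y
  proof (cases "u \<in> K")
    case True
    then have u: "u \<in> chart_img M i" using K by blast
    let ?n = "norm (g i (chart_inv M i u) y)"
    have "c * ?n\<^sup>2 \<le> R (chart_inv M i u, y)"
      using c(2)[OF True] g_le_R[OF i chart_inv_in[OF i u]] by (rule order_trans)
    then have "?n\<^sup>2 \<le> R (chart_inv M i u, y) / c" using c(1) by (simp add: field_simps)
    moreover have "\<bar>\<rho> y\<bar> * ?n \<le> (\<rho> y)\<^sup>2 + ?n\<^sup>2"
    proof -
      have "2 * (\<bar>\<rho> y\<bar> * ?n) \<le> (\<rho> y)\<^sup>2 + ?n\<^sup>2"
        using sum_squares_bound[of "\<bar>\<rho> y\<bar>" ?n] by (simp add: mult.assoc)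
      moreover have "0 \<le> \<bar>\<rho> y\<bar> * ?n" by (rule mult_nonneg_nonneg) simp_all
      ultimately show ?thesis by linarith
    qed
    ultimately show ?thesis using True by simp
  qed simp
  have "(\<integral>\<^sup>+p. ennreal (norm (case p of (u, y) \<Rightarrow> \<rho> y *\<^sub>R (indicator K u *\<^sub>R g i (chart_inv M i u) y))) \<partial>(lborel \<Otimes>\<^sub>M m))
      = (\<integral>\<^sup>+u. \<integral>\<^sup>+y. ennreal (norm (\<rho> y *\<^sub>R (indicator K u *\<^sub>R g i (chart_inv M i u) y))) \<partial>m \<partial>lborel)"
    using meas by (subst nn_integral_fst[symmetric]) auto
  also have "\<dots> \<le> (\<integral>\<^sup>+u. \<integral>\<^sup>+y. ennreal ((\<rho> y)\<^sup>2) * indicator K u + ennreal (R (chart_inv M i u, y)) * (ennreal (1 / c) * indicator K u) \<partial>m \<partial>lborel)"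
  proof (intro nn_integral_mono)
    fix u y
    have "ennreal (norm (\<rho> y *\<^sub>R (indicator K u *\<^sub>R g i (chart_inv M i u) y)))
        \<le> ennreal (indicator K u * (\<rho> y)\<^sup>2 + indicator K u * (R (chart_inv M i u, y) / c))"
      by (rule ennreal_leI[OF pt])
    also have "\<dots> = ennreal ((\<rho> y)\<^sup>2) * indicator K u + ennreal (R (chart_inv M i u, y)) * (ennreal (1 / c) * indicator K u)"
      using R_nonneg c(1) by (auto simp: indicator_def ennreal_mult[symmetric] ennreal_plus[symmetric] simp del: ennreal_plus)
    finally show "ennreal (norm (\<rho> y *\<^sub>R (indicator K u *\<^sub>R g i (chart_inv M i u) y)))
        \<le> ennreal ((\<rho> y)\<^sup>2) * indicator K u + ennreal (R (chart_inv M i u, y)) * (ennreal (1 / c) * indicator K u)" .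
  qed
  also have "\<dots> = (\<integral>\<^sup>+u. (\<integral>\<^sup>+y. ennreal ((\<rho> y)\<^sup>2) \<partial>m) * indicator K u + (\<integral>\<^sup>+y. ennreal (R (chart_inv M i u, y)) \<partial>m) * (ennreal (1 / c) * indicator K u) \<partial>lborel)"
  proof (rule nn_integral_cong)
    fix u
    have [measurable]: "(\<lambda>y. R (chart_inv M i u, y)) \<in> borel_measurable m"
      by (rule measurable_Pair2[OF R_measurable]) simp
    show "(\<integral>\<^sup>+y. ennreal ((\<rho> y)\<^sup>2) * indicator K u + ennreal (R (chart_inv M i u, y)) * (ennreal (1 / c) * indicator K u) \<partial>m)
        = (\<integral>\<^sup>+y. ennreal ((\<rho> y)\<^sup>2) \<partial>m) * indicator K u + (\<integral>\<^sup>+y. ennreal (R (chart_inv M i u, y)) \<partial>m) * (ennreal (1 / c) * indicator K u)"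
      by (subst nn_integral_add) (auto simp: nn_integral_multc)
  qed
  also have "\<dots> \<le> (\<integral>\<^sup>+y. ennreal ((\<rho> y)\<^sup>2) \<partial>m) * emeasure lborel K + ennreal (1 / c) * (ennreal C * (\<integral>\<^sup>+x. \<integral>\<^sup>+y. ennreal (R (x, y)) \<partial>m \<partial>m))"
  proof -
    have Fm: "(\<lambda>x. \<integral>\<^sup>+y. ennreal (R (x, y)) \<partial>m) \<in> borel_measurable borel"
      using borel_measurable_nn_integral_fst[of "\<lambda>p. ennreal (R p)" m] by (simp add: measurable_cong_sets[OF sets_m refl])
    have "(\<lambda>u. (\<integral>\<^sup>+y. ennreal (R (chart_inv M i u, y)) \<partial>m)) \<in> borel_measurable (restrict_space borel (chart_img M i))"
      by (rule borel_measurable_chart_inv[OF Fm i])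
    from measurable_restrict_space1[OF this, of K]
    have "(\<lambda>u. (\<integral>\<^sup>+y. ennreal (R (chart_inv M i u, y)) \<partial>m)) \<in> borel_measurable (restrict_space borel K)"
      using K open_img[OF i] by (simp add: restrict_restrict_space Int_absorb1 compact_imp_closed)
    then have m2: "(\<lambda>u. (\<integral>\<^sup>+y. ennreal (R (chart_inv M i u, y)) \<partial>m) * indicator K u) \<in> borel_measurable lborel"
      by (subst (asm) borel_measurable_restrict_space_iff_ennreal) auto
    have "(\<integral>\<^sup>+u. (\<integral>\<^sup>+y. ennreal ((\<rho> y)\<^sup>2) \<partial>m) * indicator K u + (\<integral>\<^sup>+y. ennreal (R (chart_inv M i u, y)) \<partial>m) * (ennreal (1 / c) * indicator K u) \<partial>lborel)
        = (\<integral>\<^sup>+u. (\<integral>\<^sup>+y. ennreal ((\<rho> y)\<^sup>2) \<partial>m) * indicator K u + ennreal (1 / c) * ((\<integral>\<^sup>+y. ennreal (R (chart_inv M i u, y)) \<partial>m) * indicator K u) \<partial>lborel)"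
      by (rule nn_integral_cong) (simp add: mult_ac)
    also have "\<dots> = (\<integral>\<^sup>+y. ennreal ((\<rho> y)\<^sup>2) \<partial>m) * emeasure lborel K + ennreal (1 / c) * (\<integral>\<^sup>+u. (\<integral>\<^sup>+y. ennreal (R (chart_inv M i u, y)) \<partial>m) * indicator K u \<partial>lborel)"
      using m2 by (subst nn_integral_add) (auto simp: nn_integral_cmult nn_integral_cmult_indicator)
    also have "\<dots> \<le> (\<integral>\<^sup>+y. ennreal ((\<rho> y)\<^sup>2) \<partial>m) * emeasure lborel K + ennreal (1 / c) * (ennreal C * (\<integral>\<^sup>+x. \<integral>\<^sup>+y. ennreal (R (x, y)) \<partial>m \<partial>m))"
      by (intro add_left_mono mult_left_mono C(2)[OF Fm]) simp
    finally show ?thesis .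
  qed
  also have "\<dots> < \<infinity>"
  proof -
    have "(\<integral>\<^sup>+x. \<integral>\<^sup>+y. ennreal (R (x, y)) \<partial>m \<partial>m) = (\<integral>\<^sup>+p. ennreal (R p) \<partial>(m \<Otimes>\<^sub>M m))"
      by (rule nn_integral_fst) simp
    also have "\<dots> < \<infinity>" using gradW(2) R_nonneg by (simp add: integrable_iff_bounded)
    finally have 1: "(\<integral>\<^sup>+x. \<integral>\<^sup>+y. ennreal (R (x, y)) \<partial>m \<partial>m) < \<infinity>" .
    have 2: "(\<integral>\<^sup>+y. ennreal ((\<rho> y)\<^sup>2) \<partial>m) < \<infinity>" using \<rho>_sq by (simp add: integrable_iff_bounded)
    have 3: "emeasure lborel K < \<infinity>" using K(1) emeasure_bounded_finite[OF compact_imp_bounded] by simp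
    show ?thesis using 1 2 3 by (simp add: ennreal_mult_less_top)
  qed
  finally show "(\<integral>\<^sup>+p. ennreal (norm (case p of (u, y) \<Rightarrow> \<rho> y *\<^sub>R (indicator K u *\<^sub>R g i (chart_inv M i u) y))) \<partial>(lborel \<Otimes>\<^sub>M m)) < \<infinity>" .
qed

end

context interaction_potential
begin

abbreviation "V \<equiv> conv m W \<rho>"
abbreviation "D \<equiv> conv_grad M m W \<rho>"

lemma B_nonneg: "0 \<le> B"
  using W_bound[of undefined undefined] by (rule order_trans[OF abs_ge_zero])

lemma V_bound: "\<bar>V x\<bar> \<le> B"
  by (rule conv_bound_P_ac[OF \<rho>_P_ac]) simp

lemma V_measurable: "V \<in> borel_measurable borel"
  using conv_measurable[OF \<rho>_measurable] by (simp add: measurable_cong_sets[OF sets_m refl])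

text \<open>The transition map is invertible, so it commutes with the integral also where the integrand is
  not integrable and the integral has the value \<open>0\<close>.\<close>

lemma D_vector_field: "vector_field M D"
  unfolding vector_field_def
proof (intro ballI)
  fix i j x assume h: "i \<in> chart_ix M" "j \<in> chart_ix M" "x \<in> chart_dom M i \<inter> chart_dom M j"
  then have h': "j \<in> chart_ix M" "i \<in> chart_ix M" "x \<in> chart_dom M j \<inter> chart_dom M i" by auto
  note T = trans_deriv_linear[OF h] and T' = trans_deriv_linear[OF h']
  have "D j x = (\<integral>y. trans_deriv M i j x (\<rho> y *\<^sub>R g i x y) \<partial>m)"
    unfolding conv_grad_def g_trans[OF h] by (simp add: linear_scale[OF bounded_linear.linear[OF T]])
  also have "\<dots> = trans_deriv M i j x (\<integral>y. \<rho> y *\<^sub>R g i x y \<partial>m)"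
    by (rule integral_bounded_linear'[OF T T']) (simp add: trans_deriv_inverse[OF h])
  finally show "D j x = trans_deriv M i j x (D i x)" by (simp add: conv_grad_def)
qed

lemma integral_indicator_D:
  "(\<integral>y. \<rho> y *\<^sub>R (indicator K u *\<^sub>R g i (chart_inv M i u) y) \<partial>m) = indicator K u *\<^sub>R D i (chart_inv M i u)"
  by (cases "u \<in> K") (simp_all add: conv_grad_def)

lemma D_locally_integrable:
  assumes i: "i \<in> chart_ix M"
  shows "locally_integrable_on (\<lambda>u. D i (chart_inv M i u)) (chart_img M i)"
  unfolding locally_integrable_on_def set_integrable_def
proof (intro allI impI)
  fix K assume K: "compact K" "K \<subseteq> chart_img M i"
  from Lm.integrable_fst'[OF \<rho>_g_integrable[OF i K]]
  show "integrable lborel (\<lambda>u. indicator K u *\<^sub>R D i (chart_inv M i u))"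
    by (simp only: prod.case integral_indicator_D)
qed

lemma D_measurable: "chart_measurable D"
  unfolding chart_measurable_def
  using locally_integrable_imp_measurable[OF open_img D_locally_integrable] by blast

lemma W_chart_measurable:
  assumes i: "i \<in> chart_ix M"
  shows "(\<lambda>(u, y). indicator (chart_img M i) u * W (chart_inv M i u) y) \<in> borel_measurable (lborel \<Otimes>\<^sub>M m)"
proof -
  let ?S = "chart_img M i"
  have S: "open (?S \<times> (UNIV :: 'm set))" by (intro open_Times open_img[OF i]) simp
  have "continuous_on (?S \<times> (UNIV :: 'm set)) (\<lambda>p. (chart_inv M i (fst p), snd p))"
    using homeo[OF i] by (intro continuous_on_Pair continuous_on_snd continuous_on_id
        continuous_on_compose2[of ?S "chart_inv M i", OF _ continuous_on_fst[OF continuous_on_id]])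
      (auto simp: homeomorphism_def)
  then have "(\<lambda>p. (chart_inv M i (fst p), snd p)) \<in> measurable (restrict_space borel (?S \<times> (UNIV :: 'm set))) borel"
    by (rule borel_measurable_continuous_on_restrict)
  moreover have "(\<lambda>(x, y). W x y) \<in> borel_measurable borel"
    using W_measurable by (simp add: measurable_cong_sets[OF sets_mm refl])
  ultimately have "(\<lambda>p. W (chart_inv M i (fst p)) (snd p)) \<in> borel_measurable (restrict_space borel (?S \<times> (UNIV :: 'm set)))"
    by (auto dest: measurable_compose)
  then have "(\<lambda>p. indicator (?S \<times> (UNIV :: 'm set)) p *\<^sub>R W (chart_inv M i (fst p)) (snd p)) \<in> borel_measurable borel"
    using S by (subst (asm) borel_measurable_restrict_space_iff) auto
  also have "(\<lambda>p. indicator (?S \<times> (UNIV :: 'm set)) p *\<^sub>R W (chart_inv M i (fst p)) (snd p))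
      = (\<lambda>(u, y). indicator ?S u * W (chart_inv M i u) y)"
    by (auto simp: fun_eq_iff indicator_def)
  finally show ?thesis by (simp add: measurable_cong_sets[OF sets_Lm refl])
qed

text \<open>The exceptional set of \<open>y\<close> is null chart by chart; in each chart this is \<open>weak_dir_deriv_slice\<close> in the
  direction \<open>(w, 0)\<close>, which selects the first component of the gradient.\<close>

lemma W_weak_slice:
  assumes i: "i \<in> chart_ix M" and \<psi>: "\<psi> \<in> test_functions (chart_img M i)"
  shows "AE y in m. (LINT u|lborel. W (chart_inv M i u) y * frechet_derivative \<psi> (at u) w)
    + (LINT u|lborel. metric M i (chart_inv M i u) (g i (chart_inv M i u) y) w * \<psi> u) = 0"
proof (rule AE_charts)
  fix k assume k: "k \<in> chart_ix M"
  let ?p = "(i, k)"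
  have "weak_dir_deriv (chart_img M i \<times> chart_img M k) (w, 0) (\<lambda>z. case chart_inv PM ?p z of (x, y) \<Rightarrow> W x y)
      (\<lambda>z. metric PM ?p (chart_inv PM ?p z) (gradW ?p (chart_inv PM ?p z)) (w, 0))"
    using P.weak_gradient_chart[OF gradW(1) prod_ix[OF i k], of "(w, 0)"] by (simp add: chart_img_prod)
  from weak_dir_deriv_slice[OF open_img[OF k] this \<psi>]
  show "AE v in lborel. v \<in> chart_img M k \<longrightarrow>
    (LINT u|lborel. W (chart_inv M i u) (chart_inv M k v) * frechet_derivative \<psi> (at u) w)
    + (LINT u|lborel. metric M i (chart_inv M i u) (g i (chart_inv M i u) (chart_inv M k v)) w * \<psi> u) = 0"
  proof eventually_elim
    case (elim v)
    show ?case
    proof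
      assume v: "v \<in> chart_img M k"
      have inv: "chart_inv PM ?p (u, v) = (chart_inv M i u, chart_inv M k v)" if "u \<in> chart_img M i" for u
        by (rule chart_inv_prod[OF i k that v])
      have eq1: "(case chart_inv PM ?p (u, v) of (x, y) \<Rightarrow> W x y) * frechet_derivative \<psi> (at u) w
          = W (chart_inv M i u) (chart_inv M k v) * frechet_derivative \<psi> (at u) w" for u
        by (cases "u \<in> chart_img M i") (simp_all add: inv test_function_deriv_eq_0[OF \<psi>])
      have eq2: "metric PM ?p (chart_inv PM ?p (u, v)) (gradW ?p (chart_inv PM ?p (u, v))) (w, 0) * \<psi> u
          = metric M i (chart_inv M i u) (g i (chart_inv M i u) (chart_inv M k v)) w * \<psi> u" for u
      proof (cases "u \<in> chart_img M i")
        case True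
        let ?x = "chart_inv M i u" and ?y = "chart_inv M k v"
        have "metric PM ?p (?x, ?y) G (w, 0) = metric M i ?x (fst G) w + metric M k ?y (snd G) 0" for G
          by (simp add: prod_riem_def case_prod_beta')
        moreover have "metric M k ?y z 0 = 0" for z using bilinear_rzero[OF metric_bilin[OF k v]] .
        moreover have "fst (gradW ?p (?x, ?y)) = g i ?x ?y"
          by (rule g_chart[OF i chart_inv_in[OF i True] k chart_inv_in[OF k v], symmetric])
        ultimately show ?thesis by (simp add: inv[OF True])
      qed (simp add: test_function_eq_0[OF \<psi>])
      from elim v have "(LINT u|lborel. (case chart_inv PM ?p (u, v) of (x, y) \<Rightarrow> W x y) * frechet_derivative \<psi> (at u) w)
        + (LINT u|lborel. metric PM ?p (chart_inv PM ?p (u, v)) (gradW ?p (chart_inv PM ?p (u, v))) (w, 0) * \<psi> u) = 0" by blast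
      then show "(LINT u|lborel. W (chart_inv M i u) (chart_inv M k v) * frechet_derivative \<psi> (at u) w)
        + (LINT u|lborel. metric M i (chart_inv M i u) (g i (chart_inv M i u) (chart_inv M k v)) w * \<psi> u) = 0"
        by (simp only: eq1 eq2)
    qed
  qed
qed

lemma V_chart_locally_integrable:
  assumes i: "i \<in> chart_ix M"
  shows "locally_integrable_on (\<lambda>u. V (chart_inv M i u)) (chart_img M i)"
  unfolding locally_integrable_on_def set_integrable_def
proof (intro allI impI)
  fix K assume K: "compact K" "K \<subseteq> chart_img M i"
  have "(\<lambda>u. V (chart_inv M i u)) \<in> borel_measurable (restrict_space borel (chart_img M i))"
    by (rule borel_measurable_chart_inv[OF V_measurable i])
  then have "(\<lambda>u. indicator K u *\<^sub>R V (chart_inv M i u)) \<in> borel_measurable lborel"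
    by (rule borel_measurable_indicator_compact[OF open_img[OF i] K])
  then have "integrable lborel (\<lambda>u. indicator K u * (indicator K u *\<^sub>R V (chart_inv M i u)))"
    by (rule integrable_mult_bounded(1)[OF integrable_indicator_compact[OF K(1)], where C=B])
       (use V_bound B_nonneg in \<open>auto simp: indicator_def\<close>)
  also have "(\<lambda>u. indicator K u * (indicator K u *\<^sub>R V (chart_inv M i u))) = (\<lambda>u. indicator K u *\<^sub>R V (chart_inv M i u))"
    by (auto simp: indicator_def fun_eq_iff)
  finally show "integrable lborel (\<lambda>u. indicator K u *\<^sub>R V (chart_inv M i u))" .
qed

text \<open>Fubini's theorem reduces the weak equation for \<open>V\<close> to the one for almost every slice of \<open>W\<close>. The metric
  product with \<open>w\<close> is expanded in the basis, so that its measurability and the exchange with the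
  \<open>y\<close>-integral only involve the components of \<open>\<rho> y *\<^sub>R g i x y\<close>.\<close>

theorem weak_gradient_conv: "weak_gradient M V D"
proof (rule weak_gradientI[OF D_vector_field D_locally_integrable])
  fix i w assume i: "i \<in> chart_ix M"
  let ?S = "chart_img M i" and ?inv = "chart_inv M i"
  show "weak_dir_deriv ?S w (\<lambda>u. V (?inv u)) (\<lambda>u. metric M i (?inv u) (D i (?inv u)) w)"
    unfolding weak_dir_deriv_def
  proof (intro conjI ballI V_chart_locally_integrable[OF i] metric_locally_integrable[OF i D_locally_integrable[OF i]])
    fix \<psi> assume \<psi>: "\<psi> \<in> test_functions ?S"
    obtain K where K: "compact K" "K \<subseteq> ?S" "\<And>u. u \<notin> K \<Longrightarrow> \<psi> u = 0"
      "\<And>u w. u \<notin> K \<Longrightarrow> frechet_derivative \<psi> (at u) w = 0" using test_function_support[OF \<psi>] by metis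
    obtain C where C0: "C > 0" and C: "\<And>u. \<bar>\<psi> u\<bar> \<le> C" using test_function_bounded[OF \<psi>] by metis
    obtain C' where C': "\<And>u. \<bar>frechet_derivative \<psi> (at u) w\<bar> \<le> C'" using test_function_deriv_bounded[OF \<psi>] by metis
    note [measurable] = borel_measurable_test_function[OF \<psi>] borel_measurable_test_function_deriv[OF \<psi>]
    have [measurable]: "K \<in> sets borel" using K(1) by (simp add: compact_imp_closed)
    define a where "a u y = \<rho> y * (W (?inv u) y * frechet_derivative \<psi> (at u) w)" for u y
    define b where "b u y = \<rho> y * (metric M i (?inv u) (g i (?inv u) y) w * \<psi> u)" for u y
    have ia: "integrable (lborel \<Otimes>\<^sub>M m) (case_prod a)"
    proof -
      have "integrable (lborel \<Otimes>\<^sub>M m) (\<lambda>(u, y). indicator K u * \<rho> y)"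
      proof (rule Lm.Fubini_integrable)
        show "AE u in lborel. integrable m (\<lambda>y. case (u, y) of (u, y) \<Rightarrow> indicator K u * \<rho> y)"
          using \<rho>_int by simp
        have "integrable lborel (\<lambda>u. indicator K u * (\<integral>y. \<bar>\<rho> y\<bar> \<partial>m))"
          using integrable_indicator_compact[OF K(1)] by simp
        then show "integrable lborel (\<lambda>u. \<integral>y. norm (case (u, y) of (u, y) \<Rightarrow> indicator K u * \<rho> y) \<partial>m)"
          by (simp add: abs_mult)
      qed simp
      moreover have "(\<lambda>p. (case p of (u, y) \<Rightarrow> indicator ?S u * W (?inv u) y) * frechet_derivative \<psi> (at (fst p)) w) \<in> borel_measurable (lborel \<Otimes>\<^sub>M m)"
        using W_chart_measurable[OF i] by measurable
      moreover have "\<bar>(case p of (u, y) \<Rightarrow> indicator ?S u * W (?inv u) y) * frechet_derivative \<psi> (at (fst p)) w\<bar> \<le> B * C'" for p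
        unfolding abs_mult using W_bound C' B_nonneg
        by (intro mult_mono) (auto simp: indicator_def split: prod.split)
      ultimately have "integrable (lborel \<Otimes>\<^sub>M m) (\<lambda>p. (case p of (u, y) \<Rightarrow> indicator K u * \<rho> y)
          * ((case p of (u, y) \<Rightarrow> indicator ?S u * W (?inv u) y) * frechet_derivative \<psi> (at (fst p)) w))"
        by (rule integrable_mult_bounded(1))
      also have "(\<lambda>p. (case p of (u, y) \<Rightarrow> indicator K u * \<rho> y)
          * ((case p of (u, y) \<Rightarrow> indicator ?S u * W (?inv u) y) * frechet_derivative \<psi> (at (fst p)) w)) = case_prod a"
        using K by (auto simp: fun_eq_iff a_def indicator_def)
      finally show ?thesis .
    qed
    define q where "q e u = indicator K u *\<^sub>R metric M i (?inv u) e w * \<psi> u" for e u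
    define X where "X u y = \<rho> y *\<^sub>R (indicator K u *\<^sub>R g i (?inv u) y)" for u y
    have X: "integrable (lborel \<Otimes>\<^sub>M m) (case_prod X)"
      unfolding X_def by (rule \<rho>_g_integrable[OF i K(1,2)])
    obtain c where c: "c > 0" "\<And>u v w. u \<in> K \<Longrightarrow> \<bar>metric M i (?inv u) v w\<bar> \<le> c * norm v * norm w"
      using metric_bound[OF i K(1,2)] by metis
    have q_bound: "\<bar>q e u\<bar> \<le> c * norm e * norm w * C" for e u
    proof (cases "u \<in> K")
      case True
      then show ?thesis unfolding q_def abs_mult using c C C0
        by (intro mult_mono) auto
    qed (use c(1) C0 in \<open>simp add: q_def\<close>)
    have q_meas [measurable]: "q e \<in> borel_measurable borel" for e
    proof -
      have "continuous_on K (\<lambda>u. metric M i (?inv u) e w)"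
        by (rule continuous_on_subset[OF metric_cont[OF i] K(2)])
      then have "(\<lambda>u. metric M i (?inv u) e w) \<in> borel_measurable (restrict_space borel K)"
        by (rule borel_measurable_continuous_on_restrict)
      then have [measurable]: "(\<lambda>u. indicator K u *\<^sub>R metric M i (?inv u) e w) \<in> borel_measurable borel"
        by (subst (asm) borel_measurable_restrict_space_iff) auto
      show ?thesis unfolding q_def by measurable
    qed
    have lin_comb: "metric M i (?inv u) v w * \<psi> u = (\<Sum>e\<in>Basis. ((indicator K u *\<^sub>R v) \<bullet> e) * q e u)" for u v
    proof (cases "u \<in> K")
      case True
      then have "u \<in> ?S" using K(2) by blast
      note bil = metric_bilin[OF i this]
      have lin: "linear (\<lambda>v. metric M i (?inv u) v w)" using bil by (simp add: bilinear_def)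
      have "metric M i (?inv u) v w = (\<Sum>e\<in>Basis. (v \<bullet> e) * metric M i (?inv u) e w)"
        by (subst euclidean_representation[of v, symmetric]) (simp add: linear_sum[OF lin] linear_scale[OF lin])
      then show ?thesis using True by (simp add: q_def sum_distrib_right mult.assoc)
    qed (simp add: K(3))
    have b_eq: "b u y = (\<Sum>e\<in>Basis. (X u y \<bullet> e) * q e u)" for u y
      unfolding b_def lin_comb X_def by (cases "u \<in> K") (simp_all add: sum_distrib_left mult_ac)
    have ib: "integrable (lborel \<Otimes>\<^sub>M m) (case_prod b)"
    proof -
      have "integrable (lborel \<Otimes>\<^sub>M m) (\<lambda>p. (case_prod X p \<bullet> e) * q e (fst p))" for e
        by (rule integrable_mult_bounded(1)[where C="c * norm e * norm w * C"])
           (use X q_bound in \<open>auto intro!: integrable_inner_left\<close>)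
      then have "integrable (lborel \<Otimes>\<^sub>M m) (\<lambda>p. \<Sum>e\<in>Basis. (case_prod X p \<bullet> e) * q e (fst p))" by simp
      also have "(\<lambda>p. \<Sum>e\<in>Basis. (case_prod X p \<bullet> e) * q e (fst p)) = case_prod b"
        by (auto simp: fun_eq_iff b_eq)
      finally show ?thesis .
    qed
    have b_int: "AE u in lborel. (\<integral>y. b u y \<partial>m) = metric M i (?inv u) (D i (?inv u)) w * \<psi> u"
      using Lm.AE_integrable_fst'[OF X]
    proof eventually_elim
      case (elim u)
      then have Xu: "integrable m (X u)" by simp
      have "(\<integral>y. b u y \<partial>m) = (\<Sum>e\<in>Basis. (\<integral>y. X u y \<bullet> e \<partial>m) * q e u)"
        unfolding b_eq using Xu by (subst Bochner_Integration.integral_sum) (auto intro!: integrable_mult_left integrable_inner_left)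
      also have "\<dots> = (\<Sum>e\<in>Basis. ((indicator K u *\<^sub>R D i (?inv u)) \<bullet> e) * q e u)"
      proof -
        have "(\<integral>y. X u y \<partial>m) = indicator K u *\<^sub>R D i (?inv u)" unfolding X_def by (rule integral_indicator_D)
        then show ?thesis using integral_inner_left[of _ m "X u"] Xu by simp
      qed
      finally show ?case by (simp add: lin_comb)
    qed
    have "(LINT u|lborel. V (?inv u) * frechet_derivative \<psi> (at u) w) = (LINT u|lborel. \<integral>y. a u y \<partial>m)"
    proof (rule Bochner_Integration.integral_cong[OF refl])
      fix u
      have "a u y = (W (?inv u) y * \<rho> y) * frechet_derivative \<psi> (at u) w" for y by (simp add: a_def)
      then show "V (?inv u) * frechet_derivative \<psi> (at u) w = (\<integral>y. a u y \<partial>m)" by (simp add: conv_def)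
    qed
    also have "\<dots> = (\<integral>y. (LINT u|lborel. a u y) \<partial>m)" by (rule Lm.Fubini_integral[OF ia, symmetric])
    also have "\<dots> = (\<integral>y. - (LINT u|lborel. b u y) \<partial>m)"
    proof (rule integral_cong_AE)
      show "AE y in m. (LINT u|lborel. a u y) = - (LINT u|lborel. b u y)"
        using W_weak_slice[OF i \<psi>, of w]
      proof eventually_elim
        case (elim y)
        have "(LINT u|lborel. a u y) + (LINT u|lborel. b u y) = \<rho> y * ((LINT u|lborel. W (?inv u) y * frechet_derivative \<psi> (at u) w)
            + (LINT u|lborel. metric M i (?inv u) (g i (?inv u) y) w * \<psi> u))"
          by (simp add: a_def b_def distrib_left)
        with elim show ?case by simp
      qed
      show "(\<lambda>y. LINT u|lborel. a u y) \<in> borel_measurable m"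
        by (rule borel_measurable_integrable[OF Lm.integrable_snd[OF ia]])
      show "(\<lambda>y. - (LINT u|lborel. b u y)) \<in> borel_measurable m"
        using borel_measurable_integrable[OF Lm.integrable_snd[OF ib]] by simp
    qed
    also have "\<dots> = - (LINT u|lborel. \<integral>y. b u y \<partial>m)" using Lm.Fubini_integral[OF ib] by simp
    also have "(LINT u|lborel. \<integral>y. b u y \<partial>m) = (LINT u|lborel. metric M i (?inv u) (D i (?inv u)) w * \<psi> u)"
    proof (rule integral_cong_AE[OF _ _ b_int])
      show "(\<lambda>u. \<integral>y. b u y \<partial>m) \<in> borel_measurable lborel"
        using borel_measurable_integrable[OF Lm.integrable_fst'[OF ib]] by simp
      show "(\<lambda>u. metric M i (?inv u) (D i (?inv u)) w * \<psi> u) \<in> borel_measurable lborel"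
        by (rule borel_measurable_integrable[OF locally_integrable_mult_test_function(1)[OF metric_locally_integrable[OF i D_locally_integrable[OF i]] \<psi>]])
    qed
    finally show "(LINT u:?S|lborel. V (?inv u) * frechet_derivative \<psi> (at u) w)
        = - (LINT u:?S|lborel. metric M i (?inv u) (D i (?inv u)) w * \<psi> u)"
      using set_integral_test_function[OF \<psi> order_refl] by simp
  qed
qed

text \<open>Pairing \<open>D\<close> with itself under the integral sign and applying \<open>metric_AM_GM\<close> with weight \<open>1/\<Lambda>\<close>, where
  \<open>\<Lambda>\<close> is the integral of \<open>\<rho>\<^sup>2\<close>, bounds \<open>2 |D|\<^sup>2\<close> by \<open>|D|\<^sup>2\<close> plus \<open>\<Lambda>\<close> times the integral of \<open>R\<close> over the second
  variable; one copy of \<open>|D|\<^sup>2\<close> is absorbed.\<close>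

theorem conv_grad_square_integrable: "integrable m (rinner M D D)"
proof -
  define \<Lambda> where "\<Lambda> = (\<integral>x. (\<rho> x)\<^sup>2 \<partial>m)"
  have \<Lambda>: "\<Lambda> > 0"
  proof (rule ccontr)
    assume "\<not> \<Lambda> > 0"
    moreover have "\<Lambda> \<ge> 0" unfolding \<Lambda>_def by simp
    ultimately have "(\<integral>x. (\<rho> x)\<^sup>2 \<partial>m) = 0" unfolding \<Lambda>_def by linarith
    then have "AE x in m. (\<rho> x)\<^sup>2 = 0"
      using integral_nonneg_eq_0_iff_AE[OF \<rho>_sq] by simp
    then have "(\<integral>x. \<rho> x \<partial>m) = (\<integral>x. 0 \<partial>m)" by (intro integral_cong_AE) auto
    with \<rho>_one show False by simp
  qed
  have bound: "AE x in m. norm (rinner M D D x) \<le> norm (\<Lambda> * (\<integral>y. R (x, y) \<partial>m))"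
    using mm.AE_integrable_fst'[OF gradW(2)]
  proof eventually_elim
    case (elim x)
    define i where "i = chart_at M x"
    have i: "i \<in> chart_ix M" and x: "x \<in> chart_dom M i" using chart_at by (auto simp: i_def)
    note bil = metric_at(1)[OF i x]
    have R0: "0 \<le> (\<integral>y. R (x, y) \<partial>m)" by (rule Bochner_Integration.integral_nonneg) (rule R_nonneg)
    let ?d = "D i x"
    have "metric M i x ?d ?d \<le> \<Lambda> * (\<integral>y. R (x, y) \<partial>m)"
    proof (cases "integrable m (\<lambda>y. \<rho> y *\<^sub>R g i x y)")
      case False
      then have "?d = 0" by (simp add: conv_grad_def not_integrable_integral_eq)
      then show ?thesis using R0 \<Lambda> by (simp add: bilinear_lzero[OF bil])
    next
      case True
      have T: "bounded_linear (metric M i x ?d)" using bil by (simp add: bilinear_def linear_conv_bounded_linear)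
      have "2 * metric M i x ?d ?d = (\<integral>y. 2 * metric M i x ?d (\<rho> y *\<^sub>R g i x y) \<partial>m)"
        using integral_bounded_linear[OF T True] by (simp add: conv_grad_def)
      also have "\<dots> \<le> (\<integral>y. (\<rho> y)\<^sup>2 * (metric M i x ?d ?d / \<Lambda>) + \<Lambda> * R (x, y) \<partial>m)"
      proof (rule integral_mono)
        show "integrable m (\<lambda>y. 2 * metric M i x ?d (\<rho> y *\<^sub>R g i x y))"
          by (intro integrable_mult_right integrable_bounded_linear[OF T True])
        show "integrable m (\<lambda>y. (\<rho> y)\<^sup>2 * (metric M i x ?d ?d / \<Lambda>) + \<Lambda> * R (x, y))"
          using \<rho>_sq elim by simp
        fix y
        have "2 * metric M i x ?d (\<rho> y *\<^sub>R g i x y) = 2 * metric M i x (\<rho> y *\<^sub>R ?d) (g i x y)"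
          by (simp add: bilinear_lmul[OF bil] bilinear_rmul[OF bil])
        also have "\<dots> \<le> 2 * \<bar>metric M i x (\<rho> y *\<^sub>R ?d) (g i x y)\<bar>" by simp
        also have "\<dots> \<le> (1 / \<Lambda>) * metric M i x (\<rho> y *\<^sub>R ?d) (\<rho> y *\<^sub>R ?d) + metric M i x (g i x y) (g i x y) / (1 / \<Lambda>)"
          by (rule metric_AM_GM[OF i x]) (use \<Lambda> in simp)
        also have "\<dots> = (\<rho> y)\<^sup>2 * (metric M i x ?d ?d / \<Lambda>) + \<Lambda> * metric M i x (g i x y) (g i x y)"
          by (simp add: bilinear_lmul[OF bil] bilinear_rmul[OF bil] power2_eq_square)
        also have "\<dots> \<le> (\<rho> y)\<^sup>2 * (metric M i x ?d ?d / \<Lambda>) + \<Lambda> * R (x, y)"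
          using \<Lambda> by (intro add_left_mono mult_left_mono g_le_R[OF i x]) simp
        finally show "2 * metric M i x ?d (\<rho> y *\<^sub>R g i x y) \<le> (\<rho> y)\<^sup>2 * (metric M i x ?d ?d / \<Lambda>) + \<Lambda> * R (x, y)" .
      qed
      also have "\<dots> = \<Lambda> * (metric M i x ?d ?d / \<Lambda>) + \<Lambda> * (\<integral>y. R (x, y) \<partial>m)"
        using \<rho>_sq elim by (simp add: \<Lambda>_def)
      finally show ?thesis using \<Lambda> by simp
    qed
    moreover have "rinner M D D x = metric M i x ?d ?d" by (simp add: rinner_def i_def)
    ultimately show ?case using rinner_nonneg[of D x] R0 \<Lambda> by simp
  qed
  show ?thesis
  proof (rule Bochner_Integration.integrable_bound[OF _ _ bound])
    show "integrable m (\<lambda>x. \<Lambda> * (\<integral>y. R (x, y) \<partial>m))"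
      using mm.integrable_fst'[OF gradW(2)] by simp
    show "rinner M D D \<in> borel_measurable m"
      using rinner_measurable[OF D_vector_field D_measurable D_vector_field D_measurable]
      by (simp add: measurable_cong_sets[OF sets_m refl])
  qed
qed

end

section \<open>Weak solutions and the Gibbs map\<close>

lemma abs_div_one_plus_square_le: "\<bar>t\<bar> / (1 + t\<^sup>2) \<le> 1" for t :: real
proof -
  have "2 * (\<bar>t\<bar> * 1) \<le> \<bar>t\<bar>\<^sup>2 + 1\<^sup>2" using sum_squares_bound[of "\<bar>t\<bar>" 1] by simp
  then have "\<bar>t\<bar> \<le> 1 + t\<^sup>2" using abs_ge_zero[of t] unfolding power2_abs by simp
  then show ?thesis by (simp add: divide_le_eq add_pos_nonneg)
qed

lemma exp_scaled_le:
  fixes v \<gamma> B :: real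
  assumes "\<gamma> > 0" "\<bar>v\<bar> \<le> B"
  shows "exp (\<gamma> * v) \<le> exp (\<gamma> * B)" "exp (- \<gamma> * v) \<le> exp (\<gamma> * B)"
proof -
  have "\<gamma> * v \<le> \<gamma> * B" "\<gamma> * (- v) \<le> \<gamma> * B" using assms by (intro mult_left_mono; simp add: abs_le_iff)+
  then show "exp (\<gamma> * v) \<le> exp (\<gamma> * B)" "exp (- \<gamma> * v) \<le> exp (\<gamma> * B)" by simp_all
qed

context interaction_potential
begin

lemma rinner_add_scale:
  "rinner M (\<lambda>i x. a x *\<^sub>R X i x + b x *\<^sub>R Y i x) Z x = a x * rinner M X Z x + b x * rinner M Y Z x"
  "rinner M (\<lambda>i x. a x *\<^sub>R X i x) Z x = a x * rinner M X Z x"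
  using metric_at(1)[OF chart_at, of x] by (simp_all add: rinner_def bilinear_ladd bilinear_lmul)

lemma rinner_commute: "rinner M X Y x = rinner M Y X x"
  unfolding rinner_def using metric_sym[OF chart_at] .

lemma rinner_scale_add_square:
  "rinner M (\<lambda>i x. a x *\<^sub>R X i x + b x *\<^sub>R Y i x) (\<lambda>i x. a x *\<^sub>R X i x + b x *\<^sub>R Y i x) x
    = (a x)\<^sup>2 * rinner M X X x + 2 * a x * b x * rinner M X Y x + (b x)\<^sup>2 * rinner M Y Y x"
  unfolding rinner_add_scale(1) rinner_commute[of _ "\<lambda>i x. a x *\<^sub>R X i x + b x *\<^sub>R Y i x"]
  unfolding rinner_add_scale(1) rinner_commute[of Y X] by (simp add: power2_eq_square algebra_simps)

lemma H1_field:
  assumes "\<phi> \<in> H1 M m"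
  shows "vector_field M (grad M \<phi>)" "chart_measurable (grad M \<phi>)" "integrable m (rinner M (grad M \<phi>) (grad M \<phi>))"
    "weak_gradient M \<phi> (grad M \<phi>)"
  using H1_grad[OF assms] weak_gradient_measurable by (auto simp: weak_gradient_def)

text \<open>The chain rule gives the weak gradient \<open>- \<gamma> \<rho> D\<close> for the Gibbs density, so the two integrands of the
  weak equation cancel almost everywhere. The drift is integrable because the density is bounded.\<close>

lemma gibbs_imp_weak_solution:
  assumes \<rho>: "\<rho> \<in> H1 M m" and \<rho>1: "\<rho> \<in> P_ac m" and \<gamma>: "\<gamma> > 0" and gibbs: "gibbs_zero m W \<gamma> \<rho>"
  shows "weak_solution M m W \<gamma> \<rho>"
proof -
  define Z where "Z = partition_fn m W \<gamma> \<rho>"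
  have Z: "Z > 0" unfolding Z_def by (rule gibbs_zero_partition_fn_pos[OF \<rho>1 gibbs])
  define p where "p v = 1 / Z * exp (- \<gamma> * v)" for v
  have \<rho>p: "AE x in m. \<rho> x = p (V x)" using gibbs by (simp add: gibbs_zero_def p_def Z_def)
  have p0: "p v \<ge> 0" for v using Z by (simp add: p_def)
  have p_le: "p v \<le> exp (\<gamma> * B) / Z" if "\<bar>v\<bar> \<le> B" for v
    using exp_scaled_le(2)[OF \<gamma> that] Z by (simp add: p_def divide_right_mono)
  have p_cont: "continuous_on UNIV (\<lambda>x. p (snd x))" for S unfolding p_def by (intro continuous_intros)
  define C where "C = (1 + \<gamma>) * (exp (\<gamma> * B) / Z)"
  have C: "exp (\<gamma> * B) / Z \<le> C" "\<gamma> * (exp (\<gamma> * B) / Z) \<le> C" "0 \<le> C"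
  proof -
    define e where "e = exp (\<gamma> * B) / Z"
    have e: "0 \<le> e" "0 \<le> \<gamma> * e" using \<gamma> Z by (auto simp: e_def)
    have "C = e + \<gamma> * e" by (simp add: C_def e_def[symmetric] distrib_right)
    with e show "exp (\<gamma> * B) / Z \<le> C" "\<gamma> * (exp (\<gamma> * B) / Z) \<le> C" "0 \<le> C"
      unfolding e_def[symmetric] by linarith+
  qed
  have wg: "weak_gradient M (\<lambda>x. p (V x)) (\<lambda>i x. 0 *\<^sub>R D i x + (- \<gamma> * p (V x)) *\<^sub>R D i x)"
  proof (rule weak_gradient_chain[OF weak_gradient_conv weak_gradient_conv B_nonneg V_bound,
        where G="\<lambda>r v. p v" and ?G1.0="\<lambda>r v. 0" and ?G2.0="\<lambda>r v. - \<gamma> * p v" and C=C])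
    show "((\<lambda>v. p v) has_real_derivative - \<gamma> * p v) (at v)" for v
      unfolding p_def using Z by (auto intro!: derivative_eq_intros)
    show "continuous_on UNIV (\<lambda>x. p (snd x))" "continuous_on UNIV (\<lambda>x. - \<gamma> * p (snd x))"
      using p_cont by (auto intro!: continuous_intros)
    show "\<bar>p v\<bar> \<le> C" if "\<bar>v\<bar> \<le> B" for v
      using p0[of v] p_le[OF that] C(1) by simp
    show "\<bar>- \<gamma> * p v\<bar> \<le> C" if "\<bar>v\<bar> \<le> B" for v
    proof -
      have "\<gamma> * p v \<le> \<gamma> * (exp (\<gamma> * B) / Z)" using p_le[OF that] \<gamma> by (intro mult_left_mono) auto
      then show ?thesis using p0[of v] \<gamma> C(2) by (simp add: abs_mult)
    qed
    show "\<bar>0\<bar> \<le> C" using C(3) by simp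
  qed simp_all
  have grad_eq: "AE x in m. grad M \<rho> (chart_at M x) x = 0 *\<^sub>R D (chart_at M x) x + (- \<gamma> * p (V x)) *\<^sub>R D (chart_at M x) x"
    by (rule weak_gradient_unique[OF H1_field(4)[OF \<rho>] wg]) (rule AE_chart_inv[OF _ \<rho>p])
  show ?thesis
    unfolding weak_solution_def
  proof (intro conjI ballI)
    show "\<rho> \<in> H1 M m \<inter> P_ac m" using \<rho> \<rho>1 by simp
    fix \<phi> assume \<phi>: "\<phi> \<in> H1 M m"
    note F = H1_field[OF \<phi>]
    have int: "integrable m (rinner M (grad M \<phi>) D)"
      by (rule rinner_integrable[OF F(1-3) D_vector_field D_measurable conv_grad_square_integrable])
    have [measurable]: "(\<lambda>x. p (V x)) \<in> borel_measurable m"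
      using V_measurable unfolding p_def by (simp add: measurable_cong_sets[OF sets_m refl])
    have [measurable]: "rinner M (grad M \<phi>) D \<in> borel_measurable m" using int by auto
    have "integrable m (\<lambda>x. rinner M (grad M \<phi>) D x * p (V x))"
    proof (rule integrable_mult_bounded(1)[OF int])
      show "\<bar>p (V x)\<bar> \<le> exp (\<gamma> * B) / Z" for x using p0[of "V x"] p_le[OF V_bound] by simp
    qed measurable
    then show i2: "integrable m (rinner M (\<lambda>i x. \<rho> x *\<^sub>R grad M \<phi> i x) D)"
    proof (rule integrable_cong_AE_imp)
      show "AE x in m. rinner M (grad M \<phi>) D x * p (V x) = rinner M (\<lambda>i x. \<rho> x *\<^sub>R grad M \<phi> i x) D x"
        using \<rho>p by eventually_elim (simp add: rinner_add_scale(2))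
      show "rinner M (\<lambda>i x. \<rho> x *\<^sub>R grad M \<phi> i x) D \<in> borel_measurable m"
        by (simp add: rinner_add_scale(2)[abs_def])
    qed
    have i1: "integrable m (rinner M (grad M \<rho>) (grad M \<phi>))"
      by (rule rinner_integrable[OF H1_field(1-3)[OF \<rho>] F(1-3)])
    have "(\<integral>x. rinner M (grad M \<rho>) (grad M \<phi>) x \<partial>m) = (\<integral>x. - \<gamma> * rinner M (\<lambda>i x. \<rho> x *\<^sub>R grad M \<phi> i x) D x \<partial>m)"
    proof (rule integral_cong_AE)
      show "AE x in m. rinner M (grad M \<rho>) (grad M \<phi>) x = - \<gamma> * rinner M (\<lambda>i x. \<rho> x *\<^sub>R grad M \<phi> i x) D x"
        using grad_eq \<rho>p
      proof eventually_elim
        case (elim x)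
        have "rinner M (grad M \<rho>) (grad M \<phi>) x = rinner M (\<lambda>i x. (- \<gamma> * p (V x)) *\<^sub>R D i x) (grad M \<phi>) x"
          using elim(1) by (simp add: rinner_def)
        also have "\<dots> = - \<gamma> * (\<rho> x * rinner M D (grad M \<phi>) x)"
          unfolding rinner_add_scale(2) elim(2) by simp
        finally show ?case by (simp add: rinner_add_scale(2) rinner_commute[of D])
      qed
    qed (use i1 i2 in auto)
    then show "inverse \<gamma> * (\<integral>x. rinner M (grad M \<rho>) (grad M \<phi>) x \<partial>m) + (\<integral>x. rinner M (\<lambda>i x. \<rho> x *\<^sub>R grad M \<phi> i x) D x \<partial>m) = 0"
      using \<gamma> by simp
  qed
qed

text \<open>The test function \<open>\<phi> = arctan (\<rho> e\<^sup>\<gamma>\<^sup>V)\<close> has the gradient \<open>Y = G1 (\<nabla>\<rho> + \<gamma> \<rho> D)\<close>. Both coefficients \<open>G1\<close> and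
  \<open>G2 = \<gamma> \<rho> G1\<close> are bounded, the second by \<open>\<gamma>\<close>, whatever the size of \<open>\<rho>\<close>; hence \<open>\<phi>\<close> is admissible.\<close>

lemma weak_solution_imp_gibbs:
  assumes conn: "connected (UNIV :: 'm set)" and \<gamma>: "\<gamma> > 0" and weak: "weak_solution M m W \<gamma> \<rho>"
  shows "gibbs_zero m W \<gamma> \<rho>"
proof -
  have \<rho>: "\<rho> \<in> H1 M m" and \<rho>1: "\<rho> \<in> P_ac m" using weak by (auto simp: weak_solution_def)
  note F = H1_field[OF \<rho>]
  let ?E = "\<lambda>v. exp (\<gamma> * v)"
  define G1 where "G1 r v = ?E v / (1 + (r * ?E v)\<^sup>2)" for r v
  define G2 where "G2 r v = \<gamma> * r * G1 r v" for r v
  have den: "1 + (r * ?E v)\<^sup>2 > 0" for r v by (simp add: add_pos_nonneg)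
  have G1_pos: "G1 r v > 0" for r v using den by (simp add: G1_def)
  have G1_le: "G1 r v \<le> exp (\<gamma> * B)" if "\<bar>v\<bar> \<le> B" for r v
  proof -
    have "G1 r v \<le> ?E v" unfolding G1_def using den[of r v] by (simp add: divide_le_eq mult_le_cancel_left1)
    also have "\<dots> \<le> exp (\<gamma> * B)" by (rule exp_scaled_le(1)[OF \<gamma> that])
    finally show ?thesis .
  qed
  have G2_le: "\<bar>G2 r v\<bar> \<le> \<gamma>" for r v
  proof -
    have "\<bar>G2 r v\<bar> = \<gamma> * (\<bar>r * ?E v\<bar> / (1 + (r * ?E v)\<^sup>2))"
      using \<gamma> den[of r v] by (simp add: G2_def G1_def abs_mult)
    also have "\<dots> \<le> \<gamma> * 1" using \<gamma> by (intro mult_left_mono abs_div_one_plus_square_le) auto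
    finally show ?thesis by simp
  qed
  define C where "C = 2 + exp (\<gamma> * B) + \<gamma>"
  have C: "2 \<le> C" "exp (\<gamma> * B) \<le> C" "\<gamma> \<le> C" using \<gamma> by (auto simp: C_def)
  have arctan2: "\<bar>arctan t\<bar> \<le> 2" for t
    using arctan_lbound[of t] arctan_ubound[of t] pi_less_4 by linarith
  define \<phi> where "\<phi> x = arctan (\<rho> x * ?E (V x))" for x
  define Y where "Y i x = G1 (\<rho> x) (V x) *\<^sub>R grad M \<rho> i x + G2 (\<rho> x) (V x) *\<^sub>R D i x" for i x
  have Y: "weak_gradient M \<phi> Y"
    unfolding \<phi>_def Y_def
  proof (rule weak_gradient_chain[OF F(4) weak_gradient_conv B_nonneg V_bound,
        where G="\<lambda>r v. arctan (r * ?E v)" and C=C])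
    show "((\<lambda>r. arctan (r * ?E v)) has_real_derivative G1 r v) (at r)" for r v
      unfolding G1_def by (auto intro!: derivative_eq_intros simp: field_simps)
    show "((\<lambda>v. arctan (r * ?E v)) has_real_derivative G2 r v) (at v)" for r v
      unfolding G1_def G2_def by (auto intro!: derivative_eq_intros simp: field_simps)
    show "continuous_on UNIV (\<lambda>x. arctan (fst x * ?E (snd x)))" by (intro continuous_intros)
    have c1: "continuous_on UNIV (\<lambda>x. G1 (fst x) (snd x))" unfolding G1_def
      by (intro continuous_intros ballI less_imp_neq[OF den, symmetric])
    then show "continuous_on UNIV (\<lambda>x. G1 (fst x) (snd x))" .
    show "continuous_on UNIV (\<lambda>x. G2 (fst x) (snd x))" unfolding G2_def by (intro continuous_intros c1)
    show "\<bar>arctan (r * ?E v)\<bar> \<le> C" for r v using arctan2 C(1) by (rule order_trans)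
    show "\<bar>G1 r v\<bar> \<le> C" if "\<bar>v\<bar> \<le> B" for r v
      using G1_pos[of r v] order_trans[OF G1_le[OF that] C(2)] by simp
    show "\<bar>G2 r v\<bar> \<le> C" for r v using G2_le C(3) by (rule order_trans)
  qed
  have Yvf: "vector_field M Y" using Y by (simp add: weak_gradient_def)
  have Ym: "chart_measurable Y" by (rule weak_gradient_measurable[OF Y])
  have [measurable]: "V \<in> borel_measurable m" using V_measurable by (simp add: measurable_cong_sets[OF sets_m refl])
  have Y_int: "integrable m (rinner M Y Y)"
  proof (rule Bochner_Integration.integrable_bound)
    show "integrable m (\<lambda>x. 2 * C\<^sup>2 * rinner M (grad M \<rho>) (grad M \<rho>) x + 2 * C\<^sup>2 * rinner M D D x)"
      using F(3) conv_grad_square_integrable by simp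
    show "rinner M Y Y \<in> borel_measurable m"
      using rinner_measurable[OF Yvf Ym Yvf Ym] by (simp add: measurable_cong_sets[OF sets_m refl])
    show "AE x in m. norm (rinner M Y Y x) \<le> norm (2 * C\<^sup>2 * rinner M (grad M \<rho>) (grad M \<rho>) x + 2 * C\<^sup>2 * rinner M D D x)"
    proof (rule AE_I2)
      fix x
      let ?a = "G1 (\<rho> x) (V x)" and ?b = "G2 (\<rho> x) (V x)"
      let ?A = "rinner M (grad M \<rho>) (grad M \<rho>) x" and ?B = "rinner M D D x" and ?AB = "rinner M (grad M \<rho>) D x"
      have "0 \<le> rinner M (\<lambda>i x. G1 (\<rho> x) (V x) *\<^sub>R grad M \<rho> i x + (- G2 (\<rho> x) (V x)) *\<^sub>R D i x)
          (\<lambda>i x. G1 (\<rho> x) (V x) *\<^sub>R grad M \<rho> i x + (- G2 (\<rho> x) (V x)) *\<^sub>R D i x) x"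
        by (rule rinner_nonneg)
      then have "2 * ?a * ?b * ?AB \<le> ?a\<^sup>2 * ?A + ?b\<^sup>2 * ?B"
        unfolding rinner_scale_add_square by simp
      moreover have "rinner M Y Y x = ?a\<^sup>2 * ?A + 2 * ?a * ?b * ?AB + ?b\<^sup>2 * ?B"
        unfolding Y_def by (rule rinner_scale_add_square)
      moreover have "?a\<^sup>2 * ?A \<le> C\<^sup>2 * ?A" "?b\<^sup>2 * ?B \<le> C\<^sup>2 * ?B"
      proof -
        have "\<bar>?a\<bar> \<le> C" using G1_pos[of "\<rho> x" "V x"] order_trans[OF G1_le[OF V_bound] C(2)] by simp
        then have "?a\<^sup>2 \<le> C\<^sup>2" using C(1) by (intro abs_le_square_iff[THEN iffD1]) simp
        then show "?a\<^sup>2 * ?A \<le> C\<^sup>2 * ?A" by (rule mult_right_mono[OF _ rinner_nonneg])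
        have "\<bar>?b\<bar> \<le> C" using G2_le C(3) by (rule order_trans)
        then have "?b\<^sup>2 \<le> C\<^sup>2" using C(1) by (intro abs_le_square_iff[THEN iffD1]) simp
        then show "?b\<^sup>2 * ?B \<le> C\<^sup>2 * ?B" by (rule mult_right_mono[OF _ rinner_nonneg])
      qed
      ultimately show "norm (rinner M Y Y x) \<le> norm (2 * C\<^sup>2 * ?A + 2 * C\<^sup>2 * ?B)"
        using rinner_nonneg[of Y x] unfolding real_norm_def by linarith
    qed
  qed
  have \<phi>H: "\<phi> \<in> H1 M m"
  proof -
    have m: "\<phi> \<in> borel_measurable m" unfolding \<phi>_def by measurable
    have "integrable m (\<lambda>x. (\<phi> x)\<^sup>2)"
    proof (rule integrable_const_bound[where B=4])
      show "AE x in m. norm ((\<phi> x)\<^sup>2) \<le> 4"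
      proof (rule AE_I2)
        fix x
        have "\<bar>\<phi> x\<bar> \<le> \<bar>2\<bar>" unfolding \<phi>_def using arctan2 by simp
        then have "(\<phi> x)\<^sup>2 \<le> 2\<^sup>2" by (simp only: abs_le_square_iff)
        then show "norm ((\<phi> x)\<^sup>2) \<le> 4" by simp
      qed
    qed (use m in measurable)
    with m Y Y_int show ?thesis by (auto simp: H1_def)
  qed
  note \<phi>F = H1_field[OF \<phi>H]
  have gradY: "AE x in m. grad M \<phi> (chart_at M x) x = Y (chart_at M x) x"
    by (rule weak_gradient_unique[OF \<phi>F(4) Y]) simp
  have i1: "integrable m (rinner M (grad M \<rho>) (grad M \<phi>))"
    by (rule rinner_integrable[OF F(1-3) \<phi>F(1-3)])
  have i2: "integrable m (rinner M (\<lambda>i x. \<rho> x *\<^sub>R grad M \<phi> i x) D)"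
    and eq: "inverse \<gamma> * (\<integral>x. rinner M (grad M \<rho>) (grad M \<phi>) x \<partial>m) + (\<integral>x. rinner M (\<lambda>i x. \<rho> x *\<^sub>R grad M \<phi> i x) D x \<partial>m) = 0"
    using weak \<phi>H by (auto simp: weak_solution_def)
  define J where "J x = inverse \<gamma> * rinner M (grad M \<rho>) (grad M \<phi>) x + rinner M (\<lambda>i x. \<rho> x *\<^sub>R grad M \<phi> i x) D x" for x
  have J: "integrable m J" "(\<integral>x. J x \<partial>m) = 0" unfolding J_def using i1 i2 eq by simp_all
  \<comment> \<open>\<open>Y\<close> is the multiple \<open>G1 (\<rho> x) (V x)\<close> of the flux \<open>grad \<rho> + \<gamma> \<rho> D\<close>, so the
    integrand of the weak equation is a nonnegative multiple of its square.\<close>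
  have JY: "AE x in m. \<gamma> * G1 (\<rho> x) (V x) * J x = rinner M Y Y x"
    using gradY
  proof eventually_elim
    case (elim x)
    let ?a = "G1 (\<rho> x) (V x)"
    have e: "rinner M (grad M \<rho>) (grad M \<phi>) x = rinner M (grad M \<rho>) Y x"
      "rinner M (\<lambda>i x. \<rho> x *\<^sub>R grad M \<phi> i x) D x = rinner M (\<lambda>i x. \<rho> x *\<^sub>R Y i x) D x"
      using elim by (simp_all add: rinner_def)
    have 1: "\<gamma> * J x = rinner M (grad M \<rho>) Y x + \<gamma> * \<rho> x * rinner M Y D x"
      using \<gamma> unfolding J_def e unfolding rinner_add_scale(2) by (simp add: distrib_left)
    have 2: "rinner M Y Y x = ?a * rinner M (grad M \<rho>) Y x + G2 (\<rho> x) (V x) * rinner M D Y x"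
      using rinner_add_scale(1)[of "\<lambda>x. G1 (\<rho> x) (V x)" "grad M \<rho>" "\<lambda>x. G2 (\<rho> x) (V x)" D Y x] by (simp add: Y_def[abs_def])
    have "\<gamma> * ?a * J x = ?a * (\<gamma> * J x)" by simp
    then show ?case unfolding 1 2 by (simp add: G2_def rinner_commute[of D Y] algebra_simps)
  qed
  have "AE x in m. 0 \<le> J x"
    using JY
  proof eventually_elim
    case (elim x)
    have "0 \<le> (\<gamma> * G1 (\<rho> x) (V x)) * J x" using elim rinner_nonneg[of Y x] by simp
    moreover have "0 < \<gamma> * G1 (\<rho> x) (V x)" using \<gamma> G1_pos by simp
    ultimately show ?case by (simp add: zero_le_mult_iff)
  qed
  then have "AE x in m. J x = 0" using integral_nonneg_eq_0_iff_AE[OF J(1)] J(2) by simp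
  with JY have "AE x in m. rinner M Y Y x = 0" by eventually_elim simp
  from weak_gradient_zero_imp_const[OF conn Y this]
  obtain c where c: "AE x in m. \<phi> x = c" by blast
  then have "AE x in m. \<rho> x = tan c * exp (- \<gamma> * V x)"
  proof eventually_elim
    case (elim x)
    then have "\<rho> x * ?E (V x) = tan c" by (simp add: \<phi>_def tan_arctan flip: elim)
    then show ?case by (simp add: exp_minus field_simps)
  qed
  then show ?thesis by (rule gibbs_zero_if_proportional[OF \<rho>1])
qed

end

theorem proposition2p5:
  fixes M :: "('i, 'm::{t2_space, second_countable_topology}, real ^ 'n) riem"
    and m :: "'m measure"
    and W :: "'m \<Rightarrow> 'm \<Rightarrow> real"
    and \<rho> :: "'m \<Rightarrow> real"
    and \<gamma> :: real
  assumes "riemannian_manifold M"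
    and "compact (UNIV :: 'm set)"
    and "connected (UNIV :: 'm set)"
    and "riemannian_volume M m"
    and "continuous_on UNIV (\<lambda>(x, y). W x y)"
    and "bounded (range (\<lambda>(x, y). W x y))"
    and "(\<lambda>(x, y). W x y) \<in> H1 (prod_riem M M) (m \<Otimes>\<^sub>M m)"
    and "\<And>x y. W x y = W y x"
    and "\<rho> \<in> H1 M m \<inter> P_ac_pos m"
    and "\<gamma> > 0"
  shows "(weak_solution M m W \<gamma> \<rho> \<longleftrightarrow> gibbs_zero m W \<gamma> \<rho>) \<and>
         (gibbs_zero m W \<gamma> \<rho> \<longleftrightarrow> critical_point m W \<gamma> \<rho>)"
proof -
  obtain B where B: "\<And>x y. \<bar>W x y\<bar> \<le> B"
    using assms(6) by (auto simp: bounded_iff)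
  have \<rho>: "\<rho> \<in> H1 M m" "\<rho> \<in> P_ac_pos m" "\<rho> \<in> P_ac m" and sq: "integrable m (\<lambda>x. (\<rho> x)\<^sup>2)"
    using assms(9) by (auto simp: P_ac_pos_def H1_def)
  interpret riemannian_manifold M by (rule assms(1))
  interpret interaction_potential M m W \<rho> B
    by unfold_locales (use assms(2,4,7) B \<rho>(3) sq in auto)
  have "weak_solution M m W \<gamma> \<rho> \<longleftrightarrow> gibbs_zero m W \<gamma> \<rho>"
    using weak_solution_imp_gibbs[OF assms(3,10)] gibbs_imp_weak_solution[OF \<rho>(1,3) assms(10)] by blast
  moreover have "gibbs_zero m W \<gamma> \<rho> \<longleftrightarrow> critical_point m W \<gamma> \<rho>"
    using gibbs_imp_critical[OF assms(8) \<rho>(2) sq assms(10)] critical_imp_gibbs[OF assms(8) \<rho>(2) sq assms(10)] by blast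
  ultimately show ?thesis by blast
qed

end
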